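(* Let $N\ge 1$ be an integer and let $\Omega$ be a domain in $\mathbb C^2$. Suppose $u: \Omega\rightarrow \mathbb C^N$ with $u\in W_{loc}^{1, 4+\epsilon}(\Omega)$ for some $\epsilon>0$ satisfies $|\bar\partial u| \le V|u|$ a.e. on $\Omega$ for some nonnegative function $V \in L_{loc}^{4}(\Omega)$. If $u$ vanishes to infinite order in the $L^1$ sense at some $z_0\in \Omega$, then $u$ vanishes identically on $\Omega$.
   Context: A domain is a nonempty connected open set. For $u=(u_1,\dots,u_N)$ (componentwise Sobolev, with weak derivatives), $|u| := \left(\sum_{k=1}^N |u_k|^2\right)^{1/2}$ and $|\bar\partial u| := \left(\sum_{j=1}^2\sum_{k=1}^N |\bar\partial_j u_k|^2\right)^{1/2}$, where $\bar\partial_j = \partial/\partial \bar z_j$ is taken in the weak sense. For $q\ge 1$, $u\in L^q_{loc}(\Omega)$ is said to vanish to infinite order in the $L^q$ sense at $z_0\in\Omega$ if for all $m\ge 1$, $\lim_{r\to 0} r^{-m}\int_{|z-z_0|<r}|u(z)|^q\,dv_z = 0$, where $dv$ is Lebesgue measure. "Vanishes identically" means $u=0$ as an element of $L^1_{loc}(\Omega)$, i.e. a.e. on $\Omega$. *)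

theory Defs
  imports "HOL-Analysis.Analysis"
begin

text \<open>A function on the open set \<open>\<Omega>\<close> is represented by a total function of which only the
  values on \<open>\<Omega>\<close> matter; test functions are defined everywhere and vanish off \<open>\<Omega>\<close>.\<close>

primrec Ck :: "nat \<Rightarrow> ('a::euclidean_space \<Rightarrow> 'b::real_normed_vector) \<Rightarrow> bool" where
  "Ck 0 f \<longleftrightarrow> continuous_on UNIV f"
| "Ck (Suc n) f \<longleftrightarrow> (\<forall>x. f differentiable (at x)) \<and>
     (\<forall>v. Ck n (\<lambda>x. frechet_derivative f (at x) v))"

definition test_function :: "'a::euclidean_space set \<Rightarrow> ('a \<Rightarrow> complex) \<Rightarrow> bool" where
  "test_function \<Omega> \<phi> \<longleftrightarrow> (\<forall>n. Ck n \<phi>) \<and>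
     compact (closure {x. \<phi> x \<noteq> 0}) \<and> closure {x. \<phi> x \<noteq> 0} \<subseteq> \<Omega>"

text \<open>Measurability of \<open>f\<close> is a separate condition because integrability of \<open>|f|\<^sup>p\<close>
  does not imply it.\<close>

definition Lp_loc :: "real \<Rightarrow> 'a::euclidean_space set \<Rightarrow> ('a \<Rightarrow> 'b::real_normed_vector) \<Rightarrow> bool" where
  "Lp_loc p \<Omega> f \<longleftrightarrow> f \<in> borel_measurable (lebesgue_on \<Omega>) \<and>
     (\<forall>K. compact K \<and> K \<subseteq> \<Omega> \<longrightarrow> set_integrable lebesgue K (\<lambda>x. norm (f x) powr p))"

definition has_weak_derivative ::
  "'a::euclidean_space set \<Rightarrow> 'a \<Rightarrow> ('a \<Rightarrow> complex) \<Rightarrow> ('a \<Rightarrow> complex) \<Rightarrow> bool" where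
  "has_weak_derivative \<Omega> v f g \<longleftrightarrow> Lp_loc 1 \<Omega> f \<and> Lp_loc 1 \<Omega> g \<and>
     (\<forall>\<phi>. test_function \<Omega> \<phi> \<longrightarrow>
        (LINT x:\<Omega>|lebesgue. f x * frechet_derivative \<phi> (at x) v)
          = - (LINT x:\<Omega>|lebesgue. g x * \<phi> x))"

definition W1p_loc :: "real \<Rightarrow> 'a::euclidean_space set \<Rightarrow> ('a \<Rightarrow> complex) \<Rightarrow> bool" where
  "W1p_loc p \<Omega> f \<longleftrightarrow> Lp_loc p \<Omega> f \<and>
     (\<forall>b\<in>Basis. \<exists>g. Lp_loc p \<Omega> g \<and> has_weak_derivative \<Omega> b f g)"

text \<open>With \<open>z\<^sub>j = x\<^sub>j + \<i> y\<^sub>j\<close>, the classical derivative with respect to the conjugate of \<open>z\<^sub>j\<close> is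
  \<open>(\<partial>/\<partial>x\<^sub>j + \<i> \<partial>/\<partial>y\<^sub>j)/2\<close>; \<open>axis j 1\<close> and \<open>axis j \<i>\<close> are the \<open>x\<^sub>j\<close> and \<open>y\<^sub>j\<close> directions.\<close>

definition dbar :: "'n::finite \<Rightarrow> (complex ^ 'n \<Rightarrow> complex) \<Rightarrow> complex ^ 'n \<Rightarrow> complex" where
  "dbar j \<phi> z = (frechet_derivative \<phi> (at z) (axis j 1)
                  + \<i> * frechet_derivative \<phi> (at z) (axis j \<i>)) / 2"

definition has_weak_dbar ::
  "(complex ^ 'n::finite) set \<Rightarrow> 'n \<Rightarrow> (complex ^ 'n \<Rightarrow> complex) \<Rightarrow> (complex ^ 'n \<Rightarrow> complex) \<Rightarrow> bool" where
  "has_weak_dbar \<Omega> j f g \<longleftrightarrow> Lp_loc 1 \<Omega> f \<and> Lp_loc 1 \<Omega> g \<and>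
     (\<forall>\<phi>. test_function \<Omega> \<phi> \<longrightarrow>
        (LINT z:\<Omega>|lebesgue. f z * dbar j \<phi> z) = - (LINT z:\<Omega>|lebesgue. g z * \<phi> z))"

definition vanishes_to_infinite_order ::
  "real \<Rightarrow> 'a::euclidean_space set \<Rightarrow> ('a \<Rightarrow> 'b::real_normed_vector) \<Rightarrow> 'a \<Rightarrow> bool" where
  "vanishes_to_infinite_order q \<Omega> u z0 \<longleftrightarrow> Lp_loc q \<Omega> u \<and> z0 \<in> \<Omega> \<and>
     (\<forall>m::nat. 1 \<le> m \<longrightarrow>
        ((\<lambda>r. (LINT z:ball z0 r|lebesgue. norm (u z) powr q) / r ^ m) \<longlongrightarrow> 0) (at_right 0))"

end

theory Submission
  imports Defs
begin

text \<open>
The proof restricts the inequality to the complex lines through the point \<open>z0\<close>. In the coordinates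
\<open>z = z0 + (w, w s)\<close> the function \<open>v w = u (z0 + (w, w s))\<close> of one variable satisfies, for almost every slope
\<open>s\<close>, an inequality \<open>|g| \<le> W |v|\<close>, where \<open>g\<close> is its derivative with respect to the conjugate of \<open>w\<close> and \<open>W\<close> is
a multiple of the restriction of \<open>V + 1\<close>. Lebesgue measure becomes \<open>|w|\<^sup>2 dw ds\<close>. So for almost every \<open>s\<close> the
function \<open>|w| powr (1/2) * W\<close> is in \<open>L\<^sup>4\<close> near \<open>0\<close>, and, since \<open>u\<close> vanishes to infinite order and is locally in
\<open>L\<^sup>4\<close>, all integrals of \<open>W |v| / |w| ^ M\<close> are finite.

In the plane, division by the holomorphic function \<open>w ^ m\<close> commutes with the derivative in the conjugate
variable. For a cutoff \<open>\<theta>\<close>, Cauchy's formula therefore bounds \<open>|\<theta> v| / |w| ^ m\<close> by the integral of the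
derivative of \<open>\<theta> v\<close>, divided by \<open>|w| ^ m\<close>, against \<open>1 / |w - q|\<close>, with a constant that does not depend on \<open>m\<close>.
The integral of \<open>|q| powr (-1/2) * W q / |q - w|\<close> in \<open>q\<close> over a region is at most \<open>\<eta> |w| powr (-1/2)\<close> if the
integral of \<open>|q|\<^sup>2 * W q ^ 4\<close> over the region is small; this is scale invariant and is where the exponent \<open>4\<close>
enters (\<open>nn_integral_potential_kernel_le\<close>). Tonelli's theorem then absorbs the term \<open>W |v|\<close> into the left
hand side, and letting \<open>m\<close> tend to infinity gives \<open>v = 0\<close> on a disc (\<open>absorption\<close>, \<open>vanishing_extends\<close>). Only the
part of \<open>W\<close> outside the disc where \<open>v\<close> is already known to vanish has to be small, so the vanishing spreads
to the whole disc in which the line meets a given ball, whatever the size of \<open>W\<close> (\<open>planar_vanishing\<close>). Hence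
\<open>u\<close> vanishes on every ball about \<open>z0\<close> with closure in \<open>\<Omega>\<close>, and connectedness gives the theorem
(\<open>vanishing_on_ball\<close>, \<open>unique_continuation\<close>).

The weak equation passes to the lines with test functions \<open>\<alpha> w * \<beta> s / |w|\<^sup>2\<close> (\<open>weak_equation_slice\<close>). The
function \<open>\<alpha>\<close> contains the weight \<open>1 / w ^ m\<close> and the smooth kernel \<open>cnj w / (|w|\<^sup>2 + e)\<close>, whose derivative is an
approximate identity, so Cauchy's formula for almost every line comes out of the limit \<open>e \<longlonglongrightarrow> 0\<close>
(\<open>slice_cauchy_bound\<close>).\<close>

abbreviation nn_lborel :: "('a::euclidean_space \<Rightarrow> ennreal) \<Rightarrow> ennreal" (binder "NLINT " 10)
  where "nn_lborel f \<equiv> nn_integral lborel f"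

section \<open>Smooth functions with prescribed zero sets\<close>

text \<open>A test function has to satisfy \<open>Ck n\<close> for every \<open>n\<close>, and all test functions needed here are explicit
formulas; the closure properties below reduce their smoothness to that of the flat function \<open>exp (- 1 / t)\<close>.\<close>

definition smooth :: "('a::euclidean_space \<Rightarrow> 'b::real_normed_vector) \<Rightarrow> bool" where
  "smooth f \<longleftrightarrow> (\<forall>n. Ck n f)"

lemma Ck_Suc_lower: "Ck (Suc n) f \<Longrightarrow> Ck n f"
proof (induction n arbitrary: f)
  case 0
  then show ?case
    by (auto simp: continuous_on_eq_continuous_at intro: differentiable_imp_continuous_within)
next
  case (Suc n)
  from Suc.prems have "\<forall>v. Ck (Suc n) (\<lambda>x. frechet_derivative f (at x) v)"
    by simp
  then have "\<forall>v. Ck n (\<lambda>x. frechet_derivative f (at x) v)" using Suc.IH by blast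
  then show ?case using Suc.prems by simp
qed

lemma Ck_SucI:
  assumes "\<And>x. (f has_derivative f' x) (at x)" "\<And>v. Ck n (\<lambda>x. f' x v)"
  shows "Ck (Suc n) f"
proof -
  have "frechet_derivative f (at x) = f' x" for x
    using assms(1) frechet_derivative_at by metis
  then show ?thesis using assms by (auto simp: differentiable_def)
qed

lemma Ck_Suc_has_derivative:
  "Ck (Suc n) f \<Longrightarrow> (f has_derivative frechet_derivative f (at x)) (at x)"
  by (simp add: frechet_derivative_works)

lemma Ck_const: "Ck n (\<lambda>x::'a::euclidean_space. c::'b::real_normed_vector)"
proof (induction n arbitrary: c)
  case (Suc n)
  show ?case by (rule Ck_SucI[where f' = "\<lambda>_ _. 0"]) (auto intro: Suc.IH)
qed simp

lemma Ck_bounded_linear: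
  assumes "bounded_linear f" shows "Ck n f"
proof (cases n)
  case 0 then show ?thesis using assms by (simp add: linear_continuous_on)
next
  case (Suc m)
  then show ?thesis
    using Ck_SucI[OF bounded_linear_imp_has_derivative[OF assms] Ck_const] by simp
qed

lemma Ck_add: "Ck n f \<Longrightarrow> Ck n g \<Longrightarrow> Ck n (\<lambda>x. f x + g x)"
proof (induction n arbitrary: f g)
  case 0 then show ?case by (simp add: continuous_on_add)
next
  case (Suc n)
  show ?case
    by (rule Ck_SucI[OF has_derivative_add[OF Suc.prems[THEN Ck_Suc_has_derivative]]])
       (use Suc in auto)
qed

lemma Ck_sum: "finite I \<Longrightarrow> (\<And>i. i \<in> I \<Longrightarrow> Ck n (f i)) \<Longrightarrow> Ck n (\<lambda>x. \<Sum>i\<in>I. f i x)"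
  by (induction I rule: finite_induct) (auto intro: Ck_const Ck_add)

lemma Ck_bilinear:
  assumes "bounded_bilinear B"
  shows "Ck n f \<Longrightarrow> Ck n g \<Longrightarrow> Ck n (\<lambda>x. B (f x) (g x))"
proof (induction n arbitrary: f g)
  case 0 then show ?case using bounded_bilinear.continuous_on[OF assms] by simp
next
  case (Suc n)
  show ?case
  proof (rule Ck_SucI[OF bounded_bilinear.FDERIV[OF assms Suc.prems[THEN Ck_Suc_has_derivative]]])
    fix v
    show "Ck n (\<lambda>x. B (f x) (frechet_derivative g (at x) v) +
                 B (frechet_derivative f (at x) v) (g x))"
      using Suc.prems by (intro Ck_add Suc.IH) (auto simp del: Ck.simps intro: Ck_Suc_lower, auto)
  qed
qed

text \<open>\<open>Ck\<close> differentiates in one fixed direction at a time, whereas in the chain rule the direction in which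
the outer function is differentiated moves with the point. Expanding it in a basis leaves products of
scalar functions with derivatives of the outer function in constant directions, to which the
induction hypothesis applies.\<close>

lemma Ck_compose:
  fixes f :: "'b::euclidean_space \<Rightarrow> 'c::real_normed_vector" and q :: "'a::euclidean_space \<Rightarrow> 'b"
  shows "Ck n f \<Longrightarrow> Ck n q \<Longrightarrow> Ck n (\<lambda>x. f (q x))"
proof (induction n arbitrary: f)
  case 0 then show ?case by (auto intro: continuous_on_compose2)
next
  case (Suc n)
  let ?D = "\<lambda>x v. frechet_derivative f (at (q x)) (frechet_derivative q (at x) v)"
  show ?case
  proof (rule Ck_SucI)
    show "((\<lambda>x. f (q x)) has_derivative ?D x) (at x)" for x
      using has_derivative_compose[OF Ck_Suc_has_derivative[OF Suc.prems(2)] Ck_Suc_has_derivative[OF Suc.prems(1)]] .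
    fix v
    have "?D x v = (\<Sum>b\<in>Basis. (frechet_derivative q (at x) v \<bullet> b) *\<^sub>R frechet_derivative f (at (q x)) b)" for x
    proof -
      interpret bounded_linear "frechet_derivative f (at (q x))"
        using Ck_Suc_has_derivative[OF Suc.prems(1)] by (rule has_derivative_bounded_linear)
      show ?thesis
        by (subst euclidean_representation[symmetric, of "frechet_derivative q (at x) v"])
           (simp add: sum scaleR)
    qed
    moreover have "Ck n (\<lambda>x. \<Sum>b\<in>Basis. (frechet_derivative q (at x) v \<bullet> b) *\<^sub>R frechet_derivative f (at (q x)) b)"
    proof (intro Ck_sum finite_Basis Ck_bilinear[OF bounded_bilinear_scaleR])
      fix b :: 'b
      have "Ck n (\<lambda>x. frechet_derivative q (at x) v)" using Suc.prems by simp
      then show "Ck n (\<lambda>x. frechet_derivative q (at x) v \<bullet> b)"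
        by (intro Ck_bilinear[OF bounded_bilinear_inner] Ck_const)
      show "Ck n (\<lambda>x. frechet_derivative f (at (q x)) b)"
        using Suc.prems by (intro Suc.IH) (auto simp del: Ck.simps intro: Ck_Suc_lower, auto)
    qed
    ultimately show "Ck n (\<lambda>x. ?D x v)" by simp
  qed
qed

lemma Ck_inverse:
  fixes q :: "'a::euclidean_space \<Rightarrow> 'b::real_normed_field"
  assumes "\<And>x. q x \<noteq> 0"
  shows "Ck n q \<Longrightarrow> Ck n (\<lambda>x. inverse (q x))"
proof (induction n)
  case 0 then show ?case using assms by (auto intro: continuous_intros)
next
  case (Suc n)
  show ?case
  proof (rule Ck_SucI[OF Deriv.has_derivative_inverse[OF assms Ck_Suc_has_derivative[OF Suc.prems]]])
    fix v
    have a: "Ck n (\<lambda>x. inverse (q x))" using Suc Ck_Suc_lower by blast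
    have b: "Ck n (\<lambda>x. frechet_derivative q (at x) v)" using Suc.prems by simp
    have "Ck n (\<lambda>x. (-1) * ((inverse (q x) * frechet_derivative q (at x) v) * inverse (q x)))"
      by (intro Ck_bilinear[OF bounded_bilinear_mult] a b Ck_const)
    then show "Ck n (\<lambda>x. - (inverse (q x) * frechet_derivative q (at x) v * inverse (q x)))"
      by simp
  qed
qed

lemma smooth_const [intro, simp]: "smooth (\<lambda>x. c)"
  by (simp add: smooth_def Ck_const)

lemma smooth_bounded_linear: "bounded_linear f \<Longrightarrow> smooth f"
  by (simp add: smooth_def Ck_bounded_linear)

lemma smooth_add [intro]: "smooth f \<Longrightarrow> smooth g \<Longrightarrow> smooth (\<lambda>x. f x + g x)"
  by (simp add: smooth_def Ck_add)

lemma smooth_mult [intro]: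
  fixes f :: "'a::euclidean_space \<Rightarrow> 'b::real_normed_algebra"
  shows "smooth f \<Longrightarrow> smooth g \<Longrightarrow> smooth (\<lambda>x. f x * g x)"
  by (simp add: smooth_def Ck_bilinear[OF bounded_bilinear_mult])

lemma smooth_diff [intro]:
  fixes f :: "'a::euclidean_space \<Rightarrow> 'b::real_normed_algebra_1"
  assumes "smooth f" "smooth g" shows "smooth (\<lambda>x. f x - g x)"
  using smooth_add[OF assms(1) smooth_mult[OF smooth_const[of "-1"] assms(2)]] by simp

lemma smooth_compose: "smooth f \<Longrightarrow> smooth q \<Longrightarrow> smooth (\<lambda>x. f (q x))"
  for f :: "'b::euclidean_space \<Rightarrow> 'c::real_normed_vector" and q :: "'a::euclidean_space \<Rightarrow> 'b"
  by (simp add: smooth_def Ck_compose)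

lemma smooth_linear_image:
  fixes q :: "'a::euclidean_space \<Rightarrow> 'b::real_normed_vector"
  assumes "bounded_linear L" "smooth q" shows "smooth (\<lambda>x. L (q x))"
  unfolding smooth_def
proof
  fix n
  from assms(2) have "Ck n q" by (simp add: smooth_def)
  then show "Ck n (\<lambda>x. L (q x))"
  proof (induction n arbitrary: q)
    case 0 then show ?case using bounded_linear.continuous_on[OF assms(1)] by auto
  next
    case (Suc n)
    show ?case
      by (rule Ck_SucI[OF bounded_linear.has_derivative[OF assms(1) Ck_Suc_has_derivative[OF Suc.prems]]])
         (use Suc in auto)
  qed
qed

lemma smooth_divide [intro]:
  fixes f :: "'a::euclidean_space \<Rightarrow> 'b::real_normed_field"
  assumes "smooth f" "smooth g" "\<And>x. g x \<noteq> 0" shows "smooth (\<lambda>x. f x / g x)"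
proof -
  have "smooth (\<lambda>x. inverse (g x))" using assms(2) Ck_inverse[of g, OF assms(3)] by (simp add: smooth_def)
  from smooth_mult[OF assms(1) this] show ?thesis by (simp add: divide_inverse)
qed

lemma smooth_power [intro]:
  fixes f :: "'a::euclidean_space \<Rightarrow> 'b::real_normed_algebra_1"
  shows "smooth f \<Longrightarrow> smooth (\<lambda>x. f x ^ n)"
  by (induction n) auto

lemma smooth_id [intro, simp]: "smooth (\<lambda>x. x)"
  by (rule smooth_bounded_linear) (rule bounded_linear_ident)

lemma smooth_cnj [intro]: "smooth f \<Longrightarrow> smooth (\<lambda>x. cnj (f x))"
  by (rule smooth_linear_image[OF bounded_linear_cnj])

lemma smooth_Re [intro]: "smooth f \<Longrightarrow> smooth (\<lambda>x. Re (f x))"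
  by (rule smooth_linear_image[OF bounded_linear_Re])

lemma smooth_Im [intro]: "smooth f \<Longrightarrow> smooth (\<lambda>x. Im (f x))"
  by (rule smooth_linear_image[OF bounded_linear_Im])

lemma smooth_of_real [intro]: "smooth f \<Longrightarrow> smooth (\<lambda>x. of_real (f x) :: complex)"
  by (rule smooth_linear_image[OF bounded_linear_of_real])

lemma smooth_cmod_sq [intro]: "smooth f \<Longrightarrow> smooth (\<lambda>x. (cmod (f x))\<^sup>2)"
  unfolding cmod_power2 by (intro smooth_add smooth_power smooth_Re smooth_Im)

lemma smooth_vec_nth [intro]: "smooth f \<Longrightarrow> smooth (\<lambda>x. (f x :: complex ^ 'n) $ i)"
  by (rule smooth_linear_image[OF bounded_linear_vec_nth])

lemma smooth_imp_continuous: "smooth f \<Longrightarrow> continuous_on A f"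
  unfolding smooth_def using continuous_on_subset[of UNIV f A] by (metis Ck.simps(1) subset_UNIV)

lemma smooth_has_derivative: "smooth f \<Longrightarrow> (f has_derivative frechet_derivative f (at x)) (at x)"
  unfolding smooth_def using Ck_Suc_has_derivative by blast

lemma smooth_frechet: "smooth f \<Longrightarrow> smooth (\<lambda>x. frechet_derivative f (at x) v)"
  unfolding smooth_def by (metis Ck.simps(2))

text \<open>The family is closed under differentiation, up to linear combinations, and contains \<open>exp (- 1 / t)\<close> as
its member for \<open>k = 0\<close>; this makes smoothness a one-line induction.\<close>

definition flat :: "nat \<Rightarrow> real \<Rightarrow> real" where
  "flat k t = (if t \<le> 0 then 0 else (1 / t) ^ k * exp (- (1 / t)))"

lemma flat_tendsto_0: "(flat k \<longlongrightarrow> 0) (at 0)"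
proof -
  have "((\<lambda>t. (inverse t) ^ k / exp (inverse t)) \<longlongrightarrow> 0) (at_right (0::real))"
    by (rule filterlim_compose[OF tendsto_power_div_exp_0 filterlim_inverse_at_top_right])
  moreover have "\<forall>\<^sub>F t in at_right 0. (inverse t) ^ k / exp (inverse t) = flat k t"
    unfolding eventually_at_filter by (rule always_eventually) (auto simp: flat_def exp_minus field_simps)
  ultimately have r: "(flat k \<longlongrightarrow> 0) (at_right 0)" by (rule Lim_transform_eventually)
  have "\<forall>\<^sub>F t in at_left 0. 0 = flat k t"
    unfolding eventually_at_filter by (rule always_eventually) (auto simp: flat_def)
  then have "(flat k \<longlongrightarrow> 0) (at_left 0)" by (rule Lim_transform_eventually[OF tendsto_const])
  with r show ?thesis by (simp add: filterlim_at_split)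
qed

lemma flat_has_derivative:
  "(flat k has_real_derivative (flat (k+2) t - k * flat (k+1) t)) (at t)"
proof -
  consider "t < 0" | "t = 0" | "t > 0" by linarith
  then show ?thesis
  proof cases
    case 1
    show ?thesis
    proof (rule has_field_derivative_transform_within_open[of "\<lambda>_. 0" _ _ "{..<0}"])
      show "((\<lambda>_. 0) has_real_derivative flat (k+2) t - k * flat (k+1) t) (at t)"
        using 1 by (auto intro!: derivative_eq_intros simp: flat_def)
    qed (use 1 in \<open>auto simp: flat_def\<close>)
  next
    case 2
    have "((\<lambda>h. (flat k (0 + h) - flat k 0) / h) \<longlongrightarrow> 0) (at 0)"
      by (rule Lim_transform_eventually[OF flat_tendsto_0[of "Suc k"]])
         (auto simp: flat_def eventually_at_filter)
    then show ?thesis using 2 by (simp add: DERIV_def flat_def)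
  next
    case 3
    show ?thesis
    proof (rule has_field_derivative_transform_within_open[of "\<lambda>t. (1 / t) ^ k * exp (- (1 / t))" _ _ "{0<..}"])
      show "((\<lambda>t. (1 / t) ^ k * exp (- (1 / t))) has_real_derivative flat (k+2) t - k * flat (k+1) t) (at t)"
      proof (cases k)
        case 0
        then show ?thesis using 3
          by (auto intro!: derivative_eq_intros simp: flat_def field_simps power2_eq_square)
      next
        case (Suc j)
        then show ?thesis using 3
          by (auto intro!: derivative_eq_intros simp: flat_def field_simps)
             (metis Suc_pred neq0_conv power_Suc)
      qed
    qed (use 3 in \<open>auto simp: flat_def\<close>)
  qed
qed

lemma smooth_flat: "smooth (flat k)"
proof -
  have "Ck n (flat k)" for n
  proof (induction n arbitrary: k)
    case 0
    show ?case by (auto intro!: DERIV_isCont flat_has_derivative continuous_at_imp_continuous_on)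
  next
    case (Suc n)
    show ?case
    proof (rule Ck_SucI[OF flat_has_derivative[unfolded has_field_derivative_def]])
      fix v
      have "Ck n (\<lambda>x. (flat (k + 2) x + (- real k) * flat (k + 1) x) * v)"
        by (intro Ck_bilinear[OF bounded_bilinear_mult] Ck_add Suc.IH Ck_const)
      then show "Ck n (\<lambda>x. (flat (k + 2) x - real k * flat (k + 1) x) * v)" by simp
    qed
  qed
  then show ?thesis by (simp add: smooth_def)
qed

definition bump :: "real \<Rightarrow> real" where "bump = flat 0"

lemma smooth_bump: "smooth bump"
  by (simp add: bump_def smooth_flat)

lemma bump_pos: "t > 0 \<Longrightarrow> bump t > 0" and bump_zero: "t \<le> 0 \<Longrightarrow> bump t = 0"
  and bump_nonneg: "0 \<le> bump t" and bump_le_1: "bump t \<le> 1"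
  by (auto simp: bump_def flat_def)

lemma bump_tendsto_1: "0 < t \<Longrightarrow> (\<lambda>n. bump (real n * t)) \<longlonglongrightarrow> 1"
proof -
  assume t: "0 < t"
  have "(\<lambda>n. exp (- (inverse t * inverse (real n)))) \<longlonglongrightarrow> exp (- (inverse t * 0))"
    by (intro tendsto_intros lim_inverse_n)
  moreover have "\<forall>\<^sub>F n in sequentially. exp (- (inverse t * inverse (real n))) = bump (real n * t)"
    using eventually_gt_at_top[of 0]
    by eventually_elim (use t in \<open>auto simp: bump_def flat_def field_simps mult_le_0_iff\<close>)
  ultimately show ?thesis using Lim_transform_eventually by fastforce
qed

definition step :: "real \<Rightarrow> real" where "step t = bump t / (bump t + bump (1 - t))"

lemma bump_sum_pos: "bump t + bump (1 - t) > 0"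
proof (cases "t > 0")
  case False
  then have "bump (1 - t) > 0" by (intro bump_pos) simp
  then show ?thesis using bump_nonneg[of t] by linarith
qed (simp add: add_pos_nonneg bump_pos bump_nonneg)

lemma smooth_step: "smooth step"
  unfolding step_def using bump_sum_pos
  by (intro smooth_divide smooth_add smooth_bump smooth_compose[OF smooth_bump] smooth_diff)
     (auto simp: order_less_imp_not_eq2)

lemma step_zero: "t \<le> 0 \<Longrightarrow> step t = 0"
  by (simp add: step_def bump_zero)

lemma step_one: "1 \<le> t \<Longrightarrow> step t = 1"
  using bump_sum_pos[of t] by (simp add: step_def bump_zero)

lemma step_nonneg: "0 \<le> step t" and step_le_1: "step t \<le> 1"
  using bump_sum_pos[of t] bump_nonneg[of t] bump_nonneg[of "1 - t"]
  by (auto simp: step_def divide_simps)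

section \<open>Test functions adapted to complex lines\<close>

text \<open>The two Wirtinger derivatives of a function of one complex variable.\<close>

definition cdbar :: "(complex \<Rightarrow> complex) \<Rightarrow> complex \<Rightarrow> complex" where
  "cdbar f w = (frechet_derivative f (at w) 1 + \<i> * frechet_derivative f (at w) \<i>) / 2"

definition cdel :: "(complex \<Rightarrow> complex) \<Rightarrow> complex \<Rightarrow> complex" where
  "cdel f w = (frechet_derivative f (at w) 1 - \<i> * frechet_derivative f (at w) \<i>) / 2"

lemma frechet_cdel_cdbar:
  assumes "f differentiable (at w)"
  shows "frechet_derivative f (at w) h = cdel f w * h + cdbar f w * cnj h"
proof -
  interpret bounded_linear "frechet_derivative f (at w)"
    using assms by (auto simp: frechet_derivative_works intro: has_derivative_bounded_linear)
  have "frechet_derivative f (at w) h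
      = Re h *\<^sub>R frechet_derivative f (at w) 1 + Im h *\<^sub>R frechet_derivative f (at w) \<i>"
    by (subst complex_eq[of h]) (simp only: add scaleR[symmetric], simp add: scaleR_conv_of_real mult.commute)
  then show ?thesis
    by (simp add: cdel_def cdbar_def complex_eq_iff field_simps)
qed

lemma cdbar_eqI:
  assumes "(f has_derivative f') (at w)" shows "cdbar f w = (f' 1 + \<i> * f' \<i>) / 2"
  using frechet_derivative_at[OF assms] by (simp add: cdbar_def)

lemma smooth_differentiable: "smooth f \<Longrightarrow> f differentiable (at x)"
  using smooth_has_derivative differentiable_def by blast

definition vec2 :: "complex \<Rightarrow> complex \<Rightarrow> complex ^ 2" where
  "vec2 a b = (\<chi> i. if i = 1 then a else b)"

lemma vec2_nth [simp]: "vec2 a b $ 1 = a" "vec2 a b $ 2 = b"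
  by (simp_all add: vec2_def)

lemma continuous_on_vec2 [continuous_intros]:
  "continuous_on A f \<Longrightarrow> continuous_on A g \<Longrightarrow> continuous_on A (\<lambda>x. vec2 (f x) (g x))"
  unfolding vec2_def
  by (intro continuous_on_vec_lambda) (case_tac "i = 1"; simp)

text \<open>The chart \<open>(w, s) \<mapsto> z0 + (w, w s)\<close>: for fixed slope \<open>s\<close> it parametrizes the complex line through
\<open>z0\<close> with that slope. Only the vertical line through \<open>z0\<close> is not reached, and it is a null set.\<close>

definition slice :: "complex ^ 2 \<Rightarrow> complex \<times> complex \<Rightarrow> complex ^ 2" where
  "slice z0 p = z0 + vec2 (fst p) (fst p * snd p)"

lemma continuous_slice: "continuous_on A (slice z0)"
  unfolding slice_def by (intro continuous_intros)

text \<open>The function \<open>\<alpha> w * \<beta> s / |w|\<^sup>2\<close> of the chart coordinates. The factor \<open>1 / |w|\<^sup>2\<close> cancels the Jacobian of the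
chart and also a term of order zero in the equation along the lines.\<close>

definition slice_test :: "complex ^ 2 \<Rightarrow> (complex \<Rightarrow> complex) \<Rightarrow> (complex \<Rightarrow> complex) \<Rightarrow> complex ^ 2 \<Rightarrow> complex" where
  "slice_test z0 \<alpha> \<beta> z =
     \<alpha> (z $ 1 - z0 $ 1) / of_real ((cmod (z $ 1 - z0 $ 1))\<^sup>2) * \<beta> ((z $ 2 - z0 $ 2) / (z $ 1 - z0 $ 1))"

lemma slice_test_slice:
  "w \<noteq> 0 \<Longrightarrow> slice_test z0 \<alpha> \<beta> (slice z0 (w, s)) = \<alpha> w / of_real ((cmod w)\<^sup>2) * \<beta> s"
  by (simp add: slice_test_def slice_def)

text \<open>Functions that vanish near the origin may be divided by \<open>w\<close> without a discussion of the origin, because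
\<open>1 / w\<close> can be replaced there by a globally smooth function.\<close>

lemma smooth_reciprocal:
  assumes "0 < a"
  shows "\<exists>J. smooth J \<and> (\<forall>w::complex. a \<le> cmod w \<longrightarrow> J w = 1 / w)"
proof -
  define d where "d w = (cmod w)\<^sup>2 + bump (a\<^sup>2 - (cmod w)\<^sup>2)" for w :: complex
  have dpos: "d w > 0" for w
    using bump_nonneg[of "a\<^sup>2 - (cmod w)\<^sup>2"] bump_pos[of "a\<^sup>2 - (cmod w)\<^sup>2"] assms
    by (cases "w = 0") (auto simp: d_def intro: add_pos_nonneg)
  have sd: "smooth d"
    unfolding d_def by (intro smooth_add smooth_cmod_sq smooth_diff smooth_id smooth_const smooth_compose[OF smooth_bump])
  have "smooth (\<lambda>w. cnj w / of_real (d w))"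
    using dpos by (intro smooth_divide smooth_cnj smooth_of_real smooth_id sd) (auto simp: order_less_imp_not_eq2)
  moreover have "cnj w / of_real (d w) = 1 / w" if "a \<le> cmod w" for w
  proof -
    have "a\<^sup>2 \<le> (cmod w)\<^sup>2" using that assms by (intro power_mono) auto
    then have "d w = (cmod w)\<^sup>2" by (simp add: d_def bump_zero)
    then show ?thesis by (subst complex_div_cnj) simp
  qed
  ultimately show ?thesis by blast
qed

lemma smooth_slice_test:
  assumes "smooth \<alpha>" "smooth \<beta>" "0 < a" and z: "\<And>w. cmod w \<le> a \<Longrightarrow> \<alpha> w = 0"
  shows "smooth (slice_test z0 \<alpha> \<beta>)"
proof -
  obtain J where J: "smooth J" "\<And>w. a \<le> cmod w \<Longrightarrow> J w = 1 / w"
    using smooth_reciprocal[OF \<open>0 < a\<close>] by blast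
  have c: "smooth (\<lambda>z::complex^2. z $ i - z0 $ i)" for i by (intro smooth_diff smooth_vec_nth smooth_id smooth_const)
  have "slice_test z0 \<alpha> \<beta> z = \<alpha> (z $ 1 - z0 $ 1) * (J (z $ 1 - z0 $ 1) * cnj (J (z $ 1 - z0 $ 1))) *
          \<beta> ((z $ 2 - z0 $ 2) * J (z $ 1 - z0 $ 1))" for z
  proof (cases "\<alpha> (z $ 1 - z0 $ 1) = 0")
    case False
    then have "J (z $ 1 - z0 $ 1) = 1 / (z $ 1 - z0 $ 1)" using z[of "z $ 1 - z0 $ 1"] by (intro J(2)) force
    then show ?thesis unfolding slice_test_def complex_norm_square by simp
  qed (simp add: slice_test_def)
  moreover have "smooth (\<lambda>z::complex^2. \<alpha> (z $ 1 - z0 $ 1) * (J (z $ 1 - z0 $ 1) * cnj (J (z $ 1 - z0 $ 1))) *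
          \<beta> ((z $ 2 - z0 $ 2) * J (z $ 1 - z0 $ 1)))"
    by (intro smooth_mult smooth_cnj smooth_compose[OF assms(1)] smooth_compose[OF assms(2)] smooth_compose[OF J(1)] c)
  ultimately show ?thesis by presburger
qed

lemma test_function_slice_test:
  assumes "smooth \<alpha>" "smooth \<beta>" "0 < a" and z: "\<And>w. cmod w \<le> a \<Longrightarrow> \<alpha> w = 0"
    and b: "\<And>w. b < cmod w \<Longrightarrow> \<alpha> w = 0" and S: "\<And>s. S < cmod s \<Longrightarrow> \<beta> s = 0"
    and sub: "slice z0 ` (cball 0 b \<times> cball 0 S) \<subseteq> \<Omega>"
  shows "test_function \<Omega> (slice_test z0 \<alpha> \<beta>)"
proof -
  let ?K = "slice z0 ` (cball 0 b \<times> cball 0 S)"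
  have K: "compact ?K"
    by (intro compact_continuous_image continuous_slice compact_Times) auto
  have "{x. slice_test z0 \<alpha> \<beta> x \<noteq> 0} \<subseteq> ?K"
  proof
    fix x assume "x \<in> {x. slice_test z0 \<alpha> \<beta> x \<noteq> 0}"
    then have nz: "\<alpha> (x $ 1 - z0 $ 1) \<noteq> 0" "\<beta> ((x $ 2 - z0 $ 2) / (x $ 1 - z0 $ 1)) \<noteq> 0"
      by (auto simp: slice_test_def)
    have "x $ 1 - z0 $ 1 \<noteq> 0" using nz(1) z[of 0] \<open>0 < a\<close> by auto
    then have "x = slice z0 (x $ 1 - z0 $ 1, (x $ 2 - z0 $ 2) / (x $ 1 - z0 $ 1))"
      by (simp add: slice_def vec_eq_iff forall_2)
    moreover have "cmod (x $ 1 - z0 $ 1) \<le> b" "cmod ((x $ 2 - z0 $ 2) / (x $ 1 - z0 $ 1)) \<le> S"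
      using b S nz not_le by blast+
    ultimately show "x \<in> ?K" by (intro image_eqI) auto
  qed
  then have c: "closure {x. slice_test z0 \<alpha> \<beta> x \<noteq> 0} \<subseteq> ?K"
    using K by (simp add: closure_minimal compact_imp_closed)
  then have "compact (closure {x. slice_test z0 \<alpha> \<beta> x \<noteq> 0})"
    using K by (metis (lifting) closed_closure compact_Int_closed inf.absorb_iff2)
  then show ?thesis
    using c sub smooth_slice_test[OF assms(1-4)] unfolding test_function_def smooth_def by blast
qed

lemma slice_test_has_derivative:
  fixes z0 z :: "complex ^ 2"
  assumes "smooth \<alpha>" "smooth \<beta>" and nz: "z $ 1 - z0 $ 1 \<noteq> 0"
  defines "w \<equiv> z $ 1 - z0 $ 1" and "s \<equiv> (z $ 2 - z0 $ 2) / (z $ 1 - z0 $ 1)"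
  shows "(slice_test z0 \<alpha> \<beta> has_derivative (\<lambda>v.
      ((cdel \<alpha> w * v $ 1 + cdbar \<alpha> w * cnj (v $ 1)) / (w * cnj w)
         - \<alpha> w * (v $ 1 * cnj w + w * cnj (v $ 1)) / (w * cnj w)\<^sup>2) * \<beta> s
      + \<alpha> w / (w * cnj w) * (cdel \<beta> s * ((v $ 2 - s * v $ 1) / w) + cdbar \<beta> s * cnj ((v $ 2 - s * v $ 1) / w)))) (at z)"
proof -
  have w: "((\<lambda>z. z $ 1 - z0 $ 1) has_derivative (\<lambda>v. v $ 1)) (at z)"
    by (auto intro!: derivative_eq_intros bounded_linear_imp_has_derivative bounded_linear_vec_nth)
  have w2: "((\<lambda>z. z $ 2 - z0 $ 2) has_derivative (\<lambda>v. v $ 2)) (at z)"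
    by (auto intro!: derivative_eq_intros bounded_linear_imp_has_derivative bounded_linear_vec_nth)
  have q: "((\<lambda>z. (z $ 2 - z0 $ 2) / (z $ 1 - z0 $ 1)) has_derivative (\<lambda>v. (v $ 2 - s * v $ 1) / w)) (at z)"
    using has_derivative_divide'[OF w2 w nz] nz
    by (auto simp: w_def s_def field_simps elim!: has_derivative_eq_rhs)
  have "((\<lambda>z. \<alpha> (z $ 1 - z0 $ 1)) has_derivative (\<lambda>v. cdel \<alpha> w * v $ 1 + cdbar \<alpha> w * cnj (v $ 1))) (at z)"
    using has_derivative_compose[OF w smooth_has_derivative[OF assms(1)]]
    by (simp add: frechet_cdel_cdbar smooth_differentiable assms w_def)
  moreover have "((\<lambda>z. \<beta> ((z $ 2 - z0 $ 2) / (z $ 1 - z0 $ 1))) has_derivative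
      (\<lambda>v. cdel \<beta> s * ((v $ 2 - s * v $ 1) / w) + cdbar \<beta> s * cnj ((v $ 2 - s * v $ 1) / w))) (at z)"
    using has_derivative_compose[OF q smooth_has_derivative[OF assms(2)]]
    by (simp add: frechet_cdel_cdbar smooth_differentiable assms s_def)
  moreover have "((\<lambda>z. (z $ 1 - z0 $ 1) * cnj (z $ 1 - z0 $ 1)) has_derivative
      (\<lambda>v. v $ 1 * cnj w + w * cnj (v $ 1))) (at z)"
    using has_derivative_mult[OF w has_derivative_cnj[OF w]] by (simp add: w_def add.commute)
  ultimately have *: "((\<lambda>z. \<alpha> (z $ 1 - z0 $ 1))  has_derivative (\<lambda>v. cdel \<alpha> w * v $ 1 + cdbar \<alpha> w * cnj (v $ 1))) (at z)"
     "((\<lambda>z. \<beta> ((z $ 2 - z0 $ 2) / (z $ 1 - z0 $ 1))) has_derivative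
      (\<lambda>v. cdel \<beta> s * ((v $ 2 - s * v $ 1) / w) + cdbar \<beta> s * cnj ((v $ 2 - s * v $ 1) / w))) (at z)"
     "((\<lambda>z. (z $ 1 - z0 $ 1) * cnj (z $ 1 - z0 $ 1)) has_derivative
      (\<lambda>v. v $ 1 * cnj w + w * cnj (v $ 1))) (at z)" by blast+
  have nn: "(z $ 1 - z0 $ 1) * cnj (z $ 1 - z0 $ 1) \<noteq> 0"
    using nz by (metis complex_cnj_zero_iff mult_eq_0_iff)
  have sw: "s = (z $ 2 - z0 $ 2) / w" by (simp add: s_def w_def)
  have wn: "w \<noteq> 0" "cnj w \<noteq> 0" using nz by (auto simp: w_def simp del: complex_cnj_diff)
  have "((\<lambda>z. \<alpha> (z $ 1 - z0 $ 1) / ((z $ 1 - z0 $ 1) * cnj (z $ 1 - z0 $ 1)) *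
        \<beta> ((z $ 2 - z0 $ 2) / (z $ 1 - z0 $ 1))) has_derivative (\<lambda>v.
      ((cdel \<alpha> w * v $ 1 + cdbar \<alpha> w * cnj (v $ 1)) / (w * cnj w)
         - \<alpha> w * (v $ 1 * cnj w + w * cnj (v $ 1)) / (w * cnj w)\<^sup>2) * \<beta> s
      + \<alpha> w / (w * cnj w) * (cdel \<beta> s * ((v $ 2 - s * v $ 1) / w) + cdbar \<beta> s * cnj ((v $ 2 - s * v $ 1) / w)))) (at z)"
    apply (rule has_derivative_eq_rhs[OF has_derivative_mult[OF has_derivative_divide'[OF *(1) *(3) nn] *(2)]])
    apply (rule ext)
    apply (unfold w_def[symmetric] sw[symmetric])
    using wn by (simp add: field_simps power2_eq_square)
  then show ?thesis
    by (simp only: slice_test_def[abs_def] complex_norm_square)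
qed

text \<open>In the holomorphic coordinates \<open>w = z\<^sub>1\<close>, \<open>s = z\<^sub>2 / z\<^sub>1\<close> the derivative with respect to the conjugate of \<open>z\<^sub>1\<close> is
the one for \<open>w\<close> minus \<open>cnj (s / w)\<close> times the one for \<open>s\<close>, and the derivative with respect to the conjugate of
\<open>z\<^sub>2\<close> is \<open>1 / cnj w\<close> times the one for \<open>s\<close>. The extra factor \<open>cnj s\<close> in the second test function makes the
derivatives in \<open>s\<close> cancel and leaves a term \<open>\<alpha> w * \<beta> s / (|w|\<^sup>2 * cnj w)\<close>, which is cancelled by the
derivative of \<open>1 / |w|\<^sup>2\<close>.\<close>

lemma dbar_slice_test:
  assumes "smooth \<alpha>" "smooth \<beta>" "w \<noteq> 0"
  shows "dbar 1 (slice_test z0 \<alpha> \<beta>) (slice z0 (w, s)) + dbar 2 (slice_test z0 \<alpha> (\<lambda>s. cnj s * \<beta> s)) (slice z0 (w, s))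
       = cdbar \<alpha> w * \<beta> s / of_real ((cmod w)\<^sup>2)"
proof -
  have s': "smooth (\<lambda>s. cnj s * \<beta> s)" by (intro smooth_mult smooth_cnj smooth_id assms)
  have "((\<lambda>s. cnj s * \<beta> s) has_derivative (\<lambda>h. cnj s * frechet_derivative \<beta> (at s) h + cnj h * \<beta> s)) (at s)"
    by (auto intro!: derivative_eq_intros smooth_has_derivative assms)
  from cdbar_eqI[OF this] have cd: "cdbar (\<lambda>s. cnj s * \<beta> s) s = \<beta> s + cnj s * cdbar \<beta> s"
    by (simp add: cdbar_def field_simps)
  have fr: "frechet_derivative (slice_test z0 \<alpha> \<gamma>) (at (slice z0 (w, s))) v = 
      ((cdel \<alpha> w * v $ 1 + cdbar \<alpha> w * cnj (v $ 1)) / (w * cnj w)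
         - \<alpha> w * (v $ 1 * cnj w + w * cnj (v $ 1)) / (w * cnj w)\<^sup>2) * \<gamma> s
      + \<alpha> w / (w * cnj w) * (cdel \<gamma> s * ((v $ 2 - s * v $ 1) / w) + cdbar \<gamma> s * cnj ((v $ 2 - s * v $ 1) / w))"
    if "smooth \<gamma>" for v \<gamma>
    using slice_test_has_derivative[OF assms(1) that, of "slice z0 (w, s)" z0, THEN frechet_derivative_at] assms(3)
    by (simp add: slice_def fun_eq_iff)
  have i: "(axis 1 x :: complex ^ 2) $ 1 = x" "(axis 1 x :: complex ^ 2) $ 2 = 0" 
      "(axis 2 x :: complex ^ 2) $ 1 = 0" "(axis 2 x :: complex ^ 2) $ 2 = x" for x
    by (simp_all add: axis_def)
  have n: "of_real ((cmod w)\<^sup>2) = w * cnj w" using complex_norm_square by simp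
  have "cnj w \<noteq> 0" using assms by simp
  then show ?thesis unfolding dbar_def fr[OF assms(2)] fr[OF s'] i n cd using \<open>w \<noteq> 0\<close>
    by (simp add: field_simps power2_eq_square)
qed

section \<open>Lebesgue measure and the weak equation in slice coordinates\<close>

lemma measurable_Complex [measurable]:
  "f \<in> M \<rightarrow>\<^sub>M borel \<Longrightarrow> g \<in> M \<rightarrow>\<^sub>M borel \<Longrightarrow> (\<lambda>x. Complex (f x) (g x)) \<in> M \<rightarrow>\<^sub>M borel"
  unfolding Complex_eq
  by (intro borel_measurable_add borel_measurable_times borel_measurable_const measurable_compose[OF _ borel_measurable_of_real])

lemma lborel_complex_eq_distr:
  "(lborel :: complex measure) = distr (lborel \<Otimes>\<^sub>M lborel) borel (\<lambda>(x, y). Complex x y)"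
proof (rule lborel_eqI)
  have m[measurable]: "(\<lambda>(x, y). Complex x y) \<in> lborel \<Otimes>\<^sub>M lborel \<rightarrow>\<^sub>M borel"
    unfolding split_beta' by measurable
  fix l u :: complex
  assume lu: "\<And>b. b \<in> Basis \<Longrightarrow> l \<bullet> b \<le> u \<bullet> b"
  then have le: "Re l \<le> Re u" "Im l \<le> Im u" using lu[of 1] lu[of \<i>] by (auto simp: Basis_complex_def)
  have "(\<lambda>(x, y). Complex x y) -` box l u \<inter> space (lborel \<Otimes>\<^sub>M lborel) = {Re l<..<Re u} \<times> {Im l<..<Im u}"
    by (auto simp: box_def Basis_complex_def space_pair_measure)
  then show "emeasure (distr (lborel \<Otimes>\<^sub>M lborel) borel (\<lambda>(x, y). Complex x y)) (box l u)
     = (\<Prod>b\<in>Basis. (u - l) \<bullet> b)"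
    using le by (simp add: emeasure_distr lborel.emeasure_pair_measure_Times Basis_complex_def ennreal_mult)
qed simp

lemma nn_integral_complex:
  assumes [measurable]: "f \<in> borel_measurable borel"
  shows "(NLINT s. f s) = (NLINT y. NLINT x. f (Complex x y))"
proof -
  have m[measurable]: "(\<lambda>(x, y). Complex x y) \<in> lborel \<Otimes>\<^sub>M lborel \<rightarrow>\<^sub>M borel"
    unfolding split_beta' by measurable
  show ?thesis
    by (subst lborel_complex_eq_distr)
       (simp add: nn_integral_distr lborel_pair.nn_integral_snd[symmetric] split_beta')
qed

text \<open>Multiplication by \<open>a + b \<i>\<close> with \<open>a \<noteq> 0\<close> is a composition of two maps that each change one real
coordinate affinely while the other is fixed: first \<open>x \<mapsto> a x - b y\<close>, then
\<open>y \<mapsto> (b / a) p + ((a\<^sup>2 + b\<^sup>2) / a) y\<close> with \<open>p\<close> the new first coordinate. Their factors multiply to \<open>a\<^sup>2 + b\<^sup>2\<close>.\<close>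

lemma nn_integral_complex_mult:
  assumes f[measurable]: "f \<in> borel_measurable borel" and w: "w \<noteq> 0"
  shows "(NLINT s. f (w * s)) * ennreal ((cmod w)\<^sup>2) = (NLINT s. f s)"
proof -
  define a b where "a = Re w" and "b = Im w"
  have n: "(cmod w)\<^sup>2 = a\<^sup>2 + b\<^sup>2" by (simp add: a_def b_def cmod_power2)
  have W: "w * Complex x y = Complex (a * x - b * y) (b * x + a * y)" for x y
    by (simp add: a_def b_def complex_eq_iff)
  have L: "(NLINT s. f (w * s)) = (NLINT y. NLINT x. f (Complex (a * x - b * y) (b * x + a * y)))"
    by (subst nn_integral_complex) (simp_all add: W)
  show ?thesis
  proof (cases "a = 0")
    case True
    with w have b: "b \<noteq> 0" by (auto simp: a_def b_def complex_eq_iff)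
    have "(NLINT s. f s) = (NLINT x. NLINT y. f (Complex x y))"
      by (subst nn_integral_complex, measurable) (rule lborel_pair.Fubini'[symmetric], measurable)
    also have "\<dots> = \<bar>-b\<bar> * (NLINT x. NLINT y. f (Complex (- b * x) y))"
      using b by (subst nn_integral_real_affine[where c="-b" and t=0]) auto
    also have "\<dots> = \<bar>-b\<bar> * (NLINT x. \<bar>b\<bar> * (NLINT y. f (Complex (- b * x) (b * y))))"
      using b by (subst (2) nn_integral_real_affine[where c=b and t=0]) auto
    also have "\<dots> = (NLINT s. f (w * s)) * ennreal ((cmod w)\<^sup>2)"
    proof -
      have "\<bar>-b\<bar> * (NLINT x. \<bar>b\<bar> * (NLINT y. f (Complex (- b * x) (b * y))))
          = ennreal \<bar>b\<bar> * (ennreal \<bar>b\<bar> * (NLINT x. NLINT y. f (Complex (- b * x) (b * y))))"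
        by (subst nn_integral_cmult) auto
      also have "\<dots> = ennreal \<bar>b\<bar> * (ennreal \<bar>b\<bar> * (NLINT s. f (w * s)))"
        unfolding L True by simp
      also have "\<dots> = (ennreal \<bar>b\<bar> * ennreal \<bar>b\<bar>) * (NLINT s. f (w * s))"
        by (simp only: mult.assoc)
      also have "ennreal \<bar>b\<bar> * ennreal \<bar>b\<bar> = ennreal ((cmod w)\<^sup>2)"
        using ennreal_mult[of "\<bar>b\<bar>" "\<bar>b\<bar>"] unfolding n True by (simp add: power2_eq_square abs_mult_self_eq)
      finally show ?thesis by (simp only: mult.commute)
    qed
    finally show ?thesis by simp
  next
    case False
    define k where "k = (a\<^sup>2 + b\<^sup>2) / a"
    have k: "k \<noteq> 0" using False by (simp add: k_def add_nonneg_eq_0_iff)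
    have "ennreal \<bar>k\<bar> * (NLINT y. \<bar>a\<bar> * (NLINT x. f (Complex (a * x - b * y) (b * x + a * y))))
        = ennreal \<bar>k\<bar> * (NLINT y. (NLINT p. f (Complex p ((b/a) * p + k * y))))"
    proof -
      have "(NLINT p. f (Complex p ((b/a) * p + k * y))) =
            \<bar>a\<bar> * (NLINT x. f (Complex (a * x - b * y) (b * x + a * y)))" for y
      proof (subst nn_integral_real_affine[where c=a and t="- b * y"])
        have "b / a * (- b * y + a * x) + k * y = b * x + a * y" for x
          using False by (simp add: k_def field_simps power2_eq_square)
        then show "ennreal \<bar>a\<bar> * (NLINT x. f (Complex (- b * y + a * x) (b / a * (- b * y + a * x) + k * y)))
           = \<bar>a\<bar> * (NLINT x. f (Complex (a * x - b * y) (b * x + a * y)))"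
          by (simp add: algebra_simps)
      qed (use False in auto)
      then show ?thesis by simp
    qed
    also have "\<dots> = ennreal \<bar>k\<bar> * (NLINT p. (NLINT y. f (Complex p ((b/a) * p + k * y))))"
      by (subst lborel_pair.Fubini') simp_all
    also have "\<dots> = (NLINT p. ennreal \<bar>k\<bar> * (NLINT y. f (Complex p ((b/a) * p + k * y))))"
      by (simp add: nn_integral_cmult)
    also have "\<dots> = (NLINT p. (NLINT q. f (Complex p q)))"
      using nn_integral_real_affine[where c=k and t="(b/a) * p" and f="\<lambda>q. f (Complex p q)" for p] k
      by (intro nn_integral_cong) auto
    also have "\<dots> = (NLINT s. f s)"
      by (subst nn_integral_complex, measurable) (rule lborel_pair.Fubini', measurable)
    finally have "ennreal \<bar>k\<bar> * (\<bar>a\<bar> * (NLINT s. f (w * s))) = (NLINT s. f s)"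
      unfolding L by (simp add: nn_integral_cmult)
    moreover have "\<bar>k\<bar> * \<bar>a\<bar> = (cmod w)\<^sup>2" unfolding n k_def using False by (simp add: abs_mult[symmetric])
    ultimately show ?thesis by (simp add: mult_ac flip: ennreal_mult mult.assoc)
  qed
qed

lemma Basis_complex2: "(Basis :: (complex ^ 2) set) = {axis 1 1, axis 1 \<i>, axis 2 1, axis 2 \<i>}"
  by (auto simp: Basis_vec_def Basis_complex_def UNIV_2)

lemma measurable_vec2 [measurable]: "(\<lambda>p. vec2 (fst p) (snd p)) \<in> borel \<rightarrow>\<^sub>M borel"
  by (intro borel_measurable_continuous_onI continuous_intros)

lemma lborel_complex2_eq_distr:
  "(lborel :: (complex ^ 2) measure) = distr (lborel \<Otimes>\<^sub>M lborel) borel (\<lambda>p. vec2 (fst p) (snd p))"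
proof (rule lborel_eqI)
  have m[measurable]: "(\<lambda>p. vec2 (fst p) (snd p)) \<in> lborel \<Otimes>\<^sub>M lborel \<rightarrow>\<^sub>M borel"
    unfolding lborel_prod by simp
  fix l u :: "complex ^ 2"
  assume lu: "\<And>b. b \<in> Basis \<Longrightarrow> l \<bullet> b \<le> u \<bullet> b"
  have le: "Re (l $ i) \<le> Re (u $ i)" "Im (l $ i) \<le> Im (u $ i)" for i
    using lu[of "axis i 1"] lu[of "axis i \<i>"] by (auto simp: inner_axis axis_in_Basis_iff Basis_complex_def)
  have "(\<lambda>p. vec2 (fst p) (snd p)) -` box l u \<inter> space (lborel \<Otimes>\<^sub>M lborel) = box (l $ 1) (u $ 1) \<times> box (l $ 2) (u $ 2)"
    by (auto simp: box_def Basis_complex_def Basis_complex2 inner_axis space_pair_measure)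
  then show "emeasure (distr (lborel \<Otimes>\<^sub>M lborel) borel (\<lambda>p. vec2 (fst p) (snd p))) (box l u)
     = (\<Prod>b\<in>Basis. (u - l) \<bullet> b)"
    using le by (simp add: emeasure_distr lborel.emeasure_pair_measure_Times Basis_complex_def ennreal_mult
         Basis_complex2 inner_axis axis_eq_axis emeasure_lborel_box_eq mult.assoc)
qed simp

lemma measurable_slice [measurable]: "slice z0 \<in> borel \<rightarrow>\<^sub>M borel"
  by (intro borel_measurable_continuous_onI continuous_slice)

lemma measurable_fst_borel [measurable]: "fst \<in> borel \<rightarrow>\<^sub>M (borel :: 'a::second_countable_topology measure)"
  and measurable_snd_borel [measurable]: "snd \<in> borel \<rightarrow>\<^sub>M (borel :: 'b::second_countable_topology measure)"
  by (intro borel_measurable_continuous_onI continuous_intros)+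

text \<open>For fixed \<open>w \<noteq> 0\<close> the map \<open>s \<mapsto> w s\<close> multiplies area by \<open>|w|\<^sup>2\<close>, so Tonelli's theorem gives the change of
variables for the chart.\<close>

lemma lborel_eq_distr_slice:
  "lborel = distr (density (lborel :: (complex \<times> complex) measure) (\<lambda>p. ennreal ((cmod (fst p))\<^sup>2))) borel (slice z0)"
  (is "lborel = ?M")
proof (rule measure_eqI)
  fix A :: "(complex ^ 2) set" assume "A \<in> sets lborel"
  then have A[measurable]: "A \<in> sets borel" by simp
  have [measurable]: "(\<lambda>q. z0 + vec2 (fst q) (snd q)) \<in> borel \<rightarrow>\<^sub>M borel" 
    by (intro borel_measurable_continuous_onI continuous_intros)
  have [measurable]: "(\<lambda>s. z0 + vec2 w s) \<in> borel \<rightarrow>\<^sub>M borel" for w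
    by (intro borel_measurable_continuous_onI continuous_intros)
  have "emeasure ?M A = (NLINT p. ennreal ((cmod (fst p))\<^sup>2) * indicator A (slice z0 p))"
  proof -
    have "slice z0 -` A \<in> sets borel" using measurable_sets[OF measurable_slice A] by simp
    then show ?thesis by (simp add: emeasure_distr emeasure_density)
      (auto intro!: nn_integral_cong split: split_indicator)
  qed
  also have "\<dots> = (NLINT w. NLINT s. ennreal ((cmod w)\<^sup>2) * indicator A (slice z0 (w, s)))"
    unfolding lborel_prod[symmetric] by (subst lborel.nn_integral_fst[symmetric]) (simp_all add: lborel_prod)
  also have "\<dots> = (NLINT w. NLINT s. indicator A (z0 + vec2 w s))"
  proof (rule nn_integral_cong_AE, use AE_lborel_singleton[of 0] in eventually_elim)
    fix w :: complex assume "w \<noteq> 0"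
    then show "(NLINT s. ennreal ((cmod w)\<^sup>2) * indicator A (slice z0 (w, s))) =
        (NLINT s. indicator A (z0 + vec2 w s))"
      by (subst nn_integral_complex_mult[symmetric, of _ w])
         (simp_all add: slice_def nn_integral_cmult mult.commute)
  qed
  also have "\<dots> = (NLINT q. indicator A (z0 + vec2 (fst q) (snd q)))"
    unfolding lborel_prod[symmetric] by (subst lborel.nn_integral_fst[symmetric]) (simp_all add: lborel_prod)
  also have "\<dots> = (NLINT z. indicator A (z0 + z))"
    by (subst lborel_complex2_eq_distr) (simp add: nn_integral_distr lborel_prod)
  also have "\<dots> = (\<integral>\<^sup>+z. indicator A z \<partial>distr lborel borel ((+) z0))"
    by (simp add: nn_integral_distr del: nn_integral_indicator)
  also have "\<dots> = emeasure lborel A" by (simp add: lborel_distr_plus)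
  finally show "emeasure lborel A = emeasure ?M A" by simp
qed simp

lemma measurable_cnj [measurable]: "cnj \<in> borel \<rightarrow>\<^sub>M borel"
  by (intro borel_measurable_continuous_onI continuous_intros)

lemma AE_fst_nonzero: "AE p in (lborel :: (complex \<times> complex) measure). fst p \<noteq> 0"
proof -
  have "{0::complex} \<times> (UNIV::complex set) \<in> null_sets (lborel \<Otimes>\<^sub>M lborel)"
    by (intro lborel.times_in_null_sets1) (auto simp: null_sets_def)
  then show ?thesis unfolding lborel_prod
    by (intro AE_I'[where N = "{0} \<times> UNIV"]) auto
qed

lemma AE_slice:
  assumes "AE z in lborel. P z"
  shows "AE p in lborel. P (slice z0 p)"
proof -
  have "AE p in density lborel (\<lambda>p. ennreal ((cmod (fst p))\<^sup>2)). P (slice z0 p)"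
    using assms by (subst (asm) lborel_eq_distr_slice[of z0]) (rule AE_distrD, auto)
  then have "AE p in lborel. 0 < ennreal ((cmod (fst p))\<^sup>2) \<longrightarrow> P (slice z0 p)"
    by (subst (asm) AE_density) auto
  with AE_fst_nonzero show ?thesis by eventually_elim auto
qed

lemma AE_slice_iff:
  assumes [measurable]: "Measurable.pred borel P"
  shows "(AE z in lborel. P z) \<longleftrightarrow> (AE p in lborel. P (slice z0 p))"
proof
  assume "AE p in lborel. P (slice z0 p)"
  then have "AE p in density lborel (\<lambda>p. ennreal ((cmod (fst p))\<^sup>2)). P (slice z0 p)"
    by (subst AE_density) auto
  then show "AE z in lborel. P z"
    by (subst lborel_eq_distr_slice[of z0], subst AE_distr_iff) auto
qed (rule AE_slice)

lemma integral_slice: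
  fixes h :: "complex ^ 2 \<Rightarrow> complex"
  assumes [measurable]: "h \<in> borel_measurable borel"
  shows "(LBINT z. h z) = (LBINT p. of_real ((cmod (fst p))\<^sup>2) * h (slice z0 p))"
  by (subst lborel_eq_distr_slice[of z0], subst integral_distr, simp, simp, subst integral_density)
     (auto simp: scaleR_conv_of_real)

lemma nn_integral_slice:
  assumes [measurable]: "h \<in> borel_measurable borel"
  shows "(NLINT z. h z) = (NLINT p. ennreal ((cmod (fst p))\<^sup>2) * h (slice z0 p))"
  by (subst lborel_eq_distr_slice[of z0], subst nn_integral_distr, simp, simp, subst nn_integral_density) auto

text \<open>Lebesgue measurable data are replaced by Borel functions, because only for these are all restrictions
to complex lines measurable.\<close>

lemma borel_version_real:
  fixes f :: "'a::euclidean_space \<Rightarrow> real"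
  assumes "f \<in> borel_measurable (lebesgue_on \<Omega>)" and \<Omega>: "\<Omega> \<in> sets borel"
  shows "\<exists>f'\<in>borel_measurable borel. (AE z in lborel. z \<in> \<Omega> \<longrightarrow> f' z = f z) \<and> (\<forall>z. z \<notin> \<Omega> \<longrightarrow> f' z = 0)"
proof -
  have \<Omega>': "\<Omega> \<in> sets lebesgue" using \<Omega> by auto
  have "(\<lambda>z. if z \<in> \<Omega> then f z else 0) \<in> borel_measurable lebesgue"
    using assms(1) \<Omega>' by (simp add: borel_measurable_if)
  from completion_ex_borel_measurable_real[OF this] obtain f1 where
    f1: "f1 \<in> borel_measurable lborel" "AE z in lborel. (if z \<in> \<Omega> then f z else 0) = f1 z" by blast
  show ?thesis
  proof (rule bexI[of _ "\<lambda>z. indicator \<Omega> z * f1 z"], intro conjI allI impI)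
    show "AE z in lborel. z \<in> \<Omega> \<longrightarrow> indicator \<Omega> z * f1 z = f z" using f1(2) by eventually_elim auto
    show "(\<lambda>z. indicator \<Omega> z * f1 z) \<in> borel_measurable borel" using f1(1) \<Omega> by simp
  qed simp
qed

lemma borel_version_complex:
  fixes f :: "'a::euclidean_space \<Rightarrow> complex"
  assumes f: "f \<in> borel_measurable (lebesgue_on \<Omega>)" and \<Omega>: "\<Omega> \<in> sets borel"
  shows "\<exists>f'\<in>borel_measurable borel. (AE z in lborel. z \<in> \<Omega> \<longrightarrow> f' z = f z) \<and> (\<forall>z. z \<notin> \<Omega> \<longrightarrow> f' z = 0)"
proof -
  obtain a where a: "a \<in> borel_measurable borel" "AE z in lborel. z \<in> \<Omega> \<longrightarrow> a z = Re (f z)" "\<forall>z. z \<notin> \<Omega> \<longrightarrow> a z = 0"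
    using borel_version_real[of "\<lambda>z. Re (f z)" \<Omega>] f \<Omega> by auto
  obtain b where b: "b \<in> borel_measurable borel" "AE z in lborel. z \<in> \<Omega> \<longrightarrow> b z = Im (f z)" "\<forall>z. z \<notin> \<Omega> \<longrightarrow> b z = 0"
    using borel_version_real[of "\<lambda>z. Im (f z)" \<Omega>] f \<Omega> by auto
  show ?thesis
  proof (rule bexI[of _ "\<lambda>z. Complex (a z) (b z)"], intro conjI allI impI)
    show "AE z in lborel. z \<in> \<Omega> \<longrightarrow> Complex (a z) (b z) = f z" using a(2) b(2) by eventually_elim auto
    show "(\<lambda>z. Complex (a z) (b z)) \<in> borel_measurable borel" using a(1) b(1) by (rule measurable_Complex)
  qed (use a(3) b(3) in \<open>auto simp: complex_eq_iff\<close>)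
qed

lemma set_integral_borel_version:
  fixes f f' h :: "'a::euclidean_space \<Rightarrow> complex"
  assumes f: "f \<in> borel_measurable (lebesgue_on \<Omega>)" and \<Omega>: "\<Omega> \<in> sets borel"
    and f': "f' \<in> borel_measurable borel" "AE z in lborel. z \<in> \<Omega> \<longrightarrow> f' z = f z" "\<forall>z. z \<notin> \<Omega> \<longrightarrow> f' z = 0"
    and h: "h \<in> borel_measurable borel"
  shows "(LINT z:\<Omega>|lebesgue. f z * h z) = (LBINT z. f' z * h z)"
proof -
  have \<Omega>': "\<Omega> \<in> sets lebesgue" using \<Omega> by auto
  have hm: "h \<in> borel_measurable lebesgue" using h by (intro measurable_completion) simp
  have fm: "(\<lambda>z. if z \<in> \<Omega> then f z else 0) \<in> borel_measurable lebesgue"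
    using f \<Omega>' by (simp add: borel_measurable_if)
  have f'm: "(\<lambda>z. f' z * h z) \<in> borel_measurable lborel" using f' h by simp
  have e: "AE z in lebesgue. indicator \<Omega> z *\<^sub>R (f z * h z) = f' z * h z"
    by (rule AE_completion, use f'(2) in eventually_elim) (use f'(3) in \<open>auto split: split_indicator\<close>)
  have "(\<lambda>z. (if z \<in> \<Omega> then f z else 0) * h z) \<in> borel_measurable lebesgue"
    using fm hm by (rule borel_measurable_times)
  also have "(\<lambda>z. (if z \<in> \<Omega> then f z else 0) * h z) = (\<lambda>z. indicator \<Omega> z *\<^sub>R (f z * h z))"
    by (auto simp: fun_eq_iff split: split_indicator)
  finally have "(LINT z|lebesgue. indicator \<Omega> z *\<^sub>R (f z * h z)) = (LINT z|lebesgue. f' z * h z)"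
    by (intro integral_cong_AE e) (auto intro: measurable_completion f'm)
  also have "\<dots> = (LBINT z. f' z * h z)" using f'm by (rule integral_completion)
  finally show ?thesis by (simp add: set_lebesgue_integral_def)
qed

lemma smooth_dbar: "smooth \<phi> \<Longrightarrow> smooth (dbar j \<phi>)"
  unfolding dbar_def[abs_def]
  by (intro smooth_divide smooth_add smooth_mult smooth_frechet smooth_const) auto

lemma smooth_cdbar: "smooth f \<Longrightarrow> smooth (cdbar f)"
  unfolding cdbar_def[abs_def]
  by (intro smooth_divide smooth_add smooth_mult smooth_frechet smooth_const) auto

lemma dbar_zero_outside_support:
  assumes "z \<notin> closure {x. \<phi> x \<noteq> 0}" shows "dbar j \<phi> z = 0"
proof -
  have "(\<phi> has_derivative (\<lambda>_. 0)) (at z)"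
    by (rule has_derivative_transform_within_open[of "\<lambda>_. 0" _ _ _ "- closure {x. \<phi> x \<noteq> 0}"])
       (use assms closure_subset[of "{x. \<phi> x \<noteq> 0}"] in auto)
  from frechet_derivative_at[OF this] have "frechet_derivative \<phi> (at z) = (\<lambda>_. 0)" by simp
  then show ?thesis by (simp add: dbar_def)
qed

lemma integrable_mult_compact_support:
  fixes f h :: "'a::euclidean_space \<Rightarrow> complex"
  assumes "f \<in> borel_measurable borel" "integrable lborel (\<lambda>z. indicator K z *\<^sub>R f z)" "compact K"
    and h: "continuous_on UNIV h" "\<And>z. z \<notin> K \<Longrightarrow> h z = 0"
  shows "integrable lborel (\<lambda>z. f z * h z)"
proof -
  have "bounded (h ` K)"
    using h assms(3) by (intro compact_imp_bounded compact_continuous_image) (auto intro: continuous_on_subset)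
  then obtain B where B: "\<And>z. z \<in> K \<Longrightarrow> norm (h z) \<le> B" unfolding bounded_iff by auto
  have [measurable]: "h \<in> borel_measurable borel" using h by (intro borel_measurable_continuous_onI)
  note [measurable] = assms(1)
  show ?thesis
  proof (rule Bochner_Integration.integrable_bound)
    show "integrable lborel (\<lambda>z. B *\<^sub>R (indicator K z *\<^sub>R f z))" using assms(2) by (rule integrable_scaleR_right)
    show "AE z in lborel. norm (f z * h z) \<le> norm (B *\<^sub>R (indicator K z *\<^sub>R f z))"
    proof (rule AE_I2)
      fix z
      have "norm (h z) \<le> \<bar>B\<bar>" if "z \<in> K" using B[OF that] by linarith
      then show "norm (f z * h z) \<le> norm (B *\<^sub>R (indicator K z *\<^sub>R f z))"
        using h(2)[of z] by (cases "z \<in> K") (auto simp: norm_mult mult.commute[of "cmod (f z)"] intro!: mult_right_mono)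
    qed
  qed simp
qed

text \<open>Adding the weak equations for the two variables, tested with the two functions of \<open>dbar_slice_test\<close>, gives
the weak form of the equation along the lines: \<open>g 1 + cnj s * g 2\<close> is the derivative with respect to the
conjugate of \<open>w\<close> of \<open>u\<close> restricted to the line of slope \<open>s\<close>.\<close>

lemma weak_equation_slice:
  fixes u :: "complex ^ 2 \<Rightarrow> complex" and g :: "2 \<Rightarrow> complex ^ 2 \<Rightarrow> complex"
  assumes um: "u \<in> borel_measurable borel" and gm: "\<And>j. g j \<in> borel_measurable borel"
    and wk: "\<And>j \<phi>. test_function \<Omega> \<phi> \<Longrightarrow> (LBINT z. u z * dbar j \<phi> z) = - (LBINT z. g j z * \<phi> z)"
    and iu: "\<And>K. compact K \<Longrightarrow> K \<subseteq> \<Omega> \<Longrightarrow> integrable lborel (\<lambda>z. indicator K z *\<^sub>R u z)"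
    and ig: "\<And>K j. compact K \<Longrightarrow> K \<subseteq> \<Omega> \<Longrightarrow> integrable lborel (\<lambda>z. indicator K z *\<^sub>R g j z)"
    and t: "smooth \<alpha>" "smooth \<beta>" "0 < a" "\<And>w. cmod w \<le> a \<Longrightarrow> \<alpha> w = 0"
      "\<And>w. b < cmod w \<Longrightarrow> \<alpha> w = 0" "\<And>s. S < cmod s \<Longrightarrow> \<beta> s = 0"
    and sub: "slice z0 ` (cball 0 b \<times> cball 0 S) \<subseteq> \<Omega>"
  shows "(LBINT p. u (slice z0 p) * (cdbar \<alpha> (fst p) * \<beta> (snd p)))
     = - (LBINT p. (g 1 (slice z0 p) + cnj (snd p) * g 2 (slice z0 p)) * (\<alpha> (fst p) * \<beta> (snd p)))"
proof -
  define \<phi> where "\<phi> = slice_test z0 \<alpha> \<beta>"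
  define \<psi> where "\<psi> = slice_test z0 \<alpha> (\<lambda>s. cnj s * \<beta> s)"
  have s': "smooth (\<lambda>s. cnj s * \<beta> s)" by (intro smooth_mult smooth_cnj smooth_id t)
  have \<phi>: "test_function \<Omega> \<phi>" unfolding \<phi>_def by (rule test_function_slice_test[OF t sub])
  have \<psi>: "test_function \<Omega> \<psi>" unfolding \<psi>_def
    by (rule test_function_slice_test[OF t(1) s' t(3,4,5) _ sub]) (use t(6) in auto)
  have iu': "integrable lborel (\<lambda>z. u z * dbar j \<theta> z)"
    and ig': "integrable lborel (\<lambda>z. g j z * \<theta> z)"
    and sm: "dbar j \<theta> \<in> borel_measurable borel" "\<theta> \<in> borel_measurable borel"
    if \<theta>: "test_function \<Omega> \<theta>" for \<theta> j
  proof -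
    have sm: "smooth \<theta>" using \<theta> by (simp add: test_function_def smooth_def)
    have K: "compact (closure {x. \<theta> x \<noteq> 0})" "closure {x. \<theta> x \<noteq> 0} \<subseteq> \<Omega>"
      using \<theta> by (auto simp: test_function_def)
    have c: "continuous_on UNIV \<theta>" "continuous_on UNIV (dbar j \<theta>)"
      using sm smooth_dbar smooth_imp_continuous by blast+
    then show b: "\<theta> \<in> borel_measurable borel" "dbar j \<theta> \<in> borel_measurable borel"
      by (auto intro: borel_measurable_continuous_onI)
    show "integrable lborel (\<lambda>z. u z * dbar j \<theta> z)"
      using um iu[OF K] K(1) c(2) dbar_zero_outside_support by (rule integrable_mult_compact_support)
    show "integrable lborel (\<lambda>z. g j z * \<theta> z)"
      using gm ig[OF K] K(1) c(1) by (rule integrable_mult_compact_support) (use closure_subset[of "{x. \<theta> x \<noteq> 0}"] in auto)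
  qed
  note [measurable] = um gm sm[OF \<phi>] sm[OF \<psi>]
  have [measurable]: "\<alpha> \<in> borel_measurable borel" "\<beta> \<in> borel_measurable borel" "cdbar \<alpha> \<in> borel_measurable borel"
    using t(1,2) by (auto intro!: borel_measurable_continuous_onI smooth_imp_continuous smooth_cdbar)
  have "(LBINT z. u z * (dbar 1 \<phi> z + dbar 2 \<psi> z)) = - (LBINT z. g 1 z * \<phi> z + g 2 z * \<psi> z)"
    using wk[OF \<phi>, of 1] wk[OF \<psi>, of 2] iu'[OF \<phi>, of 1] iu'[OF \<psi>, of 2] ig'[OF \<phi>, of 1] ig'[OF \<psi>, of 2]
    by (simp add: distrib_left)
  then have "(LBINT p. of_real ((cmod (fst p))\<^sup>2) * (u (slice z0 p) * (dbar 1 \<phi> (slice z0 p) + dbar 2 \<psi> (slice z0 p))))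
     = - (LBINT p. of_real ((cmod (fst p))\<^sup>2) * (g 1 (slice z0 p) * \<phi> (slice z0 p) + g 2 (slice z0 p) * \<psi> (slice z0 p)))"
    by (subst (asm) (1 2) integral_slice[of _ z0]) auto
  also have "(LBINT p. of_real ((cmod (fst p))\<^sup>2) * (u (slice z0 p) * (dbar 1 \<phi> (slice z0 p) + dbar 2 \<psi> (slice z0 p))))
     = (LBINT p. u (slice z0 p) * (cdbar \<alpha> (fst p) * \<beta> (snd p)))"
  proof (rule integral_cong_AE)
    show "AE p in lborel. of_real ((cmod (fst p))\<^sup>2) * (u (slice z0 p) * (dbar 1 \<phi> (slice z0 p) + dbar 2 \<psi> (slice z0 p)))
        = u (slice z0 p) * (cdbar \<alpha> (fst p) * \<beta> (snd p))"
      using AE_fst_nonzero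
    proof eventually_elim
      case (elim p)
      then show ?case
        unfolding \<phi>_def \<psi>_def
        using dbar_slice_test[OF t(1,2) elim, of z0 "snd p", unfolded prod.collapse] by (simp only:) simp
    qed
  qed measurable
  also have "(LBINT p. of_real ((cmod (fst p))\<^sup>2) * (g 1 (slice z0 p) * \<phi> (slice z0 p) + g 2 (slice z0 p) * \<psi> (slice z0 p)))
     = (LBINT p. (g 1 (slice z0 p) + cnj (snd p) * g 2 (slice z0 p)) * (\<alpha> (fst p) * \<beta> (snd p)))"
  proof (rule integral_cong_AE)
    show "AE p in lborel. of_real ((cmod (fst p))\<^sup>2) * (g 1 (slice z0 p) * \<phi> (slice z0 p) + g 2 (slice z0 p) * \<psi> (slice z0 p))
        = (g 1 (slice z0 p) + cnj (snd p) * g 2 (slice z0 p)) * (\<alpha> (fst p) * \<beta> (snd p))"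
      using AE_fst_nonzero
    proof eventually_elim
      case (elim p)
      show ?case
        using slice_test_slice[OF elim, of z0 \<alpha> \<beta> "snd p"] slice_test_slice[OF elim, of z0 \<alpha> "\<lambda>s. cnj s * \<beta> s" "snd p"] elim
        by (simp add: \<phi>_def \<psi>_def field_simps)
    qed
  qed measurable
  finally show ?thesis .
qed

section \<open>Radial kernels and vanishing criteria\<close>

lemma nn_integral_translate:
  fixes h :: "'a::euclidean_space \<Rightarrow> ennreal"
  assumes [measurable]: "h \<in> borel_measurable borel"
  shows "(NLINT x. h (x - w)) = (NLINT x. h x)"
  by (subst (2) lborel_distr_plus[of "-w", symmetric]) (simp add: nn_integral_distr)

lemma dyadic_scale:
  fixes x :: real assumes "1 \<le> x" shows "\<exists>k::nat. 2 ^ k \<le> x \<and> x < 2 ^ Suc k"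
proof -
  have ex: "\<exists>k. x < 2 ^ Suc k" using real_arch_pow[of 2 x] by (metis less_trans one_less_numeral_iff power_strict_increasing_iff lessI semiring_norm(76))
  define k where "k = (LEAST k. x < 2 ^ Suc k)"
  have "x < 2 ^ Suc k" unfolding k_def by (rule LeastI_ex[OF ex])
  moreover have "2 ^ k \<le> x"
  proof (cases k)
    case (Suc j)
    then have "\<not> x < 2 ^ Suc j" using not_less_Least[of j "\<lambda>k. x < 2 ^ Suc k"] by (simp add: k_def)
    then show ?thesis using Suc by simp
  qed (use assms in simp)
  ultimately show ?thesis by blast
qed

lemma pow2_powr: "((2::real) ^ k) powr p = 2 powr (p * real k)"
  by (subst powr_realpow[of 2 k, symmetric]) (simp, simp only: powr_powr mult.commute)

lemma powr2_pow: "((2::real) powr x) ^ k = 2 powr (x * real k)"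
  by (subst powr_realpow[of "2 powr x" k, symmetric]) (simp, simp only: powr_powr)

lemma emeasure_disc: "0 \<le> r \<Longrightarrow> emeasure lborel (ball (c::complex) r) = ennreal (pi * r\<^sup>2)"
  by (simp add: emeasure_ball unit_ball_vol_2)

text \<open>Wherever \<open>h\<close> is positive it is at most one term of the series of the functions \<open>a k\<close> times the
indicator of the disc of radius \<open>d k\<close>, and this series is integrated term by term.\<close>

lemma nn_integral_annuli_le:
  fixes a d :: "nat \<Rightarrow> real" and h :: "complex \<Rightarrow> real"
  assumes cov: "\<And>x. h x > 0 \<Longrightarrow> \<exists>k. cmod x < d k \<and> h x \<le> a k"
    and nn: "\<And>k. 0 \<le> a k" "\<And>k. 0 \<le> d k" and sm: "summable (\<lambda>k. a k * (pi * (d k)\<^sup>2))"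
  shows "(NLINT x. ennreal (h x)) \<le> ennreal (\<Sum>k. a k * (pi * (d k)\<^sup>2))"
proof -
  have "(NLINT x. ennreal (h x)) \<le> (NLINT x. (\<Sum>k. ennreal (a k) * indicator (ball (0::complex) (d k)) x))"
  proof (rule nn_integral_mono)
    fix x :: complex
    show "ennreal (h x) \<le> (\<Sum>k. ennreal (a k) * indicator (ball (0::complex) (d k)) x)"
    proof (cases "h x > 0")
      case True
      then obtain k where k: "cmod x < d k" "h x \<le> a k" using cov by blast
      then have "ennreal (h x) \<le> ennreal (a k) * indicator (ball 0 (d k)) x"
        by (simp add: ennreal_leI)
      also have "\<dots> \<le> (\<Sum>i<Suc k. ennreal (a i) * indicator (ball 0 (d i)) x)"
        by (rule member_le_sum) auto
      also have "\<dots> \<le> (\<Sum>k. ennreal (a k) * indicator (ball (0::complex) (d k)) x)" by (rule sum_le_suminf) auto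
      finally show ?thesis .
    qed (simp add: ennreal_neg)
  qed
  also have "\<dots> = (\<Sum>k. ennreal (a k) * ennreal (pi * (d k)\<^sup>2))"
  proof (subst nn_integral_suminf)
    have "(NLINT x. ennreal (a k) * indicator (ball (0::complex) (d k)) x) = ennreal (a k) * ennreal (pi * (d k)\<^sup>2)" for k
      by (subst nn_integral_cmult_indicator) (simp_all add: emeasure_disc nn)
    then show "(\<Sum>k. NLINT x. ennreal (a k) * indicator (ball (0::complex) (d k)) x) = (\<Sum>k. ennreal (a k) * ennreal (pi * (d k)\<^sup>2))"
      by simp
    show "(\<lambda>x. ennreal (a k) * indicator (ball (0::complex) (d k)) x) \<in> borel_measurable lborel" for k
      by (intro borel_measurable_times_ennreal borel_measurable_const borel_measurable_indicator) auto
  qed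
  also have "\<dots> = ennreal (\<Sum>k. a k * (pi * (d k)\<^sup>2))"
    using sm nn by (simp add: ennreal_mult[symmetric] suminf_ennreal2)
  finally show ?thesis .
qed

lemma nn_integral_power_disc:
  assumes "p < 2" "0 \<le> p"
  shows "\<exists>C\<ge>0. \<forall>\<rho>>0. (NLINT x. ennreal (indicator (ball (0::complex) \<rho>) x * cmod x powr (-p)))
             \<le> ennreal (C * \<rho> powr (2 - p))"
proof -
  let ?q = "2 powr (p - 2)"
  have q: "0 < ?q" "?q < 1" using assms powr_less_mono[of "p-2" 0 2] by auto
  define C where "C = 2 powr p * pi * (\<Sum>k. ?q ^ k)"
  have "C \<ge> 0" unfolding C_def using q by (intro mult_nonneg_nonneg suminf_nonneg summable_geometric) auto
  moreover have "(NLINT x. ennreal (indicator (ball (0::complex) \<rho>) x * cmod x powr (-p)))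
             \<le> ennreal (C * \<rho> powr (2 - p))" if \<rho>: "\<rho> > 0" for \<rho>
  proof -
    define d where "d k = \<rho> / 2 ^ k" for k :: nat
    define a where "a k = (\<rho> / 2 ^ Suc k) powr (-p)" for k :: nat
    have t: "a k * (pi * (d k)\<^sup>2) = 2 powr p * pi * \<rho> powr (2 - p) * ?q ^ k" for k
    proof -
      have "a k = \<rho> powr (-p) * (2 * 2 ^ k) powr p"
        using \<rho> by (simp add: a_def powr_divide powr_minus_divide)
      also have "(2 * 2 ^ k) powr p = 2 powr p * (2 powr (p * k))"
        by (simp add: powr_mult pow2_powr)
      finally have a: "a k = \<rho> powr (-p) * (2 powr p * 2 powr (p * k))" .
      have d: "(d k)\<^sup>2 = \<rho> powr 2 * 2 powr (-2 * k)"
      proof -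
        have "((2::real) ^ k)\<^sup>2 = 2 powr (2 * k)" using pow2_powr[of k 2] by simp
        then show ?thesis using \<rho> by (simp add: d_def power_divide powr_minus_divide)
      qed
      have "?q ^ k = 2 powr (p * k) * 2 powr (-2 * k)"
        unfolding powr2_pow powr_add[symmetric] by (simp add: algebra_simps)
      moreover have "\<rho> powr (2 - p) = \<rho> powr 2 * \<rho> powr (-p)" using powr_add[of \<rho> 2 "-p"] by simp
      ultimately show ?thesis unfolding a d by simp
    qed
    have sm: "summable (\<lambda>k. a k * (pi * (d k)\<^sup>2))" unfolding t using q by (intro summable_mult summable_geometric) auto
    have "(NLINT x. ennreal (indicator (ball (0::complex) \<rho>) x * cmod x powr (-p)))
        \<le> ennreal (\<Sum>k. a k * (pi * (d k)\<^sup>2))"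
    proof (rule nn_integral_annuli_le[OF _ _ _ sm])
      fix x assume "0 < indicator (ball (0::complex) \<rho>) x * cmod x powr (-p)"
      then have x: "cmod x < \<rho>" "x \<noteq> 0" by (auto split: split_indicator_asm)
      then obtain k :: nat where k: "2 ^ k \<le> \<rho> / cmod x" "\<rho> / cmod x < 2 ^ Suc k"
        using dyadic_scale[of "\<rho> / cmod x"] by auto
      have x1: "cmod x \<le> d k" "\<rho> / 2 ^ Suc k \<le> cmod x"
        using k x \<rho> by (auto simp: d_def field_simps)
      have "\<exists>k. cmod x < d k \<and> \<rho> / 2 ^ Suc k \<le> cmod x"
      proof (cases "cmod x = d k")
        case False then show ?thesis using x1 by (intro exI[of _ k]) auto
      next
        case True
        then obtain j where "k = Suc j" using x by (cases k) (auto simp: d_def)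
        with True show ?thesis using \<rho> by (intro exI[of _ j]) (auto simp: d_def field_simps)
      qed
      then obtain k where k: "cmod x < d k" "\<rho> / 2 ^ Suc k \<le> cmod x" by blast
      have "cmod x powr (-p) \<le> a k" unfolding a_def
        using k(2) \<rho> assms by (intro powr_mono2') auto
      then show "\<exists>k. cmod x < d k \<and> indicator (ball (0::complex) \<rho>) x * cmod x powr (-p) \<le> a k"
        using k(1) x(1) by auto
    qed (use \<rho> in \<open>auto simp: a_def d_def\<close>)
    also have "(\<Sum>k. a k * (pi * (d k)\<^sup>2)) = C * \<rho> powr (2 - p)"
      unfolding t C_def using q by (subst suminf_mult) (auto simp: summable_geometric)
    finally show ?thesis .
  qed
  ultimately show ?thesis by blast
qed

lemma nn_integral_power_exterior:
  assumes "2 < p"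
  shows "\<exists>C\<ge>0. \<forall>\<rho>>0. (NLINT x. ennreal (indicator (- ball (0::complex) \<rho>) x * cmod x powr (-p)))
             \<le> ennreal (C * \<rho> powr (2 - p))"
proof -
  let ?q = "2 powr (2 - p)"
  have q: "0 < ?q" "?q < 1" using assms powr_less_mono[of "2-p" 0 2] by auto
  define C where "C = 4 * pi * (\<Sum>k. ?q ^ k)"
  have "C \<ge> 0" unfolding C_def using q by (intro mult_nonneg_nonneg suminf_nonneg summable_geometric) auto
  moreover have "(NLINT x. ennreal (indicator (- ball (0::complex) \<rho>) x * cmod x powr (-p)))
             \<le> ennreal (C * \<rho> powr (2 - p))" if \<rho>: "\<rho> > 0" for \<rho>
  proof -
    define d where "d k = \<rho> * 2 ^ Suc k" for k :: nat
    define a where "a k = (\<rho> * 2 ^ k) powr (-p)" for k :: nat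
    have t: "a k * (pi * (d k)\<^sup>2) = 4 * pi * \<rho> powr (2 - p) * ?q ^ k" for k
    proof -
      have a: "a k = \<rho> powr (-p) * 2 powr (-p * k)"
        using \<rho> by (simp add: a_def powr_mult pow2_powr)
      have d: "(d k)\<^sup>2 = 4 * \<rho> powr 2 * 2 powr (2 * k)"
      proof -
        have "((2::real) ^ k)\<^sup>2 = 2 powr (2 * k)" using pow2_powr[of k 2] by simp
        then show ?thesis using \<rho> by (simp add: d_def power_mult_distrib)
      qed
      have "?q ^ k = 2 powr (-p * k) * 2 powr (2 * k)"
        unfolding powr2_pow powr_add[symmetric] by (simp add: algebra_simps)
      moreover have "\<rho> powr (2 - p) = \<rho> powr 2 * \<rho> powr (-p)" using powr_add[of \<rho> 2 "-p"] by simp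
      ultimately show ?thesis unfolding a d by simp
    qed
    have sm: "summable (\<lambda>k. a k * (pi * (d k)\<^sup>2))" unfolding t using q by (intro summable_mult summable_geometric) auto
    have "(NLINT x. ennreal (indicator (- ball (0::complex) \<rho>) x * cmod x powr (-p)))
        \<le> ennreal (\<Sum>k. a k * (pi * (d k)\<^sup>2))"
    proof (rule nn_integral_annuli_le[OF _ _ _ sm])
      fix x assume "0 < indicator (- ball (0::complex) \<rho>) x * cmod x powr (-p)"
      then have x: "\<rho> \<le> cmod x" by (auto split: split_indicator_asm)
      then obtain k :: nat where k: "2 ^ k \<le> cmod x / \<rho>" "cmod x / \<rho> < 2 ^ Suc k"
        using dyadic_scale[of "cmod x / \<rho>"] \<rho> by auto
      have x1: "cmod x < d k" "\<rho> * 2 ^ k \<le> cmod x"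
        using k x \<rho> by (auto simp: d_def field_simps)
      have "cmod x powr (-p) \<le> a k" unfolding a_def
        using x1(2) \<rho> assms by (intro powr_mono2') auto
      then show "\<exists>k. cmod x < d k \<and> indicator (- ball (0::complex) \<rho>) x * cmod x powr (-p) \<le> a k"
        using x1(1) x(1) by (intro exI[of _ k]) auto
    qed (use \<rho> in \<open>auto simp: a_def d_def\<close>)
    also have "(\<Sum>k. a k * (pi * (d k)\<^sup>2)) = C * \<rho> powr (2 - p)"
      unfolding t C_def using q by (subst suminf_mult) (auto simp: summable_geometric)
    finally show ?thesis .
  qed
  ultimately show ?thesis by blast
qed

text \<open>The sets over which \<open>F\<close> integrates to zero form a Dynkin system, and open boxes are stable under
intersection and generate the Borel sets.\<close>

lemma AE_zero_if_box_integrals_zero: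
  fixes F :: "'a::euclidean_space \<Rightarrow> complex"
  assumes F: "integrable lborel F" and box: "\<And>l u. (LBINT z. indicator (box l u) z *\<^sub>R F z) = 0"
  shows "AE z in lborel. F z = 0"
proof (rule sigma_finite_measure.density_zero[OF sigma_finite_lborel F])
  have [measurable]: "F \<in> borel_measurable borel" using F by auto
  have si: "set_integrable lborel A F" if "A \<in> sets borel" for A
    unfolding set_integrable_def using that F by (intro integrable_mult_indicator) auto
  have tot: "integral\<^sup>L lborel F = 0"
  proof -
    let ?A = "\<lambda>n::nat. box (- (real n *\<^sub>R One)) (real n *\<^sub>R One) :: 'a set"
    have "(\<lambda>n. LBINT z. indicator (?A n) z *\<^sub>R F z) \<longlonglongrightarrow> integral\<^sup>L lborel F"
    proof (rule integral_dominated_convergence[where w = "\<lambda>z. norm (F z)"])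
      show "AE z in lborel. (\<lambda>n. indicator (?A n) z *\<^sub>R F z) \<longlonglongrightarrow> F z"
      proof (rule AE_I2)
        fix z :: 'a
        have "z \<in> (\<Union>i. ?A i)" unfolding UN_box_eq_UNIV by simp
        then obtain N where N: "z \<in> ?A N" by blast
        have "\<forall>\<^sub>F n in sequentially. indicator (?A n) z *\<^sub>R F z = F z"
          using eventually_ge_at_top[of N]
        proof eventually_elim
          case (elim n)
          then have "?A N \<subseteq> ?A n" by (intro subset_box_imp) auto
          then have "z \<in> ?A n" using N by blast
          then show ?case by simp
        qed
        then show "(\<lambda>n. indicator (?A n) z *\<^sub>R F z) \<longlonglongrightarrow> F z" by (simp add: tendsto_eventually)
      qed
      show "integrable lborel (\<lambda>z. norm (F z))" using F by simp
    qed (auto split: split_indicator)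
    then show ?thesis by (simp add: box LIMSEQ_const_iff)
  qed
  have is_int: "Int_stable (range (\<lambda>(a, b). box a b :: 'a set))"
    by (auto simp: Int_stable_def box_Int_box)
  fix A :: "'a set" assume "A \<in> sets lborel"
  then have "A \<in> sigma_sets UNIV (range (\<lambda>(a, b). box a b))" by (simp add: borel_eq_box)
  from is_int subset_Pow_Union[THEN order_trans, OF Pow_mono[OF subset_UNIV]] this show "set_lebesgue_integral lborel A F = 0"
  proof (induction rule: sigma_sets_induct_disjoint)
    case (basic A)
    then show ?case using box by (auto simp: set_lebesgue_integral_def)
  next
    case empty then show ?case by (simp add: set_lebesgue_integral_def)
  next
    case (compl A)
    then have A: "A \<in> sets borel" by (simp add: borel_eq_box)
    have "set_lebesgue_integral lborel (A \<union> (UNIV - A)) F = set_lebesgue_integral lborel A F + set_lebesgue_integral lborel (UNIV - A) F"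
      using A by (intro set_integral_Un si) auto
    then show ?case using compl tot by (simp add: set_lebesgue_integral_def)
  next
    case (union A)
    then have A: "A i \<in> sets borel" for i by (auto simp: borel_eq_box)
    have "set_lebesgue_integral lborel (\<Union>i. A i) F = (\<Sum>i. set_lebesgue_integral lborel (A i) F)"
      using union A by (intro lebesgue_integral_countable_add si) (auto simp: disjoint_family_on_def)
    then show ?case using union by simp
  qed
qed

text \<open>The indicator of a box is the limit of the smooth functions obtained from \<open>bump (n * t)\<close>, where \<open>t\<close> runs
through the signed distances to the four sides; a fixed smooth factor positive exactly on the disc of
radius \<open>S\<close> confines the supports to that disc.\<close>

lemma AE_zero_if_smooth_integrals_zero:
  fixes F :: "complex \<Rightarrow> complex"
  assumes F: "integrable lborel F" and "0 < S"
    and test: "\<And>\<beta>. smooth \<beta> \<Longrightarrow> (\<And>s. S < cmod s \<Longrightarrow> \<beta> s = 0) \<Longrightarrow> (LBINT s. F s * \<beta> s) = 0"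
  shows "AE s in lborel. cmod s < S \<longrightarrow> F s = 0"
proof -
  define b where "b s = bump (S\<^sup>2 - (cmod s)\<^sup>2)" for s :: complex
  have sb: "smooth b" unfolding b_def by (intro smooth_compose[OF smooth_bump] smooth_diff smooth_const smooth_cmod_sq smooth_id)
  have [measurable]: "F \<in> borel_measurable borel" "b \<in> borel_measurable borel"
    using F sb by (auto intro: borel_measurable_continuous_onI smooth_imp_continuous)
  have b01: "0 \<le> b s" "b s \<le> 1" for s by (auto simp: b_def bump_nonneg bump_le_1)
  have F': "integrable lborel (\<lambda>s. F s * of_real (b s))"
    by (rule Bochner_Integration.integrable_bound[OF F]) (use b01 in \<open>auto simp: norm_mult mult_left_le\<close>)
  have "AE s in lborel. F s * of_real (b s) = 0"
  proof (rule AE_zero_if_box_integrals_zero[OF F'])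
    fix l u :: complex
    define e where "e n s = bump (real n * (Re s - Re l)) * bump (real n * (Re u - Re s)) *
       (bump (real n * (Im s - Im l)) * bump (real n * (Im u - Im s)))" for n s
    have se: "smooth (e n)" for n unfolding e_def
      by (intro smooth_mult smooth_compose[OF smooth_bump] smooth_diff smooth_const smooth_Re smooth_Im smooth_id)
    then have [measurable]: "e n \<in> borel_measurable borel" for n
      by (auto intro: borel_measurable_continuous_onI smooth_imp_continuous)
    have e01: "0 \<le> e n s" "e n s \<le> 1" for n s
      unfolding e_def by (auto intro!: mult_nonneg_nonneg mult_le_one bump_nonneg bump_le_1)
    have lim: "(\<lambda>n. e n s) \<longlonglongrightarrow> indicator (box l u) s" for s
    proof (cases "s \<in> box l u")
      case True
      then have "(\<lambda>n. e n s) \<longlonglongrightarrow> 1 * 1 * (1 * 1)"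
        unfolding e_def by (intro tendsto_mult bump_tendsto_1) (auto simp: box_def Basis_complex_def)
      then show ?thesis using True by simp
    next
      case False
      then have "e n s = 0" for n
        by (auto simp: e_def box_def Basis_complex_def not_less intro!: bump_zero mult_nonneg_nonpos)
      then show ?thesis using False by simp
    qed
    have "(\<lambda>n. LBINT s. F s * (of_real (b s) * of_real (e n s))) \<longlonglongrightarrow>
        (LBINT s. F s * (of_real (b s) * of_real (indicator (box l u) s)))"
    proof (rule integral_dominated_convergence[where w = "\<lambda>z. norm (F z)"])
      show "integrable lborel (\<lambda>z. norm (F z))" using F by simp
      show "AE s in lborel. (\<lambda>n. F s * (of_real (b s) * of_real (e n s))) \<longlonglongrightarrow>
          F s * (of_real (b s) * of_real (indicator (box l u) s))"
        by (intro AE_I2 tendsto_intros lim)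
      show "AE s in lborel. norm (F s * (of_real (b s) * of_real (e n s))) \<le> norm (F s)" for n
        using b01 e01 by (intro AE_I2) (auto simp: norm_mult intro!: mult_left_le mult_le_one)
    qed measurable
    moreover have "(LBINT s. F s * (of_real (b s) * of_real (e n s))) = 0" for n
    proof (rule test)
      show "smooth (\<lambda>s. of_real (b s) * of_real (e n s) :: complex)"
        by (intro smooth_mult smooth_of_real sb se)
      fix s assume "S < cmod s"
      then have "b s = 0" using \<open>0 < S\<close> unfolding b_def by (intro bump_zero) (simp add: power_mono)
      then show "of_real (b s) * of_real (e n s) = (0::complex)" by simp
    qed
    ultimately have "(LBINT s. F s * (of_real (b s) * of_real (indicator (box l u) s))) = 0"
      by (simp add: LIMSEQ_const_iff)
    then show "(LBINT s. indicator (box l u) s *\<^sub>R (F s * of_real (b s))) = 0"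
      by (simp add: scaleR_conv_of_real mult_ac)
  qed
  then show ?thesis
  proof eventually_elim
    case (elim s)
    show ?case
    proof
      assume "cmod s < S"
      then have "b s > 0" unfolding b_def by (intro bump_pos) (simp add: power_strict_mono)
      then show "F s = 0" using elim by simp
    qed
  qed
qed

section \<open>The Cauchy formula for integrable functions in the plane\<close>

text \<open>A smooth substitute for the Cauchy kernel \<open>1 / w\<close>. Its derivative with respect to the conjugate of \<open>w\<close> is
the approximate identity \<open>approx_id\<close>, and its modulus never exceeds that of \<open>1 / w\<close>.\<close>

definition cauchy_reg :: "real \<Rightarrow> complex \<Rightarrow> complex" where
  "cauchy_reg e w = cnj w / of_real ((cmod w)\<^sup>2 + e)"

definition approx_id :: "real \<Rightarrow> complex \<Rightarrow> real" where
  "approx_id e w = e / ((cmod w)\<^sup>2 + e)\<^sup>2"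

lemma denominator_pos: "0 < e \<Longrightarrow> (cmod w)\<^sup>2 + e > 0"
  by (simp add: add_nonneg_pos)

lemma smooth_cauchy_reg: "0 < e \<Longrightarrow> smooth (\<lambda>w. cauchy_reg e (w - q))"
  unfolding cauchy_reg_def using denominator_pos
  by (intro smooth_divide smooth_of_real smooth_add smooth_cmod_sq smooth_cnj smooth_diff smooth_id smooth_const)
     (auto simp: order_less_imp_not_eq2 simp del: of_real_add of_real_power)

lemma cdbar_cauchy_reg:
  assumes "0 < e" shows "cdbar (\<lambda>w. cauchy_reg e (w - q)) w = of_real (approx_id e (w - q))"
proof -
  define x where "x = w - q"
  have n: "of_real ((cmod z)\<^sup>2 + e) = z * cnj z + of_real e" for z by (simp flip: complex_norm_square)
  have nz: "x * cnj x + of_real e \<noteq> 0" 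
    using denominator_pos[OF assms, of x] unfolding n[symmetric] by (simp del: of_real_add of_real_power)
  have d: "((\<lambda>w. w - q) has_derivative (\<lambda>h. h)) (at w)" by (auto intro!: derivative_eq_intros)
  have d1: "((\<lambda>w. cnj (w - q)) has_derivative (\<lambda>h. cnj h)) (at w)" by (rule has_derivative_cnj[OF d])
  have d2: "((\<lambda>w. (w - q) * cnj (w - q) + of_real e) has_derivative (\<lambda>h. x * cnj h + h * cnj x)) (at w)"
    using has_derivative_add[OF has_derivative_mult[OF d d1] has_derivative_const[of "of_real e"]] by (simp add: x_def)
  define D where "D = x * cnj x + of_real e"
  have "((\<lambda>w. cauchy_reg e (w - q)) has_derivative (\<lambda>h. (cnj h * D - cnj x * (x * cnj h + h * cnj x)) / (D * D))) (at w)"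
    unfolding cauchy_reg_def n D_def using has_derivative_divide'[OF d1 d2] nz by (simp add: x_def)
  moreover have "(cnj h * D - cnj x * (x * cnj h + h * cnj x)) = of_real e * cnj h - cnj x * cnj x * h" for h
    by (simp add: D_def algebra_simps)
  ultimately have "((\<lambda>w. cauchy_reg e (w - q)) has_derivative (\<lambda>h. (of_real e * cnj h - cnj x * cnj x * h) / (D * D))) (at w)"
    by simp
  from cdbar_eqI[OF this] have "cdbar (\<lambda>w. cauchy_reg e (w - q)) w
      = ((of_real e - cnj x * cnj x) + (of_real e + cnj x * cnj x)) / (D * D) / 2"
    by (simp add: add_divide_distrib[symmetric] algebra_simps)
  then have "cdbar (\<lambda>w. cauchy_reg e (w - q)) w = of_real e / (x * cnj x + of_real e)\<^sup>2"
    by (simp add: D_def power2_eq_square)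
  then show ?thesis by (simp add: approx_id_def x_def[symmetric] n[symmetric])
qed

lemma approx_id_nonneg: "0 < e \<Longrightarrow> 0 \<le> approx_id e w" by (simp add: approx_id_def)

lemma approx_id_le: assumes "0 < e" shows "approx_id e w \<le> 1 / e"
proof -
  have "e * e \<le> ((cmod w)\<^sup>2 + e)\<^sup>2" using assms unfolding power2_eq_square by (intro mult_mono) auto
  then show ?thesis using assms denominator_pos[OF assms, of w] by (simp add: approx_id_def divide_simps mult.commute)
qed

lemma norm_cauchy_reg_le: assumes "0 < e" shows "cmod (cauchy_reg e w) \<le> 1 / cmod w"
proof (cases "w = 0")
  case False
  have "cmod (cauchy_reg e w) = cmod w / ((cmod w)\<^sup>2 + e)"
    using assms by (simp add: cauchy_reg_def norm_divide abs_of_pos[OF denominator_pos] del: of_real_add of_real_power)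
  also have "\<dots> \<le> 1 / cmod w" using False assms denominator_pos[OF assms, of w]
    by (simp add: divide_simps power2_eq_square)
  finally show ?thesis .
qed (simp add: cauchy_reg_def)

lemma norm_cauchy_reg_bounded: assumes "0 < e" shows "cmod (cauchy_reg e w) \<le> 1 + 1 / e"
proof -
  have eq: "cmod (cauchy_reg e w) = cmod w / ((cmod w)\<^sup>2 + e)"
    using assms by (simp add: cauchy_reg_def norm_divide abs_of_pos[OF denominator_pos] del: of_real_add of_real_power)
  have "0 \<le> 1 / e" using assms by simp
  show ?thesis
  proof (cases "cmod w \<le> 1")
    case True
    have "cmod w / ((cmod w)\<^sup>2 + e) \<le> 1 / e" using True assms by (intro frac_le) auto
    then show ?thesis unfolding eq by linarith
  next
    case False
    then have "1 / cmod w \<le> 1" by (simp add: divide_le_eq)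
    then show ?thesis using norm_cauchy_reg_le[OF assms, of w] \<open>0 \<le> 1 / e\<close> by linarith
  qed
qed

lemma cauchy_reg_tendsto:
  assumes "e \<longlonglongrightarrow> 0" shows "(\<lambda>n. cauchy_reg (e n) w) \<longlonglongrightarrow> 1 / w"
proof (cases "w = 0")
  case False
  have "(\<lambda>n. cnj w / of_real ((cmod w)\<^sup>2 + e n)) \<longlonglongrightarrow> cnj w / of_real ((cmod w)\<^sup>2 + 0)"
    using False by (intro tendsto_intros assms) simp
  then show ?thesis using False
    by (simp add: cauchy_reg_def complex_norm_square flip: of_real_power)
qed (simp add: cauchy_reg_def)

text \<open>The number \<open>\<pi>\<close> of Cauchy's formula, as the mass of the approximate identity.\<close>

definition cauchy_const :: real where "cauchy_const = (LBINT w. approx_id 1 w)"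

lemma measurable_approx_id [measurable]: "approx_id e \<in> borel_measurable borel"
  unfolding approx_id_def[abs_def] by measurable

lemma measurable_cauchy_reg [measurable]: "cauchy_reg e \<in> borel_measurable borel"
  unfolding cauchy_reg_def[abs_def] by measurable

lemma integrable_approx_id: "integrable lborel (approx_id 1)"
proof (rule integrableI_bounded)
  obtain C where C: "\<And>\<rho>. \<rho> > 0 \<Longrightarrow> (NLINT x. ennreal (indicator (- ball (0::complex) \<rho>) x * cmod x powr (-4)))
             \<le> ennreal (C * \<rho> powr (2 - 4))" using nn_integral_power_exterior[of 4] by auto
  have "(NLINT x. ennreal (norm (approx_id 1 x))) \<le> 
      (NLINT x. indicator (ball 0 1) x + ennreal (indicator (- ball (0::complex) 1) x * cmod x powr (-4)))"
  proof (rule nn_integral_mono)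
    fix x
    show "ennreal (norm (approx_id 1 x)) \<le> indicator (ball 0 1) x + ennreal (indicator (- ball (0::complex) 1) x * cmod x powr (-4))"
    proof (cases "cmod x < 1")
      case True
      then show ?thesis using approx_id_le[of 1 x] approx_id_nonneg[of 1 x] by (simp add: ennreal_leI)
    next
      case False
      have "approx_id 1 x \<le> 1 / (cmod x ^ 2) ^ 2" unfolding approx_id_def using False
        by (intro divide_left_mono power_mono mult_pos_pos zero_less_power denominator_pos) auto
      also have "\<dots> = cmod x powr (-4)" using False by (auto simp: powr_minus_divide)
      finally show ?thesis using False approx_id_nonneg[of 1 x] by (simp add: ennreal_leI)
    qed
  qed
  also have "\<dots> = emeasure lborel (ball (0::complex) 1) + (NLINT x. ennreal (indicator (- ball (0::complex) 1) x * cmod x powr (-4)))"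
  proof (subst nn_integral_add)
    have [measurable]: "- ball (0::complex) 1 \<in> sets borel" by (intro borel_closed closed_Compl) simp
    show "(\<lambda>x. ennreal (indicator (- ball (0::complex) 1) x * cmod x powr (-4))) \<in> borel_measurable lborel"
      by measurable
    show "indicator (ball (0::complex) 1) \<in> borel_measurable lborel" by (intro borel_measurable_indicator) simp
    show "(NLINT x. indicator (ball (0::complex) 1) x) + (NLINT x. ennreal (indicator (- ball (0::complex) 1) x * cmod x powr (-4)))
      = emeasure lborel (ball (0::complex) 1) + (NLINT x. ennreal (indicator (- ball (0::complex) 1) x * cmod x powr (-4)))"
      by (subst nn_integral_indicator) auto
  qed
  also have "\<dots> < \<infinity>" 
    using le_less_trans[OF C[of 1] ennreal_less_top] by (simp only: emeasure_disc infinity_ennreal_def ennreal_add_less_top) simp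
  finally show "(NLINT x. ennreal (norm (approx_id 1 x))) < \<infinity>" .
qed simp

lemma cauchy_const_pos: "0 < cauchy_const"
proof -
  have "cauchy_const \<noteq> 0"
  proof
    assume "cauchy_const = 0"
    then have "AE x in lborel. approx_id 1 x = 0" unfolding cauchy_const_def
      using integral_nonneg_eq_0_iff_AE[OF integrable_approx_id] approx_id_nonneg[of 1] by simp
    then have "AE x in (lborel :: complex measure). False"
      by eventually_elim (use denominator_pos[of 1] in \<open>auto simp: approx_id_def less_le\<close>)
    then have "emeasure lborel (UNIV :: complex set) = 0" by (subst (asm) AE_iff_measurable[of UNIV]) auto
    then show False by simp
  qed
  moreover have "0 \<le> cauchy_const" unfolding cauchy_const_def
    by (intro integral_nonneg_AE AE_I2 approx_id_nonneg) simp
  ultimately show ?thesis by simp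
qed

lemma integral_rescale:
  fixes F :: "'a::euclidean_space \<Rightarrow> 'b::{banach, second_countable_topology}"
  assumes [measurable]: "F \<in> borel_measurable borel" and "h > 0"
  shows "(LBINT x. F x) = (LBINT x. (h ^ DIM('a)) *\<^sub>R F (w + h *\<^sub>R x))"
proof -
  have h: "h \<noteq> 0" using \<open>h > 0\<close> by simp
  show ?thesis
    by (subst lborel_affine[OF h, of w], subst integral_density, simp, simp, simp, subst integral_distr)
       (use \<open>h > 0\<close> in auto)
qed

text \<open>The approximate identities are rescalings of \<open>approx_id 1\<close>, so smoothing at scale \<open>h\<close> averages over the
points \<open>w + h x\<close> with a fixed density.\<close>

lemma approx_id_smoothing:
  assumes [measurable]: "Q \<in> sets borel" and "0 < h"
  shows "(LBINT q. indicator Q q * approx_id (h\<^sup>2) (w - q)) = (LBINT x. indicator Q (w + h *\<^sub>R x) * approx_id 1 x)"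
proof -
  have "h\<^sup>2 * approx_id (h\<^sup>2) (- (h *\<^sub>R x)) = approx_id 1 x" for x
  proof -
    have "(cmod (h *\<^sub>R x))\<^sup>2 + h\<^sup>2 = h\<^sup>2 * ((cmod x)\<^sup>2 + 1)" by (simp add: power_mult_distrib algebra_simps)
    then show ?thesis using \<open>0 < h\<close> by (simp add: approx_id_def power_mult_distrib power2_eq_square)
  qed
  then have *: "h\<^sup>2 *\<^sub>R (indicator Q (w + h *\<^sub>R x) * approx_id (h\<^sup>2) (w - (w + h *\<^sub>R x))) = indicator Q (w + h *\<^sub>R x) * approx_id 1 x" for x
    by (simp add: mult_ac)
  have "(LBINT q. indicator Q q * approx_id (h\<^sup>2) (w - q))
      = (LBINT x. h ^ DIM(complex) *\<^sub>R (indicator Q (w + h *\<^sub>R x) * approx_id (h\<^sup>2) (w - (w + h *\<^sub>R x))))"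
    by (rule integral_rescale[OF _ \<open>0 < h\<close>]) measurable
  then show ?thesis by (simp only: DIM_complex *)
qed

lemma approx_id_smoothing_le:
  assumes "Q \<in> sets borel" and "0 < h"
  shows "\<bar>LBINT q. indicator Q q * approx_id (h\<^sup>2) (w - q)\<bar> \<le> cauchy_const"
proof -
  note [measurable] = assms(1)
  have "norm (LBINT x. indicator Q (w + h *\<^sub>R x) * approx_id 1 x) \<le> (LBINT x. approx_id 1 x)"
    by (rule Bochner_Integration.integral_norm_bound_integral[OF Bochner_Integration.integrable_bound[OF integrable_approx_id] integrable_approx_id])
       (auto simp: approx_id_nonneg split: split_indicator)
  then show ?thesis unfolding approx_id_smoothing[OF assms] cauchy_const_def by simp
qed

lemma approx_id_smoothing_tendsto:
  assumes w: "w \<notin> frontier Q" and Q: "Q \<in> sets borel" and h: "\<And>n. 0 < h n" "h \<longlonglongrightarrow> 0"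
  shows "(\<lambda>n. LBINT q. indicator Q q * approx_id ((h n)\<^sup>2) (w - q)) \<longlonglongrightarrow> cauchy_const * indicator Q w"
proof -
  note [measurable] = Q
  have "(\<lambda>n. LBINT x. indicator Q (w + h n *\<^sub>R x) * approx_id 1 x) \<longlonglongrightarrow> (LBINT x. indicator Q w * approx_id 1 x)"
  proof (rule integral_dominated_convergence[OF _ _ integrable_approx_id])
    show "AE x in lborel. (\<lambda>n. indicator Q (w + h n *\<^sub>R x) * approx_id 1 x) \<longlonglongrightarrow> indicator Q w * approx_id 1 x"
    proof (rule AE_I2)
      fix x
      have t: "(\<lambda>n. w + h n *\<^sub>R x) \<longlonglongrightarrow> w" using tendsto_add[OF tendsto_const tendsto_scaleR[OF h(2) tendsto_const]] by simp
      define U where "U = (if w \<in> Q then interior Q else - closure Q)"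
      have "open U" "w \<in> U" using w closure_subset[of Q] interior_subset[of Q] by (auto simp del: interior_subset closure_subset simp: U_def frontier_def)
      have U: "x \<in> U \<Longrightarrow> x \<in> Q \<longleftrightarrow> w \<in> Q" for x
        by (cases "w \<in> Q") (auto simp: U_def dest: interior_subset[THEN subsetD] closure_subset[THEN subsetD])
      from topological_tendstoD[OF t \<open>open U\<close> \<open>w \<in> U\<close>]
      have "\<forall>\<^sub>F n in sequentially. w + h n *\<^sub>R x \<in> U" .
      then have "\<forall>\<^sub>F n in sequentially. indicator Q (w + h n *\<^sub>R x) * approx_id 1 x = indicator Q w * approx_id 1 x"
        by eventually_elim (auto simp: indicator_def U)
      then show "(\<lambda>n. indicator Q (w + h n *\<^sub>R x) * approx_id 1 x) \<longlonglongrightarrow> indicator Q w * approx_id 1 x"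
        by (rule tendsto_eventually)
    qed
  qed (auto simp: approx_id_nonneg split: split_indicator)
  then show ?thesis
    by (simp add: approx_id_smoothing[OF Q h(1)] cauchy_const_def mult.commute)
qed

lemma nn_integral_inverse_distance_le:
  assumes "bounded A" and [measurable]: "A \<in> sets (borel :: complex measure)"
  shows "\<exists>C\<ge>0. \<forall>w. (NLINT q. indicator A q * ennreal (1 / cmod (w - q))) \<le> ennreal C"
proof -
  obtain C where C: "C \<ge> 0" "\<And>\<rho>. \<rho> > 0 \<Longrightarrow> (NLINT x. ennreal (indicator (ball (0::complex) \<rho>) x * cmod x powr (-1)))
             \<le> ennreal (C * \<rho> powr (2 - 1))" using nn_integral_power_disc[of 1] by auto
  have A: "emeasure lborel A < \<infinity>" using emeasure_bounded_finite[OF assms(1)] .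
  define m where "m = measure lborel A"
  have m: "emeasure lborel A = ennreal m" "0 \<le> m" using A by (auto simp: m_def emeasure_eq_ennreal_measure less_top)
  have "(NLINT q. indicator A q * ennreal (1 / cmod (w - q))) \<le> ennreal (C + m)" for w
  proof -
    have "(NLINT q. indicator A q * ennreal (1 / cmod (w - q)))
        \<le> (NLINT q. ennreal (indicator (ball (0::complex) 1) (q - w) * cmod (q - w) powr (-1)) + indicator A q)"
    proof (rule nn_integral_mono)
      fix q
      show "indicator A q * ennreal (1 / cmod (w - q)) \<le>
         ennreal (indicator (ball (0::complex) 1) (q - w) * cmod (q - w) powr (-1)) + indicator A q"
      proof (cases "cmod (q - w) < 1")
        case True
        then show ?thesis by (auto split: split_indicator simp: powr_minus_divide norm_minus_commute intro!: add_increasing2)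
      next
        case False
        then have "1 \<le> cmod (w - q)" by (simp add: norm_minus_commute)
        then have "1 / cmod (w - q) \<le> 1" by (intro divide_le_eq_1_pos[THEN iffD2]) auto
        then have "ennreal (1 / cmod (w - q)) \<le> 1" by simp
        then show ?thesis using False by (auto split: split_indicator)
      qed
    qed
    also have "\<dots> = (NLINT x. ennreal (indicator (ball (0::complex) 1) x * cmod x powr (-1))) + emeasure lborel A"
    proof -
      define k where "k x = ennreal (indicator (ball (0::complex) 1) x * cmod x powr (-1))" for x
      have [measurable]: "k \<in> borel_measurable borel" unfolding k_def[abs_def]
        by (intro measurable_compose[OF _ measurable_ennreal] borel_measurable_times borel_measurable_indicator powr_real_measurable borel_measurable_const borel_measurable_norm) auto
      show ?thesis unfolding k_def[symmetric]
        by (subst nn_integral_add) (simp_all add: nn_integral_translate)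
    qed
    also have "\<dots> \<le> ennreal (C + m)" using C(2)[of 1] C(1) m by (simp add: ennreal_plus add_mono)
    finally show ?thesis .
  qed
  then show ?thesis using C(1) m(2) by (intro exI[of _ "C + m"]) auto
qed

lemma integrable_pairI:
  fixes T :: "complex \<times> complex \<Rightarrow> complex"
  assumes [measurable]: "T \<in> borel_measurable (lborel \<Otimes>\<^sub>M lborel)"
    and fin: "(NLINT x. NLINT y. ennreal (cmod (T (x, y)))) < \<infinity>"
  shows "integrable (lborel \<Otimes>\<^sub>M lborel) T"
proof (rule integrableI_bounded)
  have "(\<integral>\<^sup>+x. ennreal (cmod (T x)) \<partial>(lborel \<Otimes>\<^sub>M lborel)) = (NLINT x. NLINT y. ennreal (cmod (T (x, y))))"
    by (rule lborel.nn_integral_fst[symmetric]) measurable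
  then show "(\<integral>\<^sup>+x. ennreal (cmod (T x)) \<partial>(lborel \<Otimes>\<^sub>M lborel)) < \<infinity>" using fin by simp
qed simp

text \<open>The hypothesis says that \<open>f\<close>, smoothed by \<open>approx_id\<close>, is minus the transform of \<open>H\<close> by the regularized kernel;
this is what one gets by inserting \<open>cauchy_reg\<close> as a test function into a weak equation. Integrated over
a box in \<open>q\<close>, the smoothing becomes a smoothed indicator of the box and the limit of vanishing
regularization can be taken by dominated convergence. Hence \<open>cauchy_const * f\<close> and minus the Cauchy
transform of \<open>H\<close> have the same integral over every box, and so agree almost everywhere.\<close>

lemma cauchy_transform_representation:
  assumes f: "integrable lborel f" and H: "integrable lborel H"
    and rep: "\<And>n. AE q in lborel. (LBINT w. f w * of_real (approx_id ((1 / Suc n)\<^sup>2) (w - q)) + H w * cauchy_reg ((1 / Suc n)\<^sup>2) (w - q)) = 0"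
  shows "AE q in lborel. ennreal (cauchy_const * cmod (f q)) \<le> (NLINT w. ennreal (cmod (H w) / cmod (w - q)))"
proof -
  note [measurable] = borel_measurable_integrable[OF f] borel_measurable_integrable[OF H]
  define h where "h n = 1 / real (Suc n)" for n
  have h: "0 < h n" "0 < (h n)\<^sup>2" for n by (auto simp: h_def)
  have h0: "h \<longlonglongrightarrow> 0" unfolding h_def by (rule LIMSEQ_Suc[OF lim_1_over_n])
  then have h20: "(\<lambda>n. (h n)\<^sup>2) \<longlonglongrightarrow> 0" using tendsto_power[OF h0, of 2] by simp
  have fb: "(NLINT w. ennreal (cmod (f w))) < \<infinity>" and Hb: "(NLINT w. ennreal (cmod (H w))) < \<infinity>"
    using f H by (auto simp: integrable_iff_bounded)
  define \<Phi> where "\<Phi> q = (LBINT w. H w / (w - q))" for q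
  have box: "integrable lborel (\<lambda>q. indicator Q q *\<^sub>R (cauchy_const * f q + \<Phi> q))"
      "(LBINT q. indicator Q q *\<^sub>R (cauchy_const * f q + \<Phi> q)) = 0"
    if Q_def: "Q = box l u" for Q l u
  proof -
    have Q[measurable]: "Q \<in> sets borel" and bQ: "bounded Q" by (auto simp: Q_def)
    obtain C where C: "C \<ge> 0" "\<And>w. (NLINT q. indicator Q q * ennreal (1 / cmod (w - q))) \<le> ennreal C"
      using nn_integral_inverse_distance_le[OF bQ Q] by blast
    define T where "T n = (\<lambda>(w, q). indicator Q q *\<^sub>R (f w * of_real (approx_id ((h n)\<^sup>2) (w - q)) + H w * cauchy_reg ((h n)\<^sup>2) (w - q)))" for n
    define T0 where "T0 = (\<lambda>(w, q). indicator Q q *\<^sub>R (H w / (w - q)))"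
    define E where "E n w = (LBINT q. indicator Q q * approx_id ((h n)\<^sup>2) (w - q))" for n w
    define G where "G n w = (LBINT q. indicator Q q *\<^sub>R cauchy_reg ((h n)\<^sup>2) (w - q))" for n w
    define G0 where "G0 w = (LBINT q. indicator Q q *\<^sub>R (1 / (w - q)))" for w
    have [measurable]: "T n \<in> borel_measurable (lborel \<Otimes>\<^sub>M lborel)" "T0 \<in> borel_measurable (lborel \<Otimes>\<^sub>M lborel)" for n
      unfolding T_def T0_def by measurable
    have eQ: "emeasure lborel Q < \<infinity>" using emeasure_bounded_finite[OF bQ] .
    have iker: "integrable lborel (\<lambda>q. indicator Q q *\<^sub>R (1 / cmod (w - q)))" for w
    proof (rule integrableI_bounded)
      have "(NLINT q. ennreal (norm (indicator Q q *\<^sub>R (1 / cmod (w - q))))) = (NLINT q. indicator Q q * ennreal (1 / cmod (w - q)))"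
        by (intro nn_integral_cong) (auto split: split_indicator)
      also have "\<dots> < \<infinity>" using le_less_trans[OF C(2) ennreal_less_top] by simp
      finally show "(NLINT q. ennreal (norm (indicator Q q *\<^sub>R (1 / cmod (w - q))))) < \<infinity>" .
    qed measurable
    have kC: "(LBINT q. indicator Q q *\<^sub>R (1 / cmod (w - q))) \<le> C" for w
    proof -
      have "ennreal (LBINT q. indicator Q q *\<^sub>R (1 / cmod (w - q))) = (NLINT q. ennreal (indicator Q q *\<^sub>R (1 / cmod (w - q))))"
        by (rule nn_integral_eq_integral[symmetric, OF iker]) simp
      also have "\<dots> = (NLINT q. indicator Q q * ennreal (1 / cmod (w - q)))"
        by (intro nn_integral_cong) (auto split: split_indicator)
      finally show ?thesis using C by (metis ennreal_le_iff)
    qed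
    have iE: "integrable lborel (\<lambda>q. indicator Q q * approx_id ((h n)\<^sup>2) (w - q))" for n w
      by (rule Bochner_Integration.integrable_bound[of _ "\<lambda>q. indicator Q q *\<^sub>R (1 / (h n)\<^sup>2)"])
         (use eQ h(2)[of n] approx_id_le[OF h(2)[of n]] approx_id_nonneg[OF h(2)[of n]] in \<open>auto split: split_indicator\<close>)
    have iG: "integrable lborel (\<lambda>q. indicator Q q *\<^sub>R cauchy_reg ((h n)\<^sup>2) (w - q))" for n w
      by (rule Bochner_Integration.integrable_bound[OF iker[of w]])
         (use norm_cauchy_reg_le[OF h(2)[of n]] in \<open>auto split: split_indicator\<close>)
    have iG0: "integrable lborel (\<lambda>q. indicator Q q *\<^sub>R (1 / (w - q)))" for w
      by (rule Bochner_Integration.integrable_bound[OF iker[of w]]) (auto simp: norm_divide split: split_indicator)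
    have nG: "cmod (G n w) \<le> C" for n w
      unfolding G_def by (rule order_trans[OF _ kC[of w]], rule Bochner_Integration.integral_norm_bound_integral[OF iG iker])
         (use norm_cauchy_reg_le[OF h(2)[of n]] in \<open>auto split: split_indicator\<close>)
    have iT: "integrable (lborel \<Otimes>\<^sub>M lborel) (T n)" for n
    proof (rule integrable_pairI)
      have "(NLINT y. ennreal (cmod (T n (x, y)))) \<le> ennreal (cmod (f x)) * (ennreal (1 / (h n)\<^sup>2) * emeasure lborel Q) + ennreal (cmod (H x)) * ennreal C" for x
      proof -
        have "(NLINT y. ennreal (cmod (T n (x, y)))) \<le> (NLINT y. ennreal (cmod (f x)) * (ennreal (1 / (h n)\<^sup>2) * indicator Q y)
              + ennreal (cmod (H x)) * (indicator Q y * ennreal (1 / cmod (x - y))))"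
        proof (rule nn_integral_mono)
          fix y
          have "cmod (f x * of_real (approx_id ((h n)\<^sup>2) (x - y)) + H x * cauchy_reg ((h n)\<^sup>2) (x - y))
               \<le> cmod (f x) * (1 / (h n)\<^sup>2) + cmod (H x) * (1 / cmod (x - y))"
            using approx_id_le[OF h(2), of n "x - y"] approx_id_nonneg[OF h(2), of n "x - y"] norm_cauchy_reg_le[OF h(2), of n "x - y"]
            by (intro order_trans[OF norm_triangle_ineq] add_mono)
               (simp_all only: norm_mult norm_of_real abs_of_nonneg mult_left_mono norm_ge_zero)
          then have "ennreal (cmod (f x * of_real (approx_id ((h n)\<^sup>2) (x - y)) + H x * cauchy_reg ((h n)\<^sup>2) (x - y)))
              \<le> ennreal (cmod (f x)) * ennreal (1 / (h n)\<^sup>2) + ennreal (cmod (H x)) * ennreal (1 / cmod (x - y))"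
            by (simp add: ennreal_leI flip: ennreal_mult ennreal_plus)
          then show "ennreal (cmod (T n (x, y))) \<le> ennreal (cmod (f x)) * (ennreal (1 / (h n)\<^sup>2) * indicator Q y)
              + ennreal (cmod (H x)) * (indicator Q y * ennreal (1 / cmod (x - y)))"
            by (auto simp: T_def split: split_indicator)
        qed
        also have "\<dots> = ennreal (cmod (f x)) * (ennreal (1 / (h n)\<^sup>2) * emeasure lborel Q) + ennreal (cmod (H x)) * (NLINT y. indicator Q y * ennreal (1 / cmod (x - y)))"
          by (subst nn_integral_add) (simp_all add: nn_integral_cmult)
        also have "\<dots> \<le> ennreal (cmod (f x)) * (ennreal (1 / (h n)\<^sup>2) * emeasure lborel Q) + ennreal (cmod (H x)) * ennreal C"
          by (intro add_left_mono mult_left_mono C(2)) simp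
        finally show ?thesis .
      qed
      then have "(NLINT x. NLINT y. ennreal (cmod (T n (x, y))))
        \<le> (NLINT x. ennreal (cmod (f x)) * (ennreal (1 / (h n)\<^sup>2) * emeasure lborel Q) + ennreal (cmod (H x)) * ennreal C)"
        by (intro nn_integral_mono) blast
      also have "\<dots> = (NLINT x. ennreal (cmod (f x))) * (ennreal (1 / (h n)\<^sup>2) * emeasure lborel Q) + (NLINT x. ennreal (cmod (H x))) * ennreal C"
        by (subst nn_integral_add) (simp_all add: nn_integral_multc)
      also have "\<dots> < \<infinity>" using fb Hb eQ by (simp add: ennreal_mult_less_top)
      finally show "(NLINT x. NLINT y. ennreal (cmod (T n (x, y)))) < \<infinity>" .
    qed simp
    have iT0: "integrable (lborel \<Otimes>\<^sub>M lborel) T0"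
    proof (rule integrable_pairI)
      have "(NLINT y. ennreal (cmod (T0 (x, y)))) \<le> ennreal (cmod (H x)) * ennreal C" for x
      proof -
        have "(NLINT y. ennreal (cmod (T0 (x, y)))) = (NLINT y. ennreal (cmod (H x)) * (indicator Q y * ennreal (1 / cmod (x - y))))"
          by (intro nn_integral_cong) (auto simp: T0_def norm_divide ennreal_mult[symmetric] split: split_indicator)
        also have "\<dots> = ennreal (cmod (H x)) * (NLINT y. indicator Q y * ennreal (1 / cmod (x - y)))"
          by (rule nn_integral_cmult) measurable
        also have "\<dots> \<le> ennreal (cmod (H x)) * ennreal C" by (intro mult_left_mono C(2)) simp
        finally show ?thesis .
      qed
      then have "(NLINT x. NLINT y. ennreal (cmod (T0 (x, y)))) \<le> (NLINT x. ennreal (cmod (H x)) * ennreal C)"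
        by (intro nn_integral_mono) blast
      also have "\<dots> = (NLINT x. ennreal (cmod (H x))) * ennreal C" by (simp add: nn_integral_multc)
      also have "\<dots> < \<infinity>" using Hb by (simp add: ennreal_mult_less_top)
      finally show "(NLINT x. NLINT y. ennreal (cmod (T0 (x, y)))) < \<infinity>" .
    qed simp
    (* the hypothesis integrated over the box in q, after Fubini's theorem *)
  have sum0: "(LBINT w. f w * of_real (E n w) + H w * G n w) = 0" for n
    proof -
      have "(LBINT w. f w * of_real (E n w) + H w * G n w) = (LBINT w. (LBINT q. T n (w, q)))"
      proof (rule Bochner_Integration.integral_cong[OF refl])
        fix w
        have "(LBINT q. T n (w, q)) = (LBINT q. f w * of_real (indicator Q q * approx_id ((h n)\<^sup>2) (w - q)) + H w * (indicator Q q *\<^sub>R cauchy_reg ((h n)\<^sup>2) (w - q)))"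
          by (intro Bochner_Integration.integral_cong) (auto simp: T_def split: split_indicator)
        also have "\<dots> = f w * of_real (E n w) + H w * G n w"
        proof -
          have 1: "integrable lborel (\<lambda>q. f w * complex_of_real (indicator Q q * approx_id ((h n)\<^sup>2) (w - q)))"
            using iE[of n w] by (intro integrable_mult_right impI integrable_of_real)
          have 2: "integrable lborel (\<lambda>q. H w * (indicator Q q *\<^sub>R cauchy_reg ((h n)\<^sup>2) (w - q)))"
            using iG[of n w] by (intro integrable_mult_right impI)
          have 3: "(LBINT q. f w * complex_of_real (indicator Q q * approx_id ((h n)\<^sup>2) (w - q))) = f w * of_real (E n w)"
            unfolding E_def integral_complex_of_real[symmetric] by (rule integral_mult_right_zero)
          have 4: "(LBINT q. H w * (indicator Q q *\<^sub>R cauchy_reg ((h n)\<^sup>2) (w - q))) = H w * G n w"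
            unfolding G_def by (rule integral_mult_right_zero)
          show ?thesis unfolding Bochner_Integration.integral_add[OF 1 2] 3 4 ..
        qed
        finally show "f w * of_real (E n w) + H w * G n w = (LBINT q. T n (w, q))" by simp
      qed
      also have "\<dots> = (LBINT q. (LBINT w. T n (w, q)))"
        by (rule lborel_pair.Fubini_integral[symmetric]) (use iT in simp)
      also have "\<dots> = (\<integral>q. 0 \<partial>(lborel :: complex measure))"
      proof (rule integral_cong_AE)
        show "AE q in lborel. (LBINT w. T n (w, q)) = 0"
          using rep[of n] by eventually_elim (auto simp: T_def h_def)
      qed measurable
      finally show ?thesis by simp
    qed
    have [measurable]: "E n \<in> borel_measurable borel" "G n \<in> borel_measurable borel" "G0 \<in> borel_measurable borel" for n
    proof -
      have "E n \<in> borel_measurable lborel" "G n \<in> borel_measurable lborel" "G0 \<in> borel_measurable lborel"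
        unfolding E_def G_def G0_def by measurable
      then show "E n \<in> borel_measurable borel" "G n \<in> borel_measurable borel" "G0 \<in> borel_measurable borel" by simp_all
    qed
    have "frontier Q \<in> null_sets lebesgue"
      unfolding negligible_iff_null_sets[symmetric] Q_def by (intro negligible_convex_frontier convex_box)
    then have "frontier Q \<in> null_sets lborel" by (simp add: null_sets_completion_iff)
    then have nf: "AE w in lborel. w \<notin> frontier Q" by (rule AE_not_in)
    have "(\<lambda>n. LBINT w. f w * of_real (E n w) + H w * G n w) \<longlonglongrightarrow> (LBINT w. f w * of_real (cauchy_const * indicator Q w) + H w * G0 w)"
    proof (rule integral_dominated_convergence[where w = "\<lambda>w. cauchy_const * cmod (f w) + C * cmod (H w)"])
      show "integrable lborel (\<lambda>w. cauchy_const * cmod (f w) + C * cmod (H w))" using f H by simp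
      show "AE w in lborel. (\<lambda>n. f w * of_real (E n w) + H w * G n w) \<longlonglongrightarrow> f w * of_real (cauchy_const * indicator Q w) + H w * G0 w"
        using nf
      proof eventually_elim
        case (elim w)
        have "(\<lambda>n. G n w) \<longlonglongrightarrow> G0 w" unfolding G_def G0_def
        proof (rule integral_dominated_convergence[OF _ _ iker[of w]])
          show "AE q in lborel. (\<lambda>n. indicator Q q *\<^sub>R cauchy_reg ((h n)\<^sup>2) (w - q)) \<longlonglongrightarrow> indicator Q q *\<^sub>R (1 / (w - q))"
            by (intro AE_I2 tendsto_intros cauchy_reg_tendsto h20)
          show "AE q in lborel. norm (indicator Q q *\<^sub>R cauchy_reg ((h n)\<^sup>2) (w - q)) \<le> indicator Q q *\<^sub>R (1 / cmod (w - q))" for n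
            using norm_cauchy_reg_le[OF h(2)[of n]] by (auto split: split_indicator)
        qed measurable
        moreover have "(\<lambda>n. E n w) \<longlonglongrightarrow> cauchy_const * indicator Q w"
          unfolding E_def by (rule approx_id_smoothing_tendsto[OF elim Q h(1) h0])
        ultimately show ?case by (intro tendsto_intros)
      qed
      show "AE w in lborel. norm (f w * of_real (E n w) + H w * G n w) \<le> cauchy_const * cmod (f w) + C * cmod (H w)" for n
      proof (rule AE_I2)
        fix w
        have "\<bar>E n w\<bar> \<le> cauchy_const" unfolding E_def by (rule approx_id_smoothing_le[OF Q h(1)])
        then show "norm (f w * of_real (E n w) + H w * G n w) \<le> cauchy_const * cmod (f w) + C * cmod (H w)"
          using nG[of n w] by (intro order_trans[OF norm_triangle_ineq] add_mono)
            (auto simp: norm_mult mult.commute[of "cmod (f w)"] mult.commute[of "cmod (H w)"] intro!: mult_right_mono)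
      qed
    qed measurable
    then have lim: "(LBINT w. f w * of_real (cauchy_const * indicator Q w) + H w * G0 w) = 0"
      by (simp add: sum0 LIMSEQ_const_iff)
    have fQ: "integrable lborel (\<lambda>w. f w * of_real (cauchy_const * indicator Q w))"
      by (rule Bochner_Integration.integrable_bound[of _ "\<lambda>w. cauchy_const *\<^sub>R f w"])
         (use f in \<open>auto simp: norm_mult split: split_indicator\<close>)
    have HG: "H w * G0 w = (LBINT q. T0 (w, q))" for w
    proof -
      have "(LBINT q. T0 (w, q)) = (LBINT q. H w * (indicator Q q *\<^sub>R (1 / (w - q))))"
        by (intro Bochner_Integration.integral_cong) (auto simp: T0_def split: split_indicator)
      then show ?thesis unfolding G0_def by (simp only: integral_mult_right_zero)
    qed
    have iHG: "integrable lborel (\<lambda>w. H w * G0 w)"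
      unfolding HG using lborel_pair.integrable_fst'[OF iT0] .
    have t0: "(LBINT w. T0 (w, q)) = indicator Q q *\<^sub>R \<Phi> q" for q
      by (auto simp: T0_def \<Phi>_def split: split_indicator)
    have "(LBINT w. H w * G0 w) = (LBINT q. (LBINT w. T0 (w, q)))"
      unfolding HG by (rule lborel_pair.Fubini_integral[symmetric]) (use iT0 in simp)
    also have "\<dots> = (LBINT q. indicator Q q *\<^sub>R \<Phi> q)" by (simp only: t0)
    finally have HP: "(LBINT w. H w * G0 w) = (LBINT q. indicator Q q *\<^sub>R \<Phi> q)" .
    have iP: "integrable lborel (\<lambda>q. indicator Q q *\<^sub>R \<Phi> q)"
      using lborel_pair.integrable_snd[of "\<lambda>w q. T0 (w, q)"] iT0 by (simp add: t0)
    have eq: "indicator Q q *\<^sub>R (cauchy_const * f q + \<Phi> q) = f q * of_real (cauchy_const * indicator Q q) + indicator Q q *\<^sub>R \<Phi> q" for q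
      by (auto split: split_indicator)
    show "integrable lborel (\<lambda>q. indicator Q q *\<^sub>R (cauchy_const * f q + \<Phi> q))"
      unfolding eq by (rule Bochner_Integration.integrable_add[OF fQ iP])
    show "(LBINT q. indicator Q q *\<^sub>R (cauchy_const * f q + \<Phi> q)) = 0"
      unfolding eq using lim unfolding Bochner_Integration.integral_add[OF fQ iP] Bochner_Integration.integral_add[OF fQ iHG] HP .
  qed
  have "AE q in lborel. indicator (box (- (real n *\<^sub>R One)) (real n *\<^sub>R One)) q *\<^sub>R (cauchy_const * f q + \<Phi> q) = 0" for n
  proof (rule AE_zero_if_box_integrals_zero)
    fix l u :: complex
    obtain a b where ab: "box l u \<inter> box (- (real n *\<^sub>R One)) (real n *\<^sub>R One) = box a b" using box_Int_box by blast
    have "indicator (box l u) z *\<^sub>R indicator (box (- (real n *\<^sub>R One)) (real n *\<^sub>R One)) z *\<^sub>R (cauchy_const * f z + \<Phi> z)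
        = indicator (box a b) z *\<^sub>R (cauchy_const * f z + \<Phi> z)" for z
      unfolding ab[symmetric] by (auto split: split_indicator)
    then show "(LBINT z. indicator (box l u) z *\<^sub>R indicator (box (- (real n *\<^sub>R One)) (real n *\<^sub>R One)) z *\<^sub>R (cauchy_const * f z + \<Phi> z)) = 0"
      by (simp only: box(2)[OF refl])
  qed (rule box(1)[OF refl])
  then have "AE q in lborel. \<forall>n. indicator (box (- (real n *\<^sub>R One)) (real n *\<^sub>R One)) q *\<^sub>R (cauchy_const * f q + \<Phi> q) = 0"
    unfolding AE_all_countable by blast
  then show ?thesis
  proof eventually_elim
    case (elim q)
    have "q \<in> (\<Union>i::nat. box (- (real i *\<^sub>R One)) (real i *\<^sub>R One))" unfolding UN_box_eq_UNIV by simp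
    then obtain n where "q \<in> box (- (real n *\<^sub>R One)) (real n *\<^sub>R One)" by blast
    with elim have e: "cauchy_const * f q + \<Phi> q = 0" by (metis (no_types, lifting) indicator_simps(1) scaleR_one)
    then have "cauchy_const * cmod (f q) = cmod (\<Phi> q)"
      using cauchy_const_pos by (metis abs_of_pos add_eq_0_iff norm_minus_cancel norm_mult norm_of_real)
    also have "ennreal (cmod (\<Phi> q)) \<le> (NLINT w. ennreal (cmod (H w / (w - q))))"
      unfolding \<Phi>_def by (cases "integrable lborel (\<lambda>w. H w / (w - q))")
        (auto simp: not_integrable_integral_eq intro: integral_norm_bound_ennreal)
    finally show ?case by (simp add: norm_divide)
  qed
qed

section \<open>Planar cutoff functions\<close>

lemma cdbar_mult:
  assumes "f differentiable (at w)" "g differentiable (at w)"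
  shows "cdbar (\<lambda>w. f w * g w) w = cdbar f w * g w + f w * cdbar g w"
proof -
  have "((\<lambda>w. f w * g w) has_derivative (\<lambda>h. f w * frechet_derivative g (at w) h + frechet_derivative f (at w) h * g w)) (at w)"
    using assms by (intro has_derivative_mult) (auto simp: frechet_derivative_works)
  then show ?thesis by (subst cdbar_eqI) (assumption, simp add: cdbar_def field_simps)
qed

lemma cdbar_holomorphic:
  assumes "(f has_field_derivative D) (at w)" shows "cdbar f w = 0"
  using cdbar_eqI[OF assms[unfolded has_field_derivative_def]] by (simp add: complex_eq_iff)

lemma cdbar_scale:
  assumes "smooth f" shows "cdbar (\<lambda>w. f (of_real c * w)) w = of_real c * cdbar f (of_real c * w)"
proof -
  have d: "((\<lambda>w. of_real c * w) has_derivative (\<lambda>h. of_real c * h)) (at w)"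
    by (auto intro!: derivative_eq_intros)
  from cdbar_eqI[OF has_derivative_compose[OF d smooth_has_derivative[OF assms]]] show ?thesis
    by (simp add: frechet_cdel_cdbar smooth_differentiable assms cdbar_def[of "\<lambda>w. f (of_real c * w)"] field_simps)
qed

lemma smooth_divide_power:
  fixes A :: "complex \<Rightarrow> complex"
  assumes A: "smooth A" and "0 < a" and z: "\<And>w. cmod w \<le> a \<Longrightarrow> A w = 0"
  shows "smooth (\<lambda>w. A w / w ^ m)"
proof -
  obtain J where J: "smooth J" "\<And>w. a \<le> cmod w \<Longrightarrow> J w = 1 / w"
    using smooth_reciprocal[OF \<open>0 < a\<close>] by blast
  have "A w / w ^ m = A w * J w ^ m" for w
  proof (cases "A w = 0")
    case False
    then have "J w = 1 / w" using z[of w] by (intro J(2)) force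
    then show ?thesis by (simp add: power_one_over)
  qed simp
  moreover have "smooth (\<lambda>w. A w * J w ^ m)" by (intro smooth_mult smooth_power A J)
  ultimately show ?thesis by presburger
qed

lemma cdbar_divide_power:
  assumes "A differentiable (at w)" "w \<noteq> 0"
  shows "cdbar (\<lambda>w. A w / w ^ m) w = cdbar A w / w ^ m"
proof -
  have D: "((\<lambda>w. inverse (w ^ m)) has_field_derivative (- (inverse (w ^ m) * (of_nat m * w ^ (m - Suc 0)) * inverse (w ^ m)))) (at w)"
  proof (rule DERIV_inverse')
    show "((\<lambda>w. w ^ m) has_field_derivative of_nat m * w ^ (m - Suc 0)) (at w)"
      by (auto intro!: derivative_eq_intros)
  qed (use assms(2) in auto)
  then have "(\<lambda>w. inverse (w ^ m)) differentiable (at w)"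
    unfolding differentiable_def has_field_derivative_def by blast
  from cdbar_mult[OF assms(1) this] cdbar_holomorphic[OF D] show ?thesis
    by (simp add: divide_inverse)
qed

definition disc_cutoff :: "real \<Rightarrow> real \<Rightarrow> complex \<Rightarrow> complex" where
  "disc_cutoff r1 r2 w = of_real (1 - step (((cmod w)\<^sup>2 - r1\<^sup>2) / (r2\<^sup>2 - r1\<^sup>2)))"

lemma disc_cutoff:
  assumes "0 \<le> r1" "r1 < r2"
  shows smooth_disc_cutoff: "smooth (disc_cutoff r1 r2)"
    and disc_cutoff_inner: "\<And>w. cmod w \<le> r1 \<Longrightarrow> disc_cutoff r1 r2 w = 1"
    and disc_cutoff_outer: "\<And>w. r2 \<le> cmod w \<Longrightarrow> disc_cutoff r1 r2 w = 0"
    and disc_cutoff_le: "\<And>w. cmod (disc_cutoff r1 r2 w) \<le> 1"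
proof -
  have p: "r2\<^sup>2 - r1\<^sup>2 > 0" using assms by (simp add: power_strict_mono)
  show "smooth (disc_cutoff r1 r2)" unfolding disc_cutoff_def[abs_def] using p
    by (intro smooth_of_real smooth_diff smooth_const smooth_compose[OF smooth_step] smooth_divide smooth_cmod_sq smooth_id) auto
  show "disc_cutoff r1 r2 w = 1" if "cmod w \<le> r1" for w
  proof -
    have "(cmod w)\<^sup>2 \<le> r1\<^sup>2" using that by (intro power_mono) auto
    then show ?thesis using p by (simp add: disc_cutoff_def step_zero divide_nonpos_pos)
  qed
  show "disc_cutoff r1 r2 w = 0" if "r2 \<le> cmod w" for w
  proof -
    have "r2\<^sup>2 \<le> (cmod w)\<^sup>2" using that assms by (intro power_mono) auto
    then show ?thesis using p by (simp add: disc_cutoff_def step_one)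
  qed
  show "cmod (disc_cutoff r1 r2 w) \<le> 1" for w
    unfolding disc_cutoff_def norm_of_real
    using step_nonneg[of "((cmod w)\<^sup>2 - r1\<^sup>2) / (r2\<^sup>2 - r1\<^sup>2)"] step_le_1[of "((cmod w)\<^sup>2 - r1\<^sup>2) / (r2\<^sup>2 - r1\<^sup>2)"] by linarith
qed

lemma continuous_bounded_on_cball:
  fixes f :: "complex \<Rightarrow> complex"
  assumes "continuous_on UNIV f" "\<And>w. R < cmod w \<Longrightarrow> f w = 0"
  shows "\<exists>B\<ge>0. \<forall>w. cmod (f w) \<le> B"
proof -
  have "bounded (f ` cball 0 R)"
    using assms(1) by (intro compact_imp_bounded compact_continuous_image) (auto intro: continuous_on_subset)
  then obtain B where "\<forall>x\<in>cball 0 R. cmod (f x) \<le> B" unfolding bounded_iff by auto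
  then have B: "\<And>w. cmod w \<le> R \<Longrightarrow> cmod (f w) \<le> B" by auto
  have "cmod (f w) \<le> max B 0" for w using B[of w] assms(2)[of w] by (cases "cmod w \<le> R") auto
  then show ?thesis by (intro exI[of _ "max B 0"]) auto
qed

lemma cdbar_zero_if_constant_near:
  assumes "open U" "w \<in> U" "\<And>x. x \<in> U \<Longrightarrow> f x = c" shows "cdbar f w = 0"
proof -
  have "(f has_derivative (\<lambda>_. 0)) (at w)"
    by (rule has_derivative_transform_within_open[of "\<lambda>_. c" _ _ _ U]) (use assms in auto)
  from cdbar_eqI[OF this] show ?thesis by simp
qed

lemma cdbar_bounded:
  assumes "smooth f" "\<And>w. R < cmod w \<Longrightarrow> f w = 0"
  shows "\<exists>B\<ge>0. \<forall>w. cmod (cdbar f w) \<le> B"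
proof (rule continuous_bounded_on_cball)
  show "continuous_on UNIV (cdbar f)" by (rule smooth_imp_continuous[OF smooth_cdbar[OF assms(1)]])
  show "cdbar f w = 0" if "R < cmod w" for w
    by (rule cdbar_zero_if_constant_near[of "- cball 0 R"]) (use that assms(2) in auto)
qed

text \<open>Rescalings of one cutoff, so that the derivative is bounded by a constant over \<open>|w|\<close> uniformly in \<open>n\<close>.
Infinite order of vanishing absorbs the singularity in the limit \<open>n \<longlonglongrightarrow> \<infinity>\<close>.\<close>

definition origin_cutoff :: "nat \<Rightarrow> complex \<Rightarrow> complex" where
  "origin_cutoff n w = 1 - disc_cutoff 1 2 (of_real (real (Suc n)) * w)"

lemma smooth_origin_cutoff: "smooth (origin_cutoff n)"
proof -
  have s: "smooth (disc_cutoff 1 2)" by (rule smooth_disc_cutoff) auto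
  have "smooth (\<lambda>w. disc_cutoff 1 2 (of_real (real (Suc n)) * w))"
    by (rule smooth_compose[OF s]) (intro smooth_mult smooth_const smooth_id)
  then show ?thesis unfolding origin_cutoff_def[abs_def] by (intro smooth_diff smooth_const)
qed

lemma origin_cutoff_zero: "cmod w \<le> 1 / real (Suc n) \<Longrightarrow> origin_cutoff n w = 0"
proof -
  assume "cmod w \<le> 1 / real (Suc n)"
  then have "real (Suc n) * cmod w \<le> 1" by (simp add: field_simps del: of_nat_Suc)
  then have "cmod (of_real (real (Suc n)) * w) \<le> 1" unfolding norm_mult norm_of_real by simp
  then show ?thesis unfolding origin_cutoff_def by (simp add: disc_cutoff_inner del: of_nat_Suc)
qed

lemma origin_cutoff_le: "cmod (origin_cutoff n w) \<le> 2"
  unfolding origin_cutoff_def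
  using norm_triangle_ineq4[of 1 "disc_cutoff 1 2 (of_real (real (Suc n)) * w)"]
    disc_cutoff_le[of 1 2 "of_real (real (Suc n)) * w"] by (simp del: of_nat_Suc)

lemma cdbar_origin_cutoff: "cdbar (origin_cutoff n) w = - (of_real (real (Suc n)) * cdbar (disc_cutoff 1 2) (of_real (real (Suc n)) * w))"
proof -
  have s: "smooth (disc_cutoff 1 2)" by (rule smooth_disc_cutoff) auto
  have s': "smooth (\<lambda>w. disc_cutoff 1 2 (of_real (real (Suc n)) * w))"
    by (intro smooth_compose[OF s] smooth_mult smooth_const smooth_id)
  have "(origin_cutoff n has_derivative (\<lambda>h. 0 - frechet_derivative (\<lambda>w. disc_cutoff 1 2 (of_real (real (Suc n)) * w)) (at w) h)) (at w)"
    unfolding origin_cutoff_def[abs_def] by (intro has_derivative_diff has_derivative_const smooth_has_derivative s')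
  from cdbar_eqI[OF this] have "cdbar (origin_cutoff n) w = - cdbar (\<lambda>w. disc_cutoff 1 2 (of_real (real (Suc n)) * w)) w"
    by (simp add: cdbar_def field_simps)
  then show ?thesis using cdbar_scale[OF s, of "real (Suc n)" w] by simp
qed

lemma cdbar_origin_cutoff_le: "\<exists>B\<ge>0. \<forall>n w. cmod (cdbar (origin_cutoff n) w) \<le> B / cmod w"
proof -
  have s: "smooth (disc_cutoff 1 2)" by (rule smooth_disc_cutoff) auto
  obtain B where B: "B \<ge> 0" "\<And>w. cmod (cdbar (disc_cutoff 1 2) w) \<le> B"
    using cdbar_bounded[OF s, of 2] disc_cutoff_outer[of 1 2] by auto
  have z: "cdbar (disc_cutoff 1 2) w = 0" if "2 < cmod w" for w
    by (rule cdbar_zero_if_constant_near[of "- cball 0 2"]) (use that disc_cutoff_outer[of 1 2] in auto)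
  have "cmod (cdbar (origin_cutoff n) w) \<le> 2 * B / cmod w" for n w
  proof (cases "w = 0")
    case True
    have "cdbar (disc_cutoff 1 2) 0 = 0"
      by (rule cdbar_zero_if_constant_near[of "ball 0 1"]) (use disc_cutoff_inner[of 1 2] in auto)
    then show ?thesis using True by (simp add: cdbar_origin_cutoff)
  next
    case False
    let ?x = "of_real (real (Suc n)) * w"
    have "cmod (cdbar (origin_cutoff n) w) * cmod w = cmod ?x * cmod (cdbar (disc_cutoff 1 2) ?x)"
      by (simp add: cdbar_origin_cutoff norm_mult)
    also have "\<dots> \<le> 2 * B"
      using z[of ?x] B(1) by (cases "cmod ?x \<le> 2") (auto intro!: mult_mono B(2))
    finally show ?thesis using False by (simp add: field_simps)
  qed
  then show ?thesis using B(1) by (intro exI[of _ "2 * B"]) auto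
qed

lemma origin_cutoff_eventually:
  assumes "w \<noteq> 0"
  shows "\<forall>\<^sub>F n in sequentially. origin_cutoff n w = 1 \<and> cdbar (origin_cutoff n) w = 0"
proof -
  have "\<forall>\<^sub>F n in sequentially. n \<ge> nat \<lceil>3 / cmod w\<rceil>" by (rule eventually_ge_at_top)
  then show ?thesis
  proof eventually_elim
    case (elim n)
    have "3 / cmod w \<le> real n" using elim by linarith
    then have "3 \<le> real n * cmod w" using assms by (simp add: divide_le_eq)
    moreover have "real n * cmod w \<le> real (Suc n) * cmod w" by (intro mult_right_mono) auto
    ultimately have "3 \<le> real (Suc n) * cmod w" by linarith
    then have c: "2 < cmod (of_real (real (Suc n)) * w)" unfolding norm_mult norm_of_real by linarith
    have "cdbar (disc_cutoff 1 2) (of_real (real (Suc n)) * w) = 0"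
      by (rule cdbar_zero_if_constant_near[of "- cball 0 2"]) (use c disc_cutoff_outer[of 1 2] in auto)
    moreover have "disc_cutoff 1 2 (of_real (real (Suc n)) * w) = 0" using c by (intro disc_cutoff_outer) auto
    ultimately show ?case by (simp add: origin_cutoff_def cdbar_origin_cutoff)
  qed
qed

section \<open>The Cauchy formula on almost every complex line\<close>

lemma integrable_bounded_mult:
  fixes f h :: "'a \<Rightarrow> complex"
  assumes f: "integrable M f" and h: "h \<in> borel_measurable M" and B: "\<And>x. cmod (h x) \<le> B"
  shows "integrable M (\<lambda>x. f x * h x)"
proof (rule Bochner_Integration.integrable_bound)
  show "integrable M (\<lambda>x. B *\<^sub>R f x)" using f by (rule integrable_scaleR_right)
  show "AE x in M. norm (f x * h x) \<le> norm (B *\<^sub>R f x)"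
  proof (rule AE_I2)
    fix x
    have "cmod (h x) \<le> \<bar>B\<bar>" using B[of x] by linarith
    then show "norm (f x * h x) \<le> norm (B *\<^sub>R f x)"
      by (simp add: norm_mult mult.commute[of "cmod (f x)"] mult_right_mono)
  qed
  show "(\<lambda>x. f x * h x) \<in> borel_measurable M" using borel_measurable_integrable[OF f] h by measurable
qed

lemma smooth_borel [measurable_dest]: "smooth f \<Longrightarrow> f \<in> borel_measurable borel"
  by (intro borel_measurable_continuous_onI smooth_imp_continuous)

lemma sets_balls [measurable]: "ball c e \<in> sets borel" "cball c e \<in> sets borel"
  for c :: "'a::metric_space"
  by auto

text \<open>A function \<open>v\<close> in slice coordinates with derivative \<open>g\<close> along the lines, in the weak sense for products of
a test function on the punctured disc and one on the slopes; the integrability conditions express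
vanishing to infinite order at \<open>w = 0\<close>, averaged over the slopes.\<close>

locale slice_data =
  fixes v g :: "complex \<times> complex \<Rightarrow> complex" and r S :: real
  assumes v [measurable]: "v \<in> borel_measurable borel" and g [measurable]: "g \<in> borel_measurable borel"
    and r: "0 < r" and S: "0 < S"
    and iv: "\<And>M. integrable lborel (\<lambda>p. indicator (cball 0 r \<times> cball 0 S) p *\<^sub>R (v p / fst p ^ M))"
    and ig: "\<And>M. integrable lborel (\<lambda>p. indicator (cball 0 r \<times> cball 0 S) p *\<^sub>R (g p / fst p ^ M))"
    and weak: "\<And>\<alpha> \<beta> a. smooth \<alpha> \<Longrightarrow> smooth \<beta> \<Longrightarrow> 0 < a \<Longrightarrow> (\<And>w. cmod w \<le> a \<Longrightarrow> \<alpha> w = 0) \<Longrightarrow>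
       (\<And>w. r < cmod w \<Longrightarrow> \<alpha> w = 0) \<Longrightarrow> (\<And>s. S < cmod s \<Longrightarrow> \<beta> s = 0) \<Longrightarrow>
       (LBINT p. v p * (cdbar \<alpha> (fst p) * \<beta> (snd p))) = - (LBINT p. g p * (\<alpha> (fst p) * \<beta> (snd p)))"
begin

text \<open>Division by \<open>w ^ m\<close> commutes with the derivative in the conjugate variable. Test functions have to vanish
near \<open>w = 0\<close>; this restriction is removed with \<open>origin_cutoff\<close>.\<close>

lemma weak_equation_weighted:
  assumes A: "smooth A" "\<And>w. r < cmod w \<Longrightarrow> A w = 0" and \<beta>: "smooth \<beta>" "\<And>s. S < cmod s \<Longrightarrow> \<beta> s = 0"
  shows "(LBINT p. (v p * cdbar A (fst p) + g p * A (fst p)) / fst p ^ m * \<beta> (snd p)) = 0"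
proof -
  let ?D = "cball (0::complex) r \<times> cball (0::complex) S"
  have [measurable]: "A \<in> borel_measurable borel" "cdbar A \<in> borel_measurable borel" "\<beta> \<in> borel_measurable borel"
    "origin_cutoff n \<in> borel_measurable borel" "cdbar (origin_cutoff n) \<in> borel_measurable borel" for n
    using smooth_borel A(1) \<beta>(1) smooth_cdbar smooth_origin_cutoff by blast+
  obtain B1 where B1: "B1 \<ge> 0" "\<And>w. cmod (A w) \<le> B1"
    using continuous_bounded_on_cball[OF smooth_imp_continuous[OF A(1)]] A(2) by blast
  obtain B2 where B2: "B2 \<ge> 0" "\<And>w. cmod (cdbar A w) \<le> B2" using cdbar_bounded[OF A] by blast
  obtain B3 where B3: "B3 \<ge> 0" "\<And>s. cmod (\<beta> s) \<le> B3"
    using continuous_bounded_on_cball[OF smooth_imp_continuous[OF \<beta>(1)]] \<beta>(2) by blast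
  obtain C where C: "C \<ge> 0" "\<And>n w. cmod (cdbar (origin_cutoff n) w) \<le> C / cmod w" using cdbar_origin_cutoff_le by blast
  have zA: "cdbar A w = 0" if "r < cmod w" for w
    by (rule cdbar_zero_if_constant_near[of "- cball 0 r"]) (use that A(2) in auto)
  have out: "(A (fst p) = 0 \<and> cdbar A (fst p) = 0) \<or> \<beta> (snd p) = 0" if "p \<notin> ?D" for p
    using that A(2)[of "fst p"] zA[of "fst p"] \<beta>(2)[of "snd p"] by (auto simp: mem_Times_iff not_le)
  define V G where "V M p = indicator ?D p *\<^sub>R (v p / fst p ^ M)" and "G p = indicator ?D p *\<^sub>R (g p / fst p ^ m)" for M p
  define Y1 where "Y1 n p = v p * (cdbar A (fst p) * origin_cutoff n (fst p) + A (fst p) * cdbar (origin_cutoff n) (fst p)) / fst p ^ m * \<beta> (snd p)" for n p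
  define Y2 where "Y2 n p = g p * A (fst p) * origin_cutoff n (fst p) / fst p ^ m * \<beta> (snd p)" for n p
  define W1 where "W1 p = B3 * (2 * B2 * cmod (V m p) + B1 * C * cmod (V (Suc m) p))" for p
  define W2 where "W2 p = 2 * B1 * B3 * cmod (G p)" for p
  have VG: "integrable lborel (V M)" "integrable lborel G" for M
    using iv ig by (simp_all add: V_def[abs_def] G_def[abs_def])
  have W: "integrable lborel W1" "integrable lborel W2"
    unfolding W1_def[abs_def] W2_def[abs_def] by (intro integrable_mult_right impI Bochner_Integration.integrable_add integrable_norm VG)+
  have [measurable]: "Y1 n \<in> borel_measurable lborel" "Y2 n \<in> borel_measurable lborel" for n
    unfolding Y1_def[abs_def] Y2_def[abs_def] by measurable
  have b1: "norm (Y1 n p) \<le> W1 p" for n p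
  proof (cases "p \<in> ?D")
    case False
    then have "Y1 n p = 0" using out[of p] by (auto simp: Y1_def) 
    then show ?thesis using B1(1) B2(1) B3(1) C(1) by (simp add: W1_def)
  next
    case True
    have "cmod (cdbar A (fst p) * origin_cutoff n (fst p) + A (fst p) * cdbar (origin_cutoff n) (fst p)) \<le> B2 * 2 + B1 * (C / cmod (fst p))"
      unfolding norm_mult using B1 B2 C
      by (intro order_trans[OF norm_triangle_ineq] add_mono; unfold norm_mult; intro mult_mono origin_cutoff_le) auto
    then have "cmod (v p / fst p ^ m) * cmod (cdbar A (fst p) * origin_cutoff n (fst p) + A (fst p) * cdbar (origin_cutoff n) (fst p)) * cmod (\<beta> (snd p))
       \<le> cmod (v p / fst p ^ m) * (B2 * 2 + B1 * (C / cmod (fst p))) * B3"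
      using B1(1) B2(1) B3 C(1) by (intro mult_mono) auto
    moreover have "norm (Y1 n p) = cmod (v p / fst p ^ m) * cmod (cdbar A (fst p) * origin_cutoff n (fst p) + A (fst p) * cdbar (origin_cutoff n) (fst p)) * cmod (\<beta> (snd p))"
      unfolding Y1_def by (simp only: norm_mult[symmetric]) simp
    moreover have "W1 p = cmod (v p / fst p ^ m) * (B2 * 2 + B1 * (C / cmod (fst p))) * B3"
      using True by (simp add: W1_def V_def norm_divide norm_power norm_mult algebra_simps)
    ultimately show ?thesis by simp
  qed
  have b2: "norm (Y2 n p) \<le> W2 p" for n p
  proof (cases "p \<in> ?D")
    case False
    then have "Y2 n p = 0" using out[of p] by (auto simp: Y2_def) 
    then show ?thesis using B1(1) B3(1) by (simp add: W2_def)
  next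
    case True
    have "cmod (g p / fst p ^ m) * (cmod (A (fst p)) * cmod (origin_cutoff n (fst p))) * cmod (\<beta> (snd p))
       \<le> cmod (g p / fst p ^ m) * (B1 * 2) * B3"
      using B1 B3 origin_cutoff_le[of n "fst p"] by (intro mult_mono mult_left_mono mult_nonneg_nonneg) auto
    then show ?thesis using True by (simp add: Y2_def W2_def G_def norm_mult norm_divide norm_power field_simps)
  qed
  have iY: "integrable lborel (Y1 n)" "integrable lborel (Y2 n)" for n
  proof -
    show "integrable lborel (Y1 n)"
      by (rule Bochner_Integration.integrable_bound[OF W(1)]) (auto intro: order_trans[OF b1 abs_ge_self])
    show "integrable lborel (Y2 n)"
      by (rule Bochner_Integration.integrable_bound[OF W(2)]) (auto intro: order_trans[OF b2 abs_ge_self])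
  qed
  have Y0: "(LBINT p. Y1 n p + Y2 n p) = 0" for n
  proof -
    define \<alpha> where "\<alpha> w = A w * origin_cutoff n w / w ^ m" for w
    have sA: "smooth (\<lambda>w. A w * origin_cutoff n w)" by (intro smooth_mult A smooth_origin_cutoff)
    have s\<alpha>: "smooth \<alpha>" unfolding \<alpha>_def[abs_def]
      by (rule smooth_divide_power[OF sA, of "1 / real (Suc n)"]) (auto simp: origin_cutoff_zero simp del: of_nat_Suc)
    then have [measurable]: "\<alpha> \<in> borel_measurable borel" "cdbar \<alpha> \<in> borel_measurable borel" using smooth_borel smooth_cdbar by blast+
    have "(LBINT p. v p * (cdbar \<alpha> (fst p) * \<beta> (snd p))) = - (LBINT p. g p * (\<alpha> (fst p) * \<beta> (snd p)))"
      by (rule weak[OF s\<alpha> \<beta>(1), of "1 / real (Suc n)"])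
        (auto simp: \<alpha>_def origin_cutoff_zero A(2) \<beta>(2) simp del: of_nat_Suc)
    moreover have "(LBINT p. v p * (cdbar \<alpha> (fst p) * \<beta> (snd p))) = (LBINT p. Y1 n p)"
    proof (rule integral_cong_AE)
      show "AE p in lborel. v p * (cdbar \<alpha> (fst p) * \<beta> (snd p)) = Y1 n p"
        using AE_fst_nonzero
      proof eventually_elim
        case (elim p)
        have "cdbar \<alpha> (fst p) = (cdbar A (fst p) * origin_cutoff n (fst p) + A (fst p) * cdbar (origin_cutoff n) (fst p)) / fst p ^ m"
          unfolding \<alpha>_def[abs_def] using elim A(1) smooth_origin_cutoff sA
          by (subst cdbar_divide_power) (auto simp: smooth_differentiable cdbar_mult)
        then show ?case by (simp add: Y1_def)
      qed
    qed measurable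
    moreover have "(LBINT p. g p * (\<alpha> (fst p) * \<beta> (snd p))) = (LBINT p. Y2 n p)"
      by (rule Bochner_Integration.integral_cong) (auto simp: \<alpha>_def Y2_def)
    ultimately show ?thesis using iY by simp
  qed
  have "(\<lambda>n. LBINT p. Y1 n p + Y2 n p) \<longlonglongrightarrow> (LBINT p. (v p * cdbar A (fst p) + g p * A (fst p)) / fst p ^ m * \<beta> (snd p))"
  proof (rule integral_dominated_convergence[where w = "\<lambda>p. W1 p + W2 p"])
    show "integrable lborel (\<lambda>p. W1 p + W2 p)" using W by simp
    show "AE p in lborel. norm (Y1 n p + Y2 n p) \<le> W1 p + W2 p" for n
      by (intro AE_I2 order_trans[OF norm_triangle_ineq] add_mono b1 b2)
    show "AE p in lborel. (\<lambda>n. Y1 n p + Y2 n p) \<longlonglongrightarrow> (v p * cdbar A (fst p) + g p * A (fst p)) / fst p ^ m * \<beta> (snd p)"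
      using AE_fst_nonzero
    proof eventually_elim
      case (elim p)
      have "\<forall>\<^sub>F n in sequentially. Y1 n p + Y2 n p = (v p * cdbar A (fst p) + g p * A (fst p)) / fst p ^ m * \<beta> (snd p)"
        using origin_cutoff_eventually[OF elim]
        by eventually_elim (simp add: Y1_def Y2_def add_divide_distrib distrib_right)
      then show ?case by (rule tendsto_eventually)
    qed
  qed measurable
  then show ?thesis by (simp add: Y0 LIMSEQ_const_iff)
qed

text \<open>For each regularized kernel with pole \<open>q\<close>, the weighted weak equation holds against all functions of the
slope, hence on almost every single line. By Fubini's theorem almost every line is good for almost all
poles at once, and on such a line \<open>cauchy_transform_representation\<close> applies.\<close>

lemma slice_cauchy_bound:
  assumes \<theta>: "smooth \<theta>" "\<And>w. r < cmod w \<Longrightarrow> \<theta> w = 0"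
  shows "AE s in lborel. cmod s < S \<longrightarrow> (AE q in lborel. ennreal (cauchy_const * cmod (\<theta> q * v (q, s) / q ^ m))
     \<le> (NLINT w. ennreal (cmod ((\<theta> w * g (w, s) + cdbar \<theta> w * v (w, s)) / w ^ m) / cmod (w - q))))"
proof -
  let ?D = "cball (0::complex) r \<times> cball (0::complex) S"
  have [measurable]: "\<theta> \<in> borel_measurable borel" "cdbar \<theta> \<in> borel_measurable borel"
    using smooth_borel \<theta>(1) smooth_cdbar by blast+
  obtain B1 where B1: "B1 \<ge> 0" "\<And>w. cmod (\<theta> w) \<le> B1"
    using continuous_bounded_on_cball[OF smooth_imp_continuous[OF \<theta>(1)]] \<theta>(2) by blast
  obtain B2 where B2: "B2 \<ge> 0" "\<And>w. cmod (cdbar \<theta> w) \<le> B2" using cdbar_bounded[OF \<theta>] by blast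
  have zc: "cdbar \<theta> w = 0" if "r < cmod w" for w
    by (rule cdbar_zero_if_constant_near[of "- cball 0 r"]) (use that \<theta>(2) in auto)
  define f where "f p = indicator (cball 0 S) (snd p) *\<^sub>R (\<theta> (fst p) * v p / fst p ^ m)" for p
  define H where "H p = indicator (cball 0 S) (snd p) *\<^sub>R ((\<theta> (fst p) * g p + cdbar \<theta> (fst p) * v p) / fst p ^ m)" for p
  define e where "e n = (1 / real (Suc n))\<^sup>2" for n
  have e: "0 < e n" for n by (simp add: e_def)
  have fH: "f \<in> borel_measurable lborel" "H \<in> borel_measurable lborel"
    unfolding f_def[abs_def] H_def[abs_def] by measurable
  then have [measurable]: "f \<in> borel_measurable borel" "H \<in> borel_measurable borel" by simp_all
  have feq: "f = (\<lambda>p. indicator ?D p *\<^sub>R (v p / fst p ^ m) * \<theta> (fst p))"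
    using \<theta>(2) by (auto simp: f_def fun_eq_iff indicator_def mem_Times_iff not_le)
  have Heq: "H = (\<lambda>p. indicator ?D p *\<^sub>R (g p / fst p ^ m) * \<theta> (fst p) + indicator ?D p *\<^sub>R (v p / fst p ^ m) * cdbar \<theta> (fst p))"
    using \<theta>(2) zc by (auto simp: H_def fun_eq_iff indicator_def mem_Times_iff not_le add_divide_distrib mult.commute)
  have if': "integrable lborel f" unfolding feq
    by (rule integrable_bounded_mult[OF iv _ B1(2)]) measurable
  have iH: "integrable lborel H" unfolding Heq
    by (intro Bochner_Integration.integrable_add integrable_bounded_mult[OF ig _ B1(2)] integrable_bounded_mult[OF iv _ B2(2)]) measurable
  define Y where "Y n q p = f p * of_real (approx_id (e n) (fst p - q)) + H p * cauchy_reg (e n) (fst p - q)" for n q p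
  have "Y n q \<in> borel_measurable lborel" for n q unfolding Y_def[abs_def] by measurable
  then have [measurable]: "Y n q \<in> borel_measurable borel" for n q by simp
  have iY: "integrable lborel (Y n q)" for n q
  proof -
    have "cmod (of_real (approx_id (e n) x)) \<le> 1 / e n" for x
      using approx_id_le[OF e] approx_id_nonneg[OF e] by simp
    then show ?thesis unfolding Y_def[abs_def]
      by (intro Bochner_Integration.integrable_add integrable_bounded_mult[OF if', where B = "1 / e n"]
            integrable_bounded_mult[OF iH, where B = "1 + 1 / e n"] norm_cauchy_reg_bounded e) auto
  qed
  have slice0: "AE s in lborel. cmod s < S \<longrightarrow> (LBINT w. Y n q (w, s)) = 0" for n q
  proof (rule AE_zero_if_smooth_integrals_zero[OF _ S])
    have iY': "integrable (lborel \<Otimes>\<^sub>M lborel) (\<lambda>(w, s). Y n q (w, s))" using iY[of n q] by (simp add: lborel_prod)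
    show "integrable lborel (\<lambda>s. LBINT w. Y n q (w, s))" using lborel_pair.integrable_snd[OF iY'] .
    fix \<beta> :: "complex \<Rightarrow> complex" assume \<beta>: "smooth \<beta>" "\<And>s. S < cmod s \<Longrightarrow> \<beta> s = 0"
    obtain B3 where B3: "\<And>s. cmod (\<beta> s) \<le> B3"
      using continuous_bounded_on_cball[OF smooth_imp_continuous[OF \<beta>(1)]] \<beta>(2) by blast
    have [measurable]: "\<beta> \<in> borel_measurable borel" using smooth_borel \<beta>(1) by blast
    have "integrable lborel (\<lambda>p. Y n q p * \<beta> (snd p))" 
      by (rule integrable_bounded_mult[OF iY _ B3]) measurable
    then have iYb: "integrable (lborel \<Otimes>\<^sub>M lborel) (\<lambda>(w, s). Y n q (w, s) * \<beta> s)" by (simp add: lborel_prod case_prod_unfold)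
    have "(LBINT s. (LBINT w. Y n q (w, s)) * \<beta> s) = (LBINT s. (LBINT w. Y n q (w, s) * \<beta> s))"
      by simp
    also have "\<dots> = (LBINT p. Y n q p * \<beta> (snd p))"
      using lborel_pair.integral_snd[OF iYb] by (simp add: lborel_prod case_prod_unfold)
    also have "\<dots> = (LBINT p. (v p * cdbar (\<lambda>w. \<theta> w * cauchy_reg (e n) (w - q)) (fst p) + g p * (\<theta> (fst p) * cauchy_reg (e n) (fst p - q))) / fst p ^ m * \<beta> (snd p))"
    proof (rule Bochner_Integration.integral_cong[OF refl])
      fix p :: "complex \<times> complex"
      have "cdbar (\<lambda>w. \<theta> w * cauchy_reg (e n) (w - q)) (fst p) = cdbar \<theta> (fst p) * cauchy_reg (e n) (fst p - q) + \<theta> (fst p) * of_real (approx_id (e n) (fst p - q))"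
        by (simp add: cdbar_mult smooth_differentiable \<theta>(1) smooth_cauchy_reg[OF e] cdbar_cauchy_reg[OF e])
      then show "Y n q p * \<beta> (snd p) = (v p * cdbar (\<lambda>w. \<theta> w * cauchy_reg (e n) (w - q)) (fst p) + g p * (\<theta> (fst p) * cauchy_reg (e n) (fst p - q))) / fst p ^ m * \<beta> (snd p)"
        using \<beta>(2)[of "snd p"] by (cases "cmod (snd p) \<le> S") (auto simp: Y_def f_def H_def add_divide_distrib algebra_simps)
    qed
    also have "\<dots> = 0"
      by (rule weak_equation_weighted[OF _ _ \<beta>]) (use \<theta> smooth_cauchy_reg[OF e] in auto)
    finally show "(LBINT s. (LBINT w. Y n q (w, s)) * \<beta> s) = 0" .
  qed
  (* the kernel parameter q must range over almost all points for a fixed slope s, not conversely *)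
  have comm: "AE s in lborel. AE q in lborel. cmod s < S \<longrightarrow> (LBINT w. Y n q (w, s)) = 0" for n
  proof -
    have "(\<lambda>x. LBINT w. Y n (fst x) (w, snd x)) \<in> borel_measurable (lborel \<Otimes>\<^sub>M lborel)"
    proof -
      have c: "(\<lambda>y::(complex \<times> complex) \<times> complex. (snd y, snd (fst y))) \<in> borel \<rightarrow>\<^sub>M borel"
        "(\<lambda>y::(complex \<times> complex) \<times> complex. snd y - fst (fst y)) \<in> borel \<rightarrow>\<^sub>M borel"
        by (intro borel_measurable_continuous_onI continuous_intros)+
      have [measurable]: "(\<lambda>y::(complex \<times> complex) \<times> complex. f (snd y, snd (fst y))) \<in> borel \<rightarrow>\<^sub>M borel"
        "(\<lambda>y::(complex \<times> complex) \<times> complex. H (snd y, snd (fst y))) \<in> borel \<rightarrow>\<^sub>M borel"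
        "(\<lambda>y::(complex \<times> complex) \<times> complex. approx_id (e n) (snd y - fst (fst y))) \<in> borel \<rightarrow>\<^sub>M borel"
        "(\<lambda>y::(complex \<times> complex) \<times> complex. cauchy_reg (e n) (snd y - fst (fst y))) \<in> borel \<rightarrow>\<^sub>M borel"
        by (rule measurable_compose[OF c(1)], simp)+ (rule measurable_compose[OF c(2)], simp)+
      have "(\<lambda>y::(complex \<times> complex) \<times> complex. Y n (fst (fst y)) (snd y, snd (fst y))) \<in> borel_measurable lborel"
        unfolding Y_def by simp
      then have "(\<lambda>(x, w). Y n (fst x) (w, snd x)) \<in> borel_measurable ((lborel \<Otimes>\<^sub>M lborel) \<Otimes>\<^sub>M lborel)"
        by (simp add: lborel_prod case_prod_unfold)
      then show ?thesis by (rule lborel.borel_measurable_lebesgue_integral)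
    qed
    then have "{x \<in> space (lborel \<Otimes>\<^sub>M lborel). cmod (snd x) < S \<longrightarrow> (LBINT w. Y n (fst x) (w, snd x)) = 0} \<in> sets (lborel \<Otimes>\<^sub>M lborel)"
      by measurable
    from lborel_pair.AE_commute[OF this] show ?thesis using slice0[of n] by simp
  qed
  have iff: "AE s in lborel. integrable lborel (\<lambda>w. f (w, s))" "AE s in lborel. integrable lborel (\<lambda>w. H (w, s))"
    using lborel_pair.AE_integrable_snd[of "\<lambda>w s. f (w, s)"] lborel_pair.AE_integrable_snd[of "\<lambda>w s. H (w, s)"] if' iH
    by (simp_all add: lborel_prod)
  have "AE s in lborel. \<forall>n. AE q in lborel. cmod s < S \<longrightarrow> (LBINT w. Y n q (w, s)) = 0"
    unfolding AE_all_countable using comm by blast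
  with iff show ?thesis
  proof eventually_elim
    case (elim s)
    show ?case
    proof
      assume s: "cmod s < S"
      have "AE q in lborel. ennreal (cauchy_const * cmod (f (q, s))) \<le> (NLINT w. ennreal (cmod (H (w, s)) / cmod (w - q)))"
        by (rule cauchy_transform_representation[OF elim(1,2)]) (use elim(3) s in \<open>simp add: Y_def e_def\<close>)
      then show "AE q in lborel. ennreal (cauchy_const * cmod (\<theta> q * v (q, s) / q ^ m))
         \<le> (NLINT w. ennreal (cmod ((\<theta> w * g (w, s) + cdbar \<theta> w * v (w, s)) / w ^ m) / cmod (w - q)))"
        using s by (simp add: f_def H_def)
    qed
  qed
qed

end

section \<open>Vanishing for the planar inequality\<close>

text \<open>Young's inequality with exponents \<open>4\<close> and \<open>4/3\<close>, up to constants, by comparing \<open>b\<close> with \<open>(t a)\<^sup>3\<close>.\<close>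

lemma young_split:
  fixes a b t :: real
  assumes "0 \<le> a" "0 \<le> b" "0 < t"
  shows "a * b \<le> t ^ 3 * a ^ 4 + b powr (4/3) / t"
proof (cases "b \<le> t ^ 3 * a ^ 3")
  case True
  then have "a * b \<le> a * (t ^ 3 * a ^ 3)" using assms by (intro mult_left_mono) auto
  also have "\<dots> = t ^ 3 * a ^ 4" by (simp add: power_numeral_reduce mult_ac)
  finally show ?thesis using assms by (simp add: add_increasing2)
next
  case False
  then have b: "0 < b" using assms by (smt (verit) mult_nonneg_nonneg zero_le_power)
  have "(t * a) ^ 3 \<le> (b powr (1/3)) ^ 3"
    using False b by (simp add: power_mult_distrib powr_power)
  then have "t * a \<le> b powr (1/3)" by (rule power_le_imp_le_base[of _ 2, simplified]) simp
  then have "a \<le> b powr (1/3) / t" using assms by (simp add: field_simps)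
  then have "a * b \<le> b powr (1/3) / t * b" using assms by (intro mult_right_mono) auto
  also have "\<dots> = b powr (4/3) / t" using b powr_add[of b "1/3" 1] by simp
  finally show ?thesis using assms by (simp add: add_increasing)
qed

text \<open>Split the plane into the discs of radius \<open>|w| / 2\<close> about the two poles, where the other factor is bounded,
and the rest, where the product is at most the sum of the squares and these decay like the power
\<open>-8/3\<close> of the distance.\<close>

lemma nn_integral_two_poles:
  "\<exists>C\<ge>0. \<forall>w\<noteq>0. (NLINT q. ennreal (cmod q powr (-4/3) * cmod (q - w) powr (-4/3))) \<le> ennreal (C * cmod w powr (-2/3))"
proof -
  obtain C1 where C1: "C1 \<ge> 0" "\<And>\<rho>. \<rho> > 0 \<Longrightarrow> (NLINT x. ennreal (indicator (ball (0::complex) \<rho>) x * cmod x powr (-(4/3))))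
             \<le> ennreal (C1 * \<rho> powr (2 - 4/3))" using nn_integral_power_disc[of "4/3"] by auto
  obtain C2 where C2: "C2 \<ge> 0" "\<And>\<rho>. \<rho> > 0 \<Longrightarrow> (NLINT x. ennreal (indicator (- ball (0::complex) \<rho>) x * cmod x powr (-(8/3))))
             \<le> ennreal (C2 * \<rho> powr (2 - 8/3))" using nn_integral_power_exterior[of "8/3"] by auto
  have [measurable]: "- ball (0::complex) d \<in> sets borel" for d by (intro borel_closed closed_Compl) simp
  have "(NLINT q. ennreal (cmod q powr (-4/3) * cmod (q - w) powr (-4/3))) \<le> ennreal (2 * (C1 + C2) * 2 powr (2/3) * cmod w powr (-2/3))"
    if "w \<noteq> 0" for w
  proof -
    define d where "d = cmod w / 2"
    have d: "d > 0" using that by (simp add: d_def)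
    define k1 where "k1 x = ennreal (indicator (ball (0::complex) d) x * cmod x powr (-(4/3)))" for x
    define k2 where "k2 x = ennreal (indicator (- ball (0::complex) d) x * cmod x powr (-(8/3)))" for x
    have [measurable]: "k1 \<in> borel_measurable borel" "k2 \<in> borel_measurable borel"
      unfolding k1_def[abs_def] k2_def[abs_def] by measurable
    have "(NLINT q. ennreal (cmod q powr (-4/3) * cmod (q - w) powr (-4/3)))
      \<le> (NLINT q. (ennreal (d powr (-4/3)) * k1 q + ennreal (d powr (-4/3)) * k1 (q - w)) + (k2 q + k2 (q - w)))"
    proof (rule nn_integral_mono)
      fix q
      have tri: "2 * d \<le> cmod q + cmod (q - w)" using norm_triangle_ineq4[of q "q - w"] by (simp add: d_def)
      have tri': "2 * d \<le> cmod (q - w) + cmod q" using tri by simp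
      define x where "x = cmod q powr (-4/3)"
      define y where "y = cmod (q - w) powr (-4/3)"
      have xy: "0 \<le> x" "0 \<le> y" by (simp_all add: x_def y_def)
      consider "cmod q < d" | "cmod (q - w) < d" | "d \<le> cmod q" "d \<le> cmod (q - w)" by linarith
      then show "ennreal (cmod q powr (-4/3) * cmod (q - w) powr (-4/3)) \<le>
         (ennreal (d powr (-4/3)) * k1 q + ennreal (d powr (-4/3)) * k1 (q - w)) + (k2 q + k2 (q - w))"
      proof cases
        case 1
        have "d \<le> cmod (q - w)" using 1 tri by linarith
        then have "y \<le> d powr (-4/3)" unfolding y_def using d by (intro powr_mono2') auto
        then have "x * y \<le> d powr (-4/3) * x" using xy by (simp add: mult.commute mult_left_mono)
        then have "ennreal (x * y) \<le> ennreal (d powr (-4/3)) * k1 q"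
          using 1 xy by (simp add: k1_def x_def ennreal_leI flip: ennreal_mult)
        then show ?thesis unfolding x_def y_def by (intro add_increasing2 add_nonneg_nonneg) auto
      next
        case 2
        have "d \<le> cmod q" using 2 tri by linarith
        then have "x \<le> d powr (-4/3)" unfolding x_def using d by (intro powr_mono2') auto
        then have "x * y \<le> d powr (-4/3) * y" using xy by (simp add: mult_right_mono)
        then have "ennreal (x * y) \<le> ennreal (d powr (-4/3)) * k1 (q - w)"
          using 2 xy by (simp add: k1_def y_def ennreal_leI flip: ennreal_mult)
        then show ?thesis unfolding x_def y_def by (intro add_increasing2[of "k2 q + k2 (q - w)"] add_increasing) auto
      next
        case 3
        have "x * y \<le> x * x + y * y" using xy by (smt (verit) mult_mono mult_nonneg_nonneg)
        moreover have "x * x = cmod q powr (-(8/3))" "y * y = cmod (q - w) powr (-(8/3))"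
          by (simp_all add: x_def y_def flip: powr_add)
        ultimately have "ennreal (x * y) \<le> k2 q + k2 (q - w)"
          using 3 by (simp add: k2_def ennreal_leI flip: ennreal_plus)
        then show ?thesis unfolding x_def y_def
          by (rule order_trans) (rule add_increasing[OF zero_le order_refl])
      qed
    qed
    also have "\<dots> = (ennreal (d powr (-4/3)) * (NLINT x. k1 x) + ennreal (d powr (-4/3)) * (NLINT x. k1 x)) + ((NLINT x. k2 x) + (NLINT x. k2 x))"
      by (simp add: nn_integral_add nn_integral_cmult nn_integral_translate)
    also have "\<dots> \<le> (ennreal (d powr (-4/3)) * ennreal (C1 * d powr (2 - 4/3)) + ennreal (d powr (-4/3)) * ennreal (C1 * d powr (2 - 4/3)))
        + (ennreal (C2 * d powr (2 - 8/3)) + ennreal (C2 * d powr (2 - 8/3)))"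
      unfolding k1_def k2_def by (intro add_mono mult_left_mono C1(2) C2(2) d) auto
    also have "\<dots> = ennreal (2 * (d powr (-4/3) * (C1 * d powr (2 - 4/3))) + 2 * (C2 * d powr (2 - 8/3)))"
      using C1(1) C2(1) by (simp flip: ennreal_mult ennreal_plus)
    also have "2 * (d powr (-4/3) * (C1 * d powr (2 - 4/3))) + 2 * (C2 * d powr (2 - 8/3)) = 2 * (C1 + C2) * d powr (-2/3)"
      using powr_add[of d "-4/3" "2-4/3"] by (simp add: algebra_simps)
    also have "d powr (-2/3) = 2 powr (2/3) * cmod w powr (-2/3)"
      by (simp add: d_def powr_divide powr_minus_divide)
    finally show ?thesis by (simp add: mult_ac)
  qed
  then show ?thesis using C1(1) C2(1) by (intro exI[of _ "2 * (C1 + C2) * 2 powr (2/3)"]) auto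
qed

text \<open>The scale-invariant form of the smallness of a potential: the integrand is the product of
\<open>|q| powr (1/2) * W q\<close>, which is small in \<open>L\<^sup>4\<close>, and \<open>1 / (|q| * |q - w|)\<close>, whose power \<open>4/3\<close> has integral of
order \<open>|w| powr (-2/3)\<close>. Young's inequality with the parameter \<open>t = K * |w| powr (-1/6)\<close> gives both terms the
homogeneity \<open>|w| powr (-1/2)\<close>, the second with the factor \<open>1 / K\<close>.\<close>

lemma nn_integral_potential_kernel_le:
  assumes "0 < \<eta>"
  shows "\<exists>\<delta>>0. \<forall>W A. W \<in> borel_measurable borel \<longrightarrow> (\<forall>q. 0 \<le> W q) \<longrightarrow> A \<in> sets borel \<longrightarrow>
     (NLINT q. indicator A q * ennreal ((cmod q)\<^sup>2 * W q ^ 4)) \<le> ennreal \<delta> \<longrightarrow>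
     (\<forall>w\<noteq>0. (NLINT q. indicator A q * ennreal (cmod q powr (-1/2) * W q / cmod (q - w))) \<le> ennreal (\<eta> * cmod w powr (-1/2)))"
proof -
  obtain C where C: "C \<ge> 0" "\<And>w. w \<noteq> 0 \<Longrightarrow> (NLINT q. ennreal (cmod q powr (-4/3) * cmod (q - w) powr (-4/3))) \<le> ennreal (C * cmod w powr (-2/3))"
    using nn_integral_two_poles by blast
  (* K makes the second term of Young's inequality at most half of the bound, and then
     delta makes the first one at most the other half *)
  define K where "K = 2 * (C + 1) / \<eta>"
  have K: "K > 0" "C / K \<le> \<eta> / 2" using assms C(1) by (auto simp: K_def field_simps)
  define \<delta> where "\<delta> = \<eta> / (2 * K ^ 3)"
  have \<delta>: "\<delta> > 0" "K ^ 3 * \<delta> = \<eta> / 2" using K assms by (auto simp: \<delta>_def)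
  show ?thesis
  proof (intro exI[of _ \<delta>] conjI allI impI \<delta>(1))
    fix W :: "complex \<Rightarrow> real" and A :: "complex set" and w :: complex
    assume [measurable]: "W \<in> borel_measurable borel" "A \<in> sets borel" and Wn: "\<forall>q. 0 \<le> W q" and w: "w \<noteq> 0"
      and small: "(NLINT q. indicator A q * ennreal ((cmod q)\<^sup>2 * W q ^ 4)) \<le> ennreal \<delta>"
    define t where "t = K * cmod w powr (-1/6)"
    have t: "t > 0" using K w by (simp add: t_def)
    have t3: "t ^ 3 = K ^ 3 * cmod w powr (-1/2)" using w by (simp add: t_def power_mult_distrib powr_power)
    have ti: "C * cmod w powr (-2/3) / t = C / K * cmod w powr (-1/2)"
      using powr_diff[of "cmod w" "-2/3" "-1/6"] by (simp add: t_def)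
    have "(NLINT q. indicator A q * ennreal (cmod q powr (-1/2) * W q / cmod (q - w)))
      \<le> (NLINT q. ennreal (t ^ 3) * (indicator A q * ennreal ((cmod q)\<^sup>2 * W q ^ 4)) + ennreal (1 / t) * ennreal (cmod q powr (-4/3) * cmod (q - w) powr (-4/3)))"
    proof (rule nn_integral_mono)
      fix q
      show "indicator A q * ennreal (cmod q powr (-1/2) * W q / cmod (q - w)) \<le>
         ennreal (t ^ 3) * (indicator A q * ennreal ((cmod q)\<^sup>2 * W q ^ 4)) + ennreal (1 / t) * ennreal (cmod q powr (-4/3) * cmod (q - w) powr (-4/3))"
      proof (cases "q \<in> A")
        case True
        define a where "a = cmod q powr (1/2) * W q"
        define b where "b = cmod q powr (-1) * cmod (q - w) powr (-1)"
        have ab: "cmod q powr (-1/2) * W q / cmod (q - w) = a * b"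
          using powr_add[of "cmod q" "1/2" "-1"] by (simp add: a_def b_def powr_minus_divide)
        have a4: "a ^ 4 = (cmod q)\<^sup>2 * W q ^ 4"
          by (cases "q = 0") (simp_all add: a_def power_mult_distrib powr_power)
        have b43: "b powr (4/3) = cmod q powr (-4/3) * cmod (q - w) powr (-4/3)"
        proof -
          have "(x powr (-1)) powr (4/3) = x powr (-4/3)" for x :: real using powr_powr[of x "-1" "4/3"] by simp
          then show ?thesis unfolding b_def by (subst powr_mult) (simp_all only: powr_ge_zero)
        qed
        have "a * b \<le> t ^ 3 * a ^ 4 + b powr (4/3) / t"
          using Wn t by (intro young_split) (auto simp: a_def b_def)
        then have "ennreal (a * b) \<le> ennreal (t ^ 3) * ennreal (a ^ 4) + ennreal (1 / t) * ennreal (b powr (4/3))"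
          using t Wn by (simp add: a_def ennreal_leI flip: ennreal_mult ennreal_plus)
        then show ?thesis using True unfolding ab a4 b43 by simp
      qed simp
    qed
    also have "\<dots> = ennreal (t ^ 3) * (NLINT q. indicator A q * ennreal ((cmod q)\<^sup>2 * W q ^ 4)) + ennreal (1 / t) * (NLINT q. ennreal (cmod q powr (-4/3) * cmod (q - w) powr (-4/3)))"
      by (subst nn_integral_add) (simp_all add: nn_integral_cmult)
    also have "\<dots> \<le> ennreal (t ^ 3) * ennreal \<delta> + ennreal (1 / t) * ennreal (C * cmod w powr (-2/3))"
      by (intro add_mono mult_left_mono small C(2) w) auto
    also have "\<dots> = ennreal (t ^ 3 * \<delta> + C * cmod w powr (-2/3) / t)"
      using t \<delta>(1) C(1) by (simp flip: ennreal_mult ennreal_plus)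
    also have "t ^ 3 * \<delta> + C * cmod w powr (-2/3) / t \<le> \<eta> * cmod w powr (-1/2)"
    proof -
      have "t ^ 3 * \<delta> + C * cmod w powr (-2/3) / t = (K ^ 3 * \<delta> + C / K) * cmod w powr (-1/2)"
        unfolding t3 ti by (simp add: algebra_simps)
      also have "\<dots> \<le> \<eta> * cmod w powr (-1/2)" by (intro mult_right_mono powr_ge_zero) (use \<delta>(2) K(2) in linarith)
      finally show ?thesis .
    qed
    finally show "(NLINT q. indicator A q * ennreal (cmod q powr (-1/2) * W q / cmod (q - w))) \<le> ennreal (\<eta> * cmod w powr (-1/2))"
      by (simp add: ennreal_leI)
  qed
qed

text \<open>One complex line: a vector-valued \<open>v\<close>, its derivative \<open>g\<close>, a potential \<open>W \<ge> 1\<close> and the bounds that hold for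
almost every slope. The disc cutoffs have rational radii so that countably many of them suffice.\<close>

locale planar_slice =
  fixes v g :: "'N::finite \<Rightarrow> complex \<Rightarrow> complex" and W :: "complex \<Rightarrow> real" and r :: real
  assumes vm [measurable]: "\<And>k. v k \<in> borel_measurable borel" and gm [measurable]: "\<And>k. g k \<in> borel_measurable borel"
    and Wm [measurable]: "W \<in> borel_measurable borel"
    and W1: "\<And>w. 1 \<le> W w"
    and dominated: "AE w in lborel. cmod w < r \<longrightarrow> (\<forall>k. cmod (g k w) \<le> W w * (\<Sum>j\<in>UNIV. cmod (v j w)))"
    and W4: "(NLINT w. indicator (ball 0 r) w * ennreal ((cmod w)\<^sup>2 * W w ^ 4)) < \<infinity>"
    and iW: "\<And>M k. (NLINT w. indicator (ball 0 r) w * ennreal (W w * cmod (v k w) / cmod w ^ M)) < \<infinity>"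
    and rep: "\<And>m k r1 r2. r1 \<in> \<rat> \<Longrightarrow> r2 \<in> \<rat> \<Longrightarrow> 0 < r1 \<Longrightarrow> r1 < r2 \<Longrightarrow> r2 < r \<Longrightarrow>
       AE q in lborel. ennreal (cauchy_const * cmod (disc_cutoff r1 r2 q * v k q / q ^ m))
         \<le> (NLINT w. ennreal (cmod ((disc_cutoff r1 r2 w * g k w + cdbar (disc_cutoff r1 r2) w * v k w) / w ^ m) / cmod (w - q)))"
begin

definition size_v :: "complex \<Rightarrow> real" where "size_v w = (\<Sum>k\<in>UNIV. cmod (v k w))"

lemma size_v_measurable [measurable]: "size_v \<in> borel_measurable borel"
  unfolding size_v_def[abs_def] by measurable

lemma size_v_nonneg: "0 \<le> size_v w"
  unfolding size_v_def by (intro sum_nonneg) auto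

lemma cmod_v_le_size: "cmod (v k w) \<le> size_v w"
  unfolding size_v_def by (rule member_le_sum) auto

lemma integral_size_finite:
  "(NLINT w. indicator (ball 0 r) w * ennreal (W w * size_v w / cmod w ^ M)) < \<infinity>"
proof -
  have "indicator (ball 0 r) w * ennreal (W w * size_v w / cmod w ^ M) = (\<Sum>k\<in>UNIV. indicator (ball 0 r) w * ennreal (W w * cmod (v k w) / cmod w ^ M))" for w
  proof -
    have "ennreal (W w * size_v w / cmod w ^ M) = (\<Sum>k\<in>UNIV. ennreal (W w * cmod (v k w) / cmod w ^ M))"
      using W1[of w] by (subst sum_ennreal) (auto simp: size_v_def sum_distrib_left sum_divide_distrib)
    then show ?thesis by (simp only: sum_distrib_left)
  qed
  then have "(NLINT w. indicator (ball 0 r) w * ennreal (W w * size_v w / cmod w ^ M))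
      = (\<Sum>k\<in>UNIV. NLINT w. indicator (ball 0 r) w * ennreal (W w * cmod (v k w) / cmod w ^ M))"
    by (simp only:) (rule nn_integral_sum, measurable)
  then show ?thesis using iW by simp
qed

text \<open>A majorant of the derivative of \<open>v\<close> times a disc cutoff: the potential term, and the term from the
derivative of the cutoff, which lives between the two radii.\<close>

definition source :: "real \<Rightarrow> real \<Rightarrow> real \<Rightarrow> complex \<Rightarrow> real" where
  "source M r1 r2 w = indicator (cball 0 r2) w * (W w * size_v w) + M * (indicator (cball 0 r2 - ball 0 r1) w * size_v w)"

lemma source_measurable [measurable]: "source M r1 r2 \<in> borel_measurable borel"
proof -
  have "source M r1 r2 \<in> borel_measurable lborel" unfolding source_def[abs_def] by measurable
  then show ?thesis by simp
qed

lemma source_nonneg: "0 \<le> M \<Longrightarrow> 0 \<le> source M r1 r2 w"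
  using W1[of w] size_v_nonneg[of w] by (simp add: source_def)

lemma cauchy_bound_size:
  assumes "r1 \<in> \<rat>" "r2 \<in> \<rat>" "0 < r1" "r1 < r2" "r2 < r"
  shows "\<exists>M\<ge>0. \<forall>m. AE q in lborel. cmod q < r1 \<longrightarrow> ennreal (cauchy_const * size_v q / cmod q ^ m)
     \<le> of_nat CARD('N) * (NLINT w. ennreal (source M r1 r2 w / cmod w ^ m / cmod (w - q)))"
proof -
  let ?\<theta> = "disc_cutoff r1 r2"
  have \<theta>: "smooth ?\<theta>" by (rule smooth_disc_cutoff) (use assms in auto)
  have out: "?\<theta> w = 0" if "r2 \<le> cmod w" for w by (rule disc_cutoff_outer) (use assms that in auto)
  have inn: "?\<theta> w = 1" if "cmod w \<le> r1" for w by (rule disc_cutoff_inner) (use assms that in auto)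
  obtain M where M: "M \<ge> 0" "\<And>w. cmod (cdbar ?\<theta> w) \<le> M" using cdbar_bounded[OF \<theta>, of r2] out by auto
  have z1: "cdbar ?\<theta> w = 0" if "cmod w < r1" for w
    by (rule cdbar_zero_if_constant_near[of "ball 0 r1"]) (use that inn in auto)
  have z2: "cdbar ?\<theta> w = 0" if "r2 < cmod w" for w
    by (rule cdbar_zero_if_constant_near[of "- cball 0 r2"]) (use that out in auto)
  have dom: "AE w in lborel. cmod (?\<theta> w * g k w + cdbar ?\<theta> w * v k w) \<le> source M r1 r2 w" for k
    using dominated
  proof eventually_elim
    case (elim w)
    have s: "W w * size_v w \<ge> 0" using W1[of w] size_v_nonneg[of w] by simp
    have a: "cmod (?\<theta> w * g k w) \<le> indicator (cball 0 r2) w * (W w * size_v w)"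
    proof (cases "cmod w < r2")
      case True
      have "cmod (?\<theta> w * g k w) \<le> 1 * cmod (g k w)" unfolding norm_mult
        by (intro mult_right_mono disc_cutoff_le) (use assms in auto)
      also have "\<dots> \<le> W w * size_v w" using elim True assms by (simp add: size_v_def)
      finally show ?thesis using True by simp
    qed (use out s in simp)
    have b: "cmod (cdbar ?\<theta> w * v k w) \<le> M * (indicator (cball 0 r2 - ball 0 r1) w * size_v w)"
    proof (cases "cmod w < r1 \<or> r2 < cmod w")
      case True
      then show ?thesis using z1 z2 M(1) size_v_nonneg[of w] by auto
    next
      case False
      then show ?thesis using M cmod_v_le_size[of k w] by (auto simp: norm_mult intro!: mult_mono)
    qed
    show ?case unfolding source_def by (intro order_trans[OF norm_triangle_ineq] add_mono a b)
  qed
  have "AE q in lborel. cmod q < r1 \<longrightarrow> ennreal (cauchy_const * size_v q / cmod q ^ m)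
     \<le> of_nat CARD('N) * (NLINT w. ennreal (source M r1 r2 w / cmod w ^ m / cmod (w - q)))" for m
  proof -
    have "AE q in lborel. \<forall>k. ennreal (cauchy_const * cmod (?\<theta> q * v k q / q ^ m))
         \<le> (NLINT w. ennreal (cmod ((?\<theta> w * g k w + cdbar ?\<theta> w * v k w) / w ^ m) / cmod (w - q)))"
    proof -
      have "AE q in lborel. \<forall>k\<in>UNIV. ennreal (cauchy_const * cmod (?\<theta> q * v k q / q ^ m))
         \<le> (NLINT w. ennreal (cmod ((?\<theta> w * g k w + cdbar ?\<theta> w * v k w) / w ^ m) / cmod (w - q)))"
        by (rule AE_finite_allI[OF finite]) (rule rep[OF assms])
      then show ?thesis by simp
    qed
    then show ?thesis
    proof eventually_elim
      case (elim q)
      show ?case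
      proof
        assume q: "cmod q < r1"
        let ?J = "NLINT w. ennreal (source M r1 r2 w / cmod w ^ m / cmod (w - q))"
        have "ennreal (cauchy_const * cmod (v k q) / cmod q ^ m) \<le> ?J" for k
        proof -
          have "ennreal (cauchy_const * cmod (v k q) / cmod q ^ m) \<le> 
            (NLINT w. ennreal (cmod ((?\<theta> w * g k w + cdbar ?\<theta> w * v k w) / w ^ m) / cmod (w - q)))"
            using elim[rule_format, of k] q by (simp add: inn norm_divide norm_power)
          also have "\<dots> \<le> ?J"
          proof (rule nn_integral_mono_AE)
            show "AE w in lborel. ennreal (cmod ((?\<theta> w * g k w + cdbar ?\<theta> w * v k w) / w ^ m) / cmod (w - q))
               \<le> ennreal (source M r1 r2 w / cmod w ^ m / cmod (w - q))"
              using dom[of k] by eventually_elim (auto simp: norm_divide norm_power intro!: ennreal_leI divide_right_mono)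
          qed
          finally show ?thesis .
        qed
        then have "(\<Sum>k\<in>UNIV. ennreal (cauchy_const * cmod (v k q) / cmod q ^ m)) \<le> (\<Sum>k\<in>(UNIV::'N set). ?J)"
          by (intro sum_mono)
        moreover have "(\<Sum>k\<in>UNIV. ennreal (cauchy_const * cmod (v k q) / cmod q ^ m)) = ennreal (cauchy_const * size_v q / cmod q ^ m)"
          using cauchy_const_pos by (simp add: size_v_def sum_distrib_left sum_divide_distrib)
        ultimately show "ennreal (cauchy_const * size_v q / cmod q ^ m) \<le> of_nat CARD('N) * ?J" by simp
      qed
    qed
  qed
  then show ?thesis using M(1) by blast
qed

text \<open>The weighted fourth power of \<open>W\<close> is integrable and circles are null sets, so thin annuli carry little
of it.\<close>

lemma small_annulus:
  assumes "0 \<le> \<rho>" "\<rho> < r" "0 < \<delta>"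
  shows "\<exists>R. \<rho> < R \<and> R < r \<and> (NLINT q. indicator (ball 0 R - ball 0 \<rho>) q * ennreal ((cmod q)\<^sup>2 * W q ^ 4)) \<le> ennreal \<delta>"
proof -
  define \<mu> where "\<mu> = density lborel (\<lambda>w. indicator (ball 0 r) w * ennreal ((cmod w)\<^sup>2 * W w ^ 4))"
  (* the 2 keeps the outer radius below r *)
  define A where "A n = ball (0::complex) (\<rho> + (r - \<rho>) / real (n + 2)) - ball 0 \<rho>" for n
  have fr: "(r - \<rho>) / real (n + 2) < r - \<rho>" for n using assms(2) by (simp add: divide_less_eq)
  have em: "emeasure \<mu> (A n) = (NLINT q. indicator (A n) q * ennreal ((cmod q)\<^sup>2 * W q ^ 4))" for n
  proof -
    have "A n \<in> sets lborel" by (simp add: A_def)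
    have "emeasure \<mu> (A n) = (NLINT q. indicator (ball 0 r) q * ennreal ((cmod q)\<^sup>2 * W q ^ 4) * indicator (A n) q)"
    proof -
      have f: "(\<lambda>w. indicator (ball 0 r) w * ennreal ((cmod w)\<^sup>2 * W w ^ 4)) \<in> borel_measurable lborel" by measurable
      show ?thesis unfolding \<mu>_def by (rule emeasure_density[OF f \<open>A n \<in> sets lborel\<close>])
    qed
    also have "\<dots> = (NLINT q. indicator (A n) q * ennreal ((cmod q)\<^sup>2 * W q ^ 4))"
      by (intro nn_integral_cong) (use fr[of n] in \<open>auto simp: A_def split: split_indicator\<close>)
    finally show ?thesis .
  qed
  have "(\<lambda>n. emeasure \<mu> (A n)) \<longlonglongrightarrow> emeasure \<mu> (\<Inter>n. A n)"
  proof (rule Lim_emeasure_decseq)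
    show "range A \<subseteq> sets \<mu>" by (auto simp: A_def \<mu>_def)
    show "decseq A" unfolding decseq_def A_def using assms(2)
      by (intro allI impI Diff_mono subset_ball add_left_mono divide_left_mono) auto
    fix n
    have "emeasure \<mu> (A n) \<le> (NLINT w. indicator (ball 0 r) w * ennreal ((cmod w)\<^sup>2 * W w ^ 4))"
      unfolding em by (intro nn_integral_mono) (use fr[of n] in \<open>auto simp: A_def split: split_indicator\<close>)
    then show "emeasure \<mu> (A n) \<noteq> \<infinity>" using W4 by (auto simp: top_unique)
  qed
  moreover have "emeasure \<mu> (\<Inter>n. A n) = 0"
  proof -
    have "(\<Inter>n. A n) \<subseteq> sphere 0 \<rho>"
    proof
      fix x assume x: "x \<in> (\<Inter>n. A n)"
      then have "\<rho> \<le> cmod x" by (auto simp: A_def)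
      moreover have "cmod x \<le> \<rho>"
      proof (rule LIMSEQ_le_const)
        have "(\<lambda>n. \<rho> + (r - \<rho>) * inverse (real (n + 2))) \<longlonglongrightarrow> \<rho> + (r - \<rho>) * 0"
          by (intro tendsto_intros LIMSEQ_ignore_initial_segment lim_inverse_n)
        then show "(\<lambda>n. \<rho> + (r - \<rho>) / real (n + 2)) \<longlonglongrightarrow> \<rho>" by (simp add: divide_inverse)
        show "\<exists>N. \<forall>n\<ge>N. cmod x \<le> \<rho> + (r - \<rho>) / real (n + 2)"
          using x by (intro exI[of _ 0]) (force simp: A_def intro: less_imp_le)
      qed
      ultimately show "x \<in> sphere 0 \<rho>" by simp
    qed
    moreover have "sphere (0::complex) \<rho> \<in> null_sets lborel"
    proof -
      have "sphere (0::complex) \<rho> \<in> null_sets lebesgue" unfolding negligible_iff_null_sets[symmetric]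
        by (rule negligible_sphere)
      then show ?thesis by (simp add: null_sets_completion_iff)
    qed
    moreover have "(\<Inter>n. A n) \<in> sets lborel" by (auto simp: A_def)
    ultimately have "(\<Inter>n. A n) \<in> null_sets lborel" by (metis null_sets_subset)
    then have null: "(\<Inter>n. A n) \<in> null_sets lborel" .
    have f: "(\<lambda>w. indicator (ball 0 r) w * ennreal ((cmod w)\<^sup>2 * W w ^ 4)) \<in> borel_measurable lborel" by measurable
    show ?thesis unfolding \<mu>_def using emeasure_density[OF f null_setsD2[OF null]] nn_integral_null_set[OF null] by simp
  qed
  ultimately have "(\<lambda>n. emeasure \<mu> (A n)) \<longlonglongrightarrow> 0" by simp
  then have "\<forall>\<^sub>F n in sequentially. emeasure \<mu> (A n) < ennreal \<delta>"
    using assms(3) by (intro order_tendstoD(2)[of _ 0]) auto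
  then obtain n where "emeasure \<mu> (A n) < ennreal \<delta>" by (auto simp: eventually_sequentially)
  then show ?thesis unfolding em using fr[of n] assms(2)
    by (intro exI[of _ "\<rho> + (r - \<rho>) / real (n + 2)"]) (auto simp: A_def intro: less_imp_le)
qed

lemma half_power_le: "cmod q powr (-1/2) \<le> 1 + 1 / cmod q"
proof (cases "q = 0")
  case False
  show ?thesis
  proof (cases "1 \<le> cmod q")
    case True
    have "cmod q powr (-1/2) \<le> cmod q powr 0" using True by (intro powr_mono) auto
    then have "cmod q powr (-1/2) \<le> 1" using False by simp
    moreover have "0 \<le> 1 / cmod q" by simp
    ultimately show ?thesis by linarith
  next
    case 2: False
    have "cmod q powr (-1/2) \<le> cmod q powr (-1)" using False 2 by (intro powr_mono') auto
    then show ?thesis using False by (simp add: powr_minus_divide)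
  qed
qed simp

lemma weighted_integral_finite:
  "(NLINT w. indicator (ball 0 r) w * ennreal (cmod w powr (-1/2) * (W w * size_v w) / cmod w ^ m)) < \<infinity>"
proof -
  have "(NLINT w. indicator (ball 0 r) w * ennreal (cmod w powr (-1/2) * (W w * size_v w) / cmod w ^ m))
    \<le> (NLINT w. indicator (ball 0 r) w * ennreal (W w * size_v w / cmod w ^ m) + indicator (ball 0 r) w * ennreal (W w * size_v w / cmod w ^ Suc m))"
  proof (rule nn_integral_mono)
    fix w
    have nn: "0 \<le> W w * size_v w / cmod w ^ m" for m using W1[of w] size_v_nonneg[of w] by simp
    have "cmod w powr (-1/2) * (W w * size_v w) / cmod w ^ m \<le> (1 + 1 / cmod w) * (W w * size_v w / cmod w ^ m)"
      using mult_right_mono[OF half_power_le[of w] nn[of m]] by simp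
    also have "\<dots> = W w * size_v w / cmod w ^ m + W w * size_v w / cmod w ^ Suc m" by (simp add: distrib_right add_divide_distrib)
    finally have "ennreal (cmod w powr (-1/2) * (W w * size_v w) / cmod w ^ m) \<le> ennreal (W w * size_v w / cmod w ^ m) + ennreal (W w * size_v w / cmod w ^ Suc m)"
      using nn[of m] nn[of "Suc m"] by (simp add: ennreal_leI flip: ennreal_plus)
    then show "indicator (ball 0 r) w * ennreal (cmod w powr (-1/2) * (W w * size_v w) / cmod w ^ m) \<le>
      indicator (ball 0 r) w * ennreal (W w * size_v w / cmod w ^ m) + indicator (ball 0 r) w * ennreal (W w * size_v w / cmod w ^ Suc m)"
      by (auto split: split_indicator)
  qed
  also have "\<dots> = (NLINT w. indicator (ball 0 r) w * ennreal (W w * size_v w / cmod w ^ m))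
      + (NLINT w. indicator (ball 0 r) w * ennreal (W w * size_v w / cmod w ^ Suc m))"
    by (rule nn_integral_add; measurable)
  also have "\<dots> < \<infinity>" using integral_size_finite[of m] integral_size_finite[of "Suc m"] by simp
  finally show ?thesis .
qed

text \<open>The Carleman estimate. Integrate the Cauchy bound for \<open>v / w ^ m\<close> against \<open>|q| powr (-1/2) * W q\<close> over the
annulus and exchange the integrals. By \<open>ker\<close> the potential term of the source returns half of the left
hand side, which is finite and can be subtracted; what remains comes from \<open>|w| \<ge> r1\<close>, where
\<open>1 / |w| ^ m\<close> is at most \<open>1 / r1 ^ m\<close>. The smallness in \<open>ker\<close> does not depend on \<open>m\<close>.\<close>

lemma absorption:
  assumes \<rho>: "0 \<le> \<rho>" "\<rho> < r1" and r1: "r1 \<in> \<rat>" and r2: "r2 \<in> \<rat>" "r1 < r2" "r2 < r"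
    and van: "AE w in lborel. cmod w < \<rho> \<longrightarrow> size_v w = 0"
    and ker: "\<And>w. w \<noteq> 0 \<Longrightarrow> (NLINT q. indicator (ball 0 r1 - ball 0 \<rho>) q * ennreal (cmod q powr (-1/2) * W q / cmod (q - w)))
        \<le> ennreal (cauchy_const / (2 * real CARD('N)) * cmod w powr (-1/2))"
  shows "\<exists>b\<ge>0. \<forall>m. (NLINT q. indicator (ball 0 r1 - ball 0 \<rho>) q * ennreal (cmod q powr (-1/2) * (W q * size_v q) / cmod q ^ m))
      \<le> ennreal (b / r1 ^ m)"
proof -
  let ?N = "real CARD('N)" and ?A = "ball (0::complex) r1 - ball 0 \<rho>" and ?p = "\<lambda>q::complex. cmod q powr (-1/2)"
  let ?c = "cauchy_const"
  have N: "?N > 0" by simp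
  have r1p: "0 < r1" using \<rho> by linarith
  obtain M where M: "M \<ge> 0" "\<And>m. AE q in lborel. cmod q < r1 \<longrightarrow> ennreal (?c * size_v q / cmod q ^ m)
     \<le> of_nat CARD('N) * (NLINT w. ennreal (source M r1 r2 w / cmod w ^ m / cmod (w - q)))"
    using cauchy_bound_size[OF r1 r2(1) r1p r2(2,3)] by blast
  define a where "a m = (NLINT q. indicator ?A q * ennreal (?p q * (W q * size_v q) / cmod q ^ m))" for m
  define B where "B = (NLINT w. indicator (cball 0 r2 - ball 0 r1) w * ennreal ((1 + M) * (?p w * (W w * size_v w))))"
  have Wu: "0 \<le> W w * size_v w" for w using W1[of w] size_v_nonneg[of w] by simp
  have a_fin: "a m < \<infinity>" for m
    unfolding a_def by (rule le_less_trans[OF nn_integral_mono weighted_integral_finite[of m]])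
      (use r2 in \<open>auto split: split_indicator\<close>)
  have B_fin: "B < \<infinity>"
  proof -
    have "B \<le> (NLINT w. ennreal (1 + M) * (indicator (ball 0 r) w * ennreal (?p w * (W w * size_v w) / cmod w ^ 0)))"
      unfolding B_def using M(1) Wu r2 by (intro nn_integral_mono) (auto simp: ennreal_mult split: split_indicator)
    also have "\<dots> = ennreal (1 + M) * (NLINT w. indicator (ball 0 r) w * ennreal (?p w * (W w * size_v w) / cmod w ^ 0))"
      by (rule nn_integral_cmult) measurable
    also have "\<dots> < \<infinity>" using weighted_integral_finite[of 0] by (simp add: ennreal_mult_less_top)
    finally show ?thesis .
  qed
  obtain b where b: "0 \<le> b" "B = ennreal b" using B_fin by (cases B) auto
  have "a m \<le> ennreal (b / r1 ^ m)" for m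
  proof -
    have sn: "0 \<le> source M r1 r2 w / cmod w ^ m" for w using source_nonneg[OF M(1), of r1 r2 w] by simp
    have pW: "0 \<le> ?p q * W q" for q using W1[of q] by simp
    have "ennreal ?c * a m = (NLINT q. indicator ?A q * ennreal (?p q * W q) * ennreal (?c * size_v q / cmod q ^ m))"
    proof -
      have "ennreal ?c * (indicator ?A q * ennreal (?p q * (W q * size_v q) / cmod q ^ m))
          = indicator ?A q * ennreal (?p q * W q) * ennreal (?c * size_v q / cmod q ^ m)" for q
      proof -
        have "ennreal ?c * ennreal (?p q * (W q * size_v q) / cmod q ^ m) = ennreal (?c * (?p q * (W q * size_v q) / cmod q ^ m))"
          using cauchy_const_pos Wu[of q] by (intro ennreal_mult[symmetric]) auto
        also have "?c * (?p q * (W q * size_v q) / cmod q ^ m) = (?p q * W q) * (?c * size_v q / cmod q ^ m)" by simp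
        also have "ennreal \<dots> = ennreal (?p q * W q) * ennreal (?c * size_v q / cmod q ^ m)"
          using pW[of q] cauchy_const_pos size_v_nonneg[of q] by (intro ennreal_mult) auto
        finally show ?thesis by (cases "q \<in> ?A") auto
      qed
      then show ?thesis unfolding a_def by (subst nn_integral_cmult[symmetric], measurable)
    qed
    also have "\<dots> \<le> (NLINT q. indicator ?A q * ennreal (?p q * W q) * (of_nat CARD('N) * (NLINT w. ennreal (source M r1 r2 w / cmod w ^ m / cmod (w - q)))))"
      by (rule nn_integral_mono_AE, use M(2)[of m] in eventually_elim) (auto intro!: mult_left_mono split: split_indicator)
    also have "\<dots> = (NLINT q. of_nat CARD('N) * (NLINT w. indicator ?A q * ennreal (?p q * W q) * ennreal (source M r1 r2 w / cmod w ^ m / cmod (w - q))))"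
      by (intro nn_integral_cong, subst nn_integral_cmult, measurable) (simp add: mult_ac)
    also have "\<dots> = of_nat CARD('N) * (NLINT q. (NLINT w. indicator ?A q * ennreal (?p q * W q) * ennreal (source M r1 r2 w / cmod w ^ m / cmod (w - q))))"
      by (rule nn_integral_cmult) measurable
    also have "(NLINT q. (NLINT w. indicator ?A q * ennreal (?p q * W q) * ennreal (source M r1 r2 w / cmod w ^ m / cmod (w - q))))
       = (NLINT w. (NLINT q. indicator ?A q * ennreal (?p q * W q) * ennreal (source M r1 r2 w / cmod w ^ m / cmod (w - q))))"
      by (rule lborel_pair.Fubini'[symmetric]) measurable
    also have "\<dots> = (NLINT w. ennreal (source M r1 r2 w / cmod w ^ m) * (NLINT q. indicator ?A q * ennreal (?p q * W q / cmod (q - w))))"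
    proof (rule nn_integral_cong)
      fix w
      have "(NLINT q. indicator ?A q * ennreal (?p q * W q) * ennreal (source M r1 r2 w / cmod w ^ m / cmod (w - q)))
        = (NLINT q. ennreal (source M r1 r2 w / cmod w ^ m) * (indicator ?A q * ennreal (?p q * W q / cmod (q - w))))"
      proof (rule nn_integral_cong)
        fix q
        have "ennreal (?p q * W q) * ennreal (source M r1 r2 w / cmod w ^ m / cmod (w - q)) = ennreal ((?p q * W q) * (source M r1 r2 w / cmod w ^ m / cmod (w - q)))"
          using pW[of q] divide_nonneg_nonneg[OF sn[of w] norm_ge_zero[of "w - q"]] by (intro ennreal_mult[symmetric])
        also have "(?p q * W q) * (source M r1 r2 w / cmod w ^ m / cmod (w - q)) = source M r1 r2 w / cmod w ^ m * (?p q * W q / cmod (q - w))"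
          by (simp add: norm_minus_commute[of w q])
        also have "ennreal \<dots> = ennreal (source M r1 r2 w / cmod w ^ m) * ennreal (?p q * W q / cmod (q - w))"
          using divide_nonneg_nonneg[OF pW[of q] norm_ge_zero[of "q - w"]] sn[of w] by (intro ennreal_mult)
        finally show "indicator ?A q * ennreal (?p q * W q) * ennreal (source M r1 r2 w / cmod w ^ m / cmod (w - q))
            = ennreal (source M r1 r2 w / cmod w ^ m) * (indicator ?A q * ennreal (?p q * W q / cmod (q - w)))"
          by (cases "q \<in> ?A") auto
      qed
      also have "\<dots> = ennreal (source M r1 r2 w / cmod w ^ m) * (NLINT q. indicator ?A q * ennreal (?p q * W q / cmod (q - w)))"
        by (rule nn_integral_cmult) measurable
      finally show "(NLINT q. indicator ?A q * ennreal (?p q * W q) * ennreal (source M r1 r2 w / cmod w ^ m / cmod (w - q)))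
         = ennreal (source M r1 r2 w / cmod w ^ m) * (NLINT q. indicator ?A q * ennreal (?p q * W q / cmod (q - w)))" .
    qed
    also have "\<dots> \<le> (NLINT w. ennreal (?c / (2 * ?N)) * (indicator ?A w * ennreal (?p w * (W w * size_v w) / cmod w ^ m)
          + ennreal (1 / r1 ^ m) * (indicator (cball 0 r2 - ball 0 r1) w * ennreal ((1 + M) * (?p w * (W w * size_v w))))))"
    proof (rule nn_integral_mono_AE, use AE_lborel_singleton[of 0] van in eventually_elim)
      fix w :: complex assume w: "w \<noteq> 0" and v0: "cmod w < \<rho> \<longrightarrow> size_v w = 0"
      have main: "ennreal (?p w * (source M r1 r2 w / cmod w ^ m)) \<le> indicator ?A w * ennreal (?p w * (W w * size_v w) / cmod w ^ m)
          + ennreal (1 / r1 ^ m) * (indicator (cball 0 r2 - ball 0 r1) w * ennreal ((1 + M) * (?p w * (W w * size_v w))))"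
      proof -
        consider "cmod w < \<rho>" | "\<rho> \<le> cmod w" "cmod w < r1" | "r1 \<le> cmod w" "cmod w \<le> r2" | "r2 < cmod w" by linarith
        then show ?thesis
        proof cases
          case 1 then show ?thesis using v0 by (simp add: source_def)
        next
          case 2 then show ?thesis using r2 by (simp add: source_def)
        next
          case 3
          have "size_v w \<le> W w * size_v w" using W1[of w] size_v_nonneg[of w] by (simp add: mult_le_cancel_right1)
          then have "source M r1 r2 w \<le> (1 + M) * (W w * size_v w)"
            using 3 M(1) by (simp add: source_def algebra_simps mult_left_mono)
          moreover have "1 / cmod w ^ m \<le> 1 / r1 ^ m" using 3 r1p by (intro divide_left_mono power_mono mult_pos_pos zero_less_power) auto
          ultimately have "source M r1 r2 w * (1 / cmod w ^ m) \<le> ((1 + M) * (W w * size_v w)) * (1 / r1 ^ m)"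
            using M(1) Wu[of w] by (intro mult_mono) auto
          then have "?p w * (source M r1 r2 w / cmod w ^ m) \<le> 1 / r1 ^ m * ((1 + M) * (?p w * (W w * size_v w)))"
            using mult_left_mono[of "source M r1 r2 w * (1 / cmod w ^ m)" "((1 + M) * (W w * size_v w)) * (1 / r1 ^ m)" "?p w"]
            by (simp add: mult_ac)
          then have "ennreal (?p w * (source M r1 r2 w / cmod w ^ m)) \<le> ennreal (1 / r1 ^ m) * ennreal ((1 + M) * (?p w * (W w * size_v w)))"
            using M(1) Wu[of w] r1p by (subst ennreal_mult[symmetric]) (auto intro: ennreal_leI)
          then show ?thesis using 3 by simp
        next
          case 4 then show ?thesis using r2 by (simp add: source_def)
        qed
      qed
      have "ennreal (source M r1 r2 w / cmod w ^ m) * (NLINT q. indicator ?A q * ennreal (?p q * W q / cmod (q - w)))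
        \<le> ennreal (source M r1 r2 w / cmod w ^ m) * ennreal (?c / (2 * ?N) * ?p w)"
        by (intro mult_left_mono ker w) simp
      also have "\<dots> = ennreal (?c / (2 * ?N)) * ennreal (?p w * (source M r1 r2 w / cmod w ^ m))"
      proof -
        have "ennreal (source M r1 r2 w / cmod w ^ m) * ennreal (?c / (2 * ?N) * ?p w)
            = ennreal (source M r1 r2 w / cmod w ^ m * (?c / (2 * ?N) * ?p w))"
          using sn[of w] cauchy_const_pos by (intro ennreal_mult[symmetric]) auto
        also have "source M r1 r2 w / cmod w ^ m * (?c / (2 * ?N) * ?p w) = ?c / (2 * ?N) * (?p w * (source M r1 r2 w / cmod w ^ m))"
          by (simp only: mult_ac)
        also have "ennreal \<dots> = ennreal (?c / (2 * ?N)) * ennreal (?p w * (source M r1 r2 w / cmod w ^ m))"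
          using mult_nonneg_nonneg[OF powr_ge_zero sn[of w]] cauchy_const_pos by (intro ennreal_mult) auto
        finally show ?thesis .
      qed
      also have "\<dots> \<le> ennreal (?c / (2 * ?N)) * (indicator ?A w * ennreal (?p w * (W w * size_v w) / cmod w ^ m)
          + ennreal (1 / r1 ^ m) * (indicator (cball 0 r2 - ball 0 r1) w * ennreal ((1 + M) * (?p w * (W w * size_v w)))))"
        by (intro mult_left_mono main) simp
      finally show "ennreal (source M r1 r2 w / cmod w ^ m) * (NLINT q. indicator ?A q * ennreal (?p q * W q / cmod (q - w)))
        \<le> ennreal (?c / (2 * ?N)) * (indicator ?A w * ennreal (?p w * (W w * size_v w) / cmod w ^ m)
          + ennreal (1 / r1 ^ m) * (indicator (cball 0 r2 - ball 0 r1) w * ennreal ((1 + M) * (?p w * (W w * size_v w)))))" .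
    qed
    also have "\<dots> = ennreal (?c / (2 * ?N)) * (a m + ennreal (1 / r1 ^ m) * B)"
    proof -
      define F1 where "F1 w = indicator ?A w * ennreal (?p w * (W w * size_v w) / cmod w ^ m)" for w
      define F2 where "F2 w = indicator (cball 0 r2 - ball 0 r1) w * ennreal ((1 + M) * (?p w * (W w * size_v w)))" for w
      have F: "F1 \<in> borel_measurable lborel" "F2 \<in> borel_measurable lborel"
        unfolding F1_def[abs_def] F2_def[abs_def] by measurable
      show ?thesis unfolding a_def B_def F1_def[symmetric] F2_def[symmetric]
        using F by (simp add: nn_integral_cmult nn_integral_add)
    qed
    finally have main: "ennreal ?c * a m \<le> of_nat CARD('N) * (ennreal (?c / (2 * ?N)) * (a m + ennreal (1 / r1 ^ m) * B))"
      by (simp add: mult_left_mono)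
    obtain \<alpha> where \<alpha>: "0 \<le> \<alpha>" "a m = ennreal \<alpha>" using a_fin[of m] by (cases "a m") auto
    have "ennreal (?c * \<alpha>) \<le> ennreal (?N * (?c / (2 * ?N) * (\<alpha> + 1 / r1 ^ m * b)))"
    proof -
      define k where "k = ?c / (2 * ?N)"
      have k: "0 \<le> k" using cauchy_const_pos by (simp add: k_def)
      have nn: "0 \<le> 1 / r1 ^ m" using r1p by simp
      note nb = mult_nonneg_nonneg[OF nn b(1)]
      have "of_nat CARD('N) * (ennreal k * (ennreal \<alpha> + ennreal (1 / r1 ^ m) * ennreal b))
         = ennreal ?N * (ennreal k * ennreal (\<alpha> + 1 / r1 ^ m * b))"
        by (simp only: ennreal_of_nat_eq_real_of_nat ennreal_mult[OF nn b(1), symmetric] ennreal_plus[OF \<alpha>(1) nb, symmetric])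
      also have "\<dots> = ennreal (?N * (k * (\<alpha> + 1 / r1 ^ m * b)))"
        by (simp only: ennreal_mult[OF k add_nonneg_nonneg[OF \<alpha>(1) nb]]
              ennreal_mult[OF of_nat_0_le_iff mult_nonneg_nonneg[OF k add_nonneg_nonneg[OF \<alpha>(1) nb]]])
      finally show ?thesis
        using main cauchy_const_pos \<alpha>(1) unfolding \<alpha>(2) b(2) k_def[symmetric] by (simp add: ennreal_mult)
    qed
    then have "?c * \<alpha> \<le> ?N * (?c / (2 * ?N) * (\<alpha> + 1 / r1 ^ m * b))"
      using \<alpha> b cauchy_const_pos r1p by (subst (asm) ennreal_le_iff) auto
    then have "?c * \<alpha> \<le> ?c * ((\<alpha> + b / r1 ^ m) / 2)" by simp
    then have "\<alpha> \<le> b / r1 ^ m" using cauchy_const_pos by (simp add: mult_le_cancel_left)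
    then show ?thesis using \<alpha> by (simp add: ennreal_leI)
  qed
  then show ?thesis using b(1) unfolding a_def by blast
qed

text \<open>On a disc of radius \<open>t < r1\<close> the weight is at least \<open>1 / t ^ m\<close>, so the absorption estimate bounds the
unweighted integral by a multiple of \<open>(t / r1) ^ m\<close>, and \<open>m\<close> is arbitrary. Smallness of the potential is
required only between \<open>\<rho>\<close> and \<open>r1\<close>, since \<open>v\<close> is already zero inside.\<close>

lemma vanishing_extends:
  assumes \<rho>: "0 \<le> \<rho>" "\<rho> < r" and van: "AE w in lborel. cmod w < \<rho> \<longrightarrow> size_v w = 0"
  shows "\<exists>t>\<rho>. t < r \<and> (AE w in lborel. cmod w < t \<longrightarrow> size_v w = 0)"
proof -
  have \<eta>: "0 < cauchy_const / (2 * real CARD('N))" using cauchy_const_pos by simp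
  obtain \<delta> where \<delta>: "\<delta> > 0" "\<And>W A w. W \<in> borel_measurable borel \<Longrightarrow> (\<forall>q. 0 \<le> W q) \<Longrightarrow> A \<in> sets borel \<Longrightarrow>
     (NLINT q. indicator A q * ennreal ((cmod q)\<^sup>2 * W q ^ 4)) \<le> ennreal \<delta> \<Longrightarrow> w \<noteq> 0 \<Longrightarrow>
     (NLINT q. indicator A q * ennreal (cmod q powr (-1/2) * W q / cmod (q - w))) \<le> ennreal (cauchy_const / (2 * real CARD('N)) * cmod w powr (-1/2))"
    using nn_integral_potential_kernel_le[OF \<eta>] by blast
  obtain R where R: "\<rho> < R" "R < r" "(NLINT q. indicator (ball 0 R - ball 0 \<rho>) q * ennreal ((cmod q)\<^sup>2 * W q ^ 4)) \<le> ennreal \<delta>"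
    using small_annulus[OF \<rho> \<delta>(1)] by blast
  (* rational radii, for which the Cauchy bound is available *)
  obtain r1 where r1: "r1 \<in> \<rat>" "\<rho> < r1" "r1 < R" using Rats_dense_in_real[OF R(1)] by blast
  have "r1 < r" using r1(3) R(2) by linarith
  then obtain r2 where r2: "r2 \<in> \<rat>" "r1 < r2" "r2 < r" using Rats_dense_in_real by blast
  have r1p: "0 < r1" using \<rho> r1 by linarith
  have "\<forall>q. 0 \<le> W q" using W1 by (meson order_trans zero_le_one)
  moreover have "(NLINT q. indicator (ball 0 r1 - ball 0 \<rho>) q * ennreal ((cmod q)\<^sup>2 * W q ^ 4)) \<le> ennreal \<delta>"
    by (rule order_trans[OF nn_integral_mono R(3)]) (use r1(3) in \<open>auto split: split_indicator\<close>)
  ultimately obtain b where b: "b \<ge> 0" "\<And>m. (NLINT q. indicator (ball 0 r1 - ball 0 \<rho>) q * ennreal (cmod q powr (-1/2) * (W q * size_v q) / cmod q ^ m))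
      \<le> ennreal (b / r1 ^ m)"
    using absorption[OF \<rho>(1) r1(2,1) r2 van \<delta>(2)[OF Wm]] by auto
  define t where "t = (\<rho> + r1) / 2"
  have t: "\<rho> < t" "t < r1" "0 < t" using r1(2) \<rho> by (auto simp: t_def)
  define X where "X = (NLINT q. indicator (ball 0 t - ball 0 \<rho>) q * ennreal (cmod q powr (-1/2) * (W q * size_v q)))"
  have Wu: "0 \<le> W w * size_v w" for w using W1[of w] size_v_nonneg[of w] by simp
  have X: "X \<le> ennreal (b * (t / r1) ^ m)" for m
  proof -
    have "X \<le> (NLINT q. ennreal (t ^ m) * (indicator (ball 0 r1 - ball 0 \<rho>) q * ennreal (cmod q powr (-1/2) * (W q * size_v q) / cmod q ^ m)))"
      unfolding X_def
    proof (rule nn_integral_mono)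
      fix q :: complex
      show "indicator (ball 0 t - ball 0 \<rho>) q * ennreal (cmod q powr (-1/2) * (W q * size_v q))
        \<le> ennreal (t ^ m) * (indicator (ball 0 r1 - ball 0 \<rho>) q * ennreal (cmod q powr (-1/2) * (W q * size_v q) / cmod q ^ m))"
      proof (cases "q \<in> ball 0 t - ball 0 \<rho> \<and> q \<noteq> 0")
        case True
        have "1 \<le> t ^ m / cmod q ^ m" using True t by (simp add: power_mono)
        then have "cmod q powr (-1/2) * (W q * size_v q) \<le> t ^ m / cmod q ^ m * (cmod q powr (-1/2) * (W q * size_v q))"
          using mult_right_mono[of 1 "t ^ m / cmod q ^ m" "cmod q powr (-1/2) * (W q * size_v q)"] Wu[of q] by simp
        then have "ennreal (cmod q powr (-1/2) * (W q * size_v q)) \<le> ennreal (t ^ m) * ennreal (cmod q powr (-1/2) * (W q * size_v q) / cmod q ^ m)"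
          using t Wu[of q] by (subst ennreal_mult[symmetric]) (auto intro!: ennreal_leI)
        then show ?thesis using True t by simp
      qed auto
    qed
    also have "\<dots> = ennreal (t ^ m) * (NLINT q. indicator (ball 0 r1 - ball 0 \<rho>) q * ennreal (cmod q powr (-1/2) * (W q * size_v q) / cmod q ^ m))"
      by (rule nn_integral_cmult) measurable
    also have "\<dots> \<le> ennreal (t ^ m) * ennreal (b / r1 ^ m)" by (intro mult_left_mono b) simp
    also have "\<dots> = ennreal (b * (t / r1) ^ m)" using t b r1p by (simp add: power_divide mult.commute flip: ennreal_mult)
    finally show ?thesis .
  qed
  have "X = 0"
  proof -
    have "(\<lambda>m. b * (t / r1) ^ m) \<longlonglongrightarrow> b * 0"
      using t r1p by (intro tendsto_intros LIMSEQ_realpow_zero) auto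
    then have "(\<lambda>m. ennreal (b * (t / r1) ^ m)) \<longlonglongrightarrow> ennreal 0" by (intro tendsto_ennrealI) simp
    then have "X \<le> ennreal 0" by (rule LIMSEQ_le_const) (use X in auto)
    then show ?thesis by simp
  qed
  then have "AE q in lborel. indicator (ball 0 t - ball 0 \<rho>) q * ennreal (cmod q powr (-1/2) * (W q * size_v q)) = 0"
    unfolding X_def by (subst (asm) nn_integral_0_iff_AE) auto
  with van AE_lborel_singleton[of 0] have "AE w in lborel. cmod w < t \<longrightarrow> size_v w = 0"
  proof eventually_elim
    case (elim w)
    show ?case
    proof (intro impI, cases "cmod w < \<rho>")
      case False
      assume "cmod w < t"
      then have "cmod w powr (-1/2) * (W w * size_v w) \<le> 0" using elim(3) False by (simp add: ennreal_eq_0_iff)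
      moreover have "0 < cmod w powr (-1/2)" using elim(2) by simp
      ultimately have "W w * size_v w \<le> 0" by (simp add: mult_le_0_iff not_le)
      then show "size_v w = 0" using W1[of w] size_v_nonneg[of w] by (smt (verit) mult_le_0_iff)
    qed (use elim in simp)
  qed
  then show ?thesis using t \<open>r1 < r\<close> by (intro exI[of _ t]) auto
qed

text \<open>The largest radius of a disc on which \<open>v\<close> vanishes cannot be smaller than \<open>r\<close>. In this way a potential of
arbitrary size is treated with an estimate for small ones.\<close>

theorem planar_vanishing:
  assumes r: "0 < r" shows "AE w in lborel. cmod w < r \<longrightarrow> (\<forall>k. v k w = 0)"
proof -
  define Z where "Z = {\<rho>. 0 \<le> \<rho> \<and> \<rho> \<le> r \<and> (AE w in lborel. cmod w < \<rho> \<longrightarrow> size_v w = 0)}"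
  have Z0: "0 \<in> Z" using r by (auto simp: Z_def)
  have bdd: "bdd_above Z" by (auto simp: Z_def)
  define s where "s = Sup Z"
  have Zr: "\<rho> \<le> r" if "\<rho> \<in> Z" for \<rho> using that by (simp add: Z_def)
  have Zne: "Z \<noteq> {}" using Z0 by blast
  have s: "0 \<le> s" "s \<le> r" unfolding s_def by (rule cSup_upper[OF Z0 bdd], rule cSup_least[OF Zne Zr])
  have "\<exists>\<rho>\<in>Z. s - 1 / real (Suc n) < \<rho>" for n
    using less_cSup_iff[OF Zne bdd, of "s - 1 / real (Suc n)"] by (simp add: s_def)
  then obtain \<rho> where \<rho>: "\<And>n. \<rho> n \<in> Z" "\<And>n. s - 1 / real (Suc n) < \<rho> n" by metis
  have "AE w in lborel. \<forall>n. cmod w < \<rho> n \<longrightarrow> size_v w = 0"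
    unfolding AE_all_countable using \<rho>(1) by (auto simp: Z_def)
  then have Ps: "AE w in lborel. cmod w < s \<longrightarrow> size_v w = 0"
  proof eventually_elim
    case (elim w)
    show ?case
    proof
      assume "cmod w < s"
      then obtain n where "1 / real (Suc n) < s - cmod w" using nat_approx_posE[of "s - cmod w"] by auto
      then have "cmod w < \<rho> n" using \<rho>(2)[of n] by linarith
      then show "size_v w = 0" using elim by blast
    qed
  qed
  have "s = r"
  proof (rule ccontr)
    assume "s \<noteq> r"
    with s obtain t where t: "t > s" "t < r" "AE w in lborel. cmod w < t \<longrightarrow> size_v w = 0"
      using vanishing_extends[OF s(1) _ Ps] by force
    then have "t \<in> Z" using s by (auto simp: Z_def)
    then have "t \<le> s" unfolding s_def using bdd by (rule cSup_upper)
    then show False using t by simp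
  qed
  from Ps[unfolded this] show ?thesis
  proof eventually_elim
    case (elim w)
    then show ?case using cmod_v_le_size[of _ w] by (metis norm_le_zero_iff)
  qed
qed

end

section \<open>Vanishing on balls and unique continuation\<close>

text \<open>If \<open>W \<le> t\<^sup>3\<close>, the last term dominates; otherwise \<open>t \<le> W\<close>, and the product is at most the cube of
\<open>max W x \<ge> 1\<close>.\<close>

lemma potential_weight_le:
  fixes W x t :: real
  assumes "1 \<le> W" "0 \<le> x" "0 \<le> t"
  shows "W * x * t \<le> W ^ 4 + x ^ 4 + x * t ^ 4"
proof (cases "W \<le> t ^ 3")
  case True
  then have "W * (x * t) \<le> t ^ 3 * (x * t)" using assms by (intro mult_right_mono) auto
  also have "\<dots> = x * t ^ 4" by (simp add: power_numeral_reduce)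
  finally show ?thesis using assms by (simp add: mult_ac add_increasing)
next
  case False
  have "t \<le> W"
  proof (rule ccontr)
    assume "\<not> t \<le> W"
    then have "W < t" "1 \<le> t" using assms by auto
    then have "t * 1 \<le> t * (t * t)" by (intro mult_left_mono) (auto intro: mult_ge1_I)
    then show False using False \<open>W < t\<close> by (simp add: power3_eq_cube)
  qed
  define y where "y = max W x"
  have y: "1 \<le> y" "W \<le> y" "x \<le> y" using assms by (auto simp: y_def)
  have "W * x * t \<le> y * y * y" using y \<open>t \<le> W\<close> assms by (intro mult_mono) auto
  also have "\<dots> \<le> y ^ 4" using y power_increasing[of 3 4 y] by (simp add: power3_eq_cube mult.assoc)
  also have "\<dots> \<le> W ^ 4 + x ^ 4" unfolding y_def using assms by (auto simp: max_def)
  finally show ?thesis using assms by (smt (verit) mult_nonneg_nonneg zero_le_power)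
qed

lemma norm_slice: "norm (slice z0 (w, s) - z0) = cmod w * sqrt (1 + (cmod s)\<^sup>2)"
proof -
  have "norm (slice z0 (w, s) - z0) = sqrt ((cmod w)\<^sup>2 + (cmod w * cmod s)\<^sup>2)"
    by (simp add: slice_def norm_vec_def L2_set_def sum_2 norm_mult)
  also have "(cmod w)\<^sup>2 + (cmod w * cmod s)\<^sup>2 = (cmod w)\<^sup>2 * (1 + (cmod s)\<^sup>2)" by (simp add: power_mult_distrib algebra_simps)
  finally show ?thesis by (simp add: real_sqrt_mult)
qed

text \<open>Vanishing to infinite order in the mean, stated with the nonnegative integral so that it makes sense
without integrability.\<close>

definition decays_fast :: "(complex ^ 2 \<Rightarrow> complex) \<Rightarrow> complex ^ 2 \<Rightarrow> bool" where
  "decays_fast f z0 \<longleftrightarrow> (\<forall>m. \<exists>\<rho>>0. \<forall>r. 0 < r \<and> r < \<rho> \<longrightarrow> (NLINT z. indicator (ball z0 r) z * ennreal (cmod (f z))) \<le> ennreal (r ^ m))"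

text \<open>On the \<open>k\<close>-th dyadic shell the weight is at most a constant over \<open>d k ^ M\<close>, while the integral of \<open>|f|\<close> is at
most \<open>d k ^ Suc M\<close>; the sum over the shells converges.\<close>

lemma decays_fast_weighted_integral:
  assumes [measurable]: "f \<in> borel_measurable borel" and d: "decays_fast f z0"
    and fin: "(NLINT z. indicator (cball z0 R) z * ennreal (cmod (f z))) < \<infinity>"
  shows "(NLINT z. indicator (cball z0 R) z * ennreal (cmod (f z) / norm (z - z0) ^ M)) < \<infinity>"
proof -
  obtain \<rho>0 where \<rho>0: "\<rho>0 > 0" "\<And>r. 0 < r \<Longrightarrow> r < \<rho>0 \<Longrightarrow> (NLINT z. indicator (ball z0 r) z * ennreal (cmod (f z))) \<le> ennreal (r ^ Suc M)"
    using d unfolding decays_fast_def by (metis (no_types))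
  (* all the discs of radius d k below are smaller than rho0 *)
  define \<rho> where "\<rho> = \<rho>0 / 4"
  have \<rho>: "0 < \<rho>" "2 * \<rho> < \<rho>0" using \<rho>0(1) by (auto simp: \<rho>_def)
  define d where "d k = 2 * \<rho> / 2 ^ k" for k :: nat
  have dk: "0 < d k" "d k < \<rho>0" for k
  proof -
    show "0 < d k" using \<rho> by (simp add: d_def)
    have "2 * \<rho> / 2 ^ k \<le> 2 * \<rho> / 1" using \<rho> by (intro divide_left_mono) auto
    then show "d k < \<rho>0" using \<rho> by (simp add: d_def)
  qed
  define a where "a k = (4 / d k) ^ M" for k
  have sm: "summable (\<lambda>k. a k * d k ^ Suc M)"
  proof -
    have "a k * d k ^ Suc M = 4 ^ M * (2 * \<rho>) * (1/2) ^ k" for k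
      using dk(1)[of k] by (simp add: a_def power_divide) (simp add: d_def power_divide)
    then show ?thesis by (simp add: summable_geometric)
  qed
  have "(NLINT z. indicator (cball z0 R) z * ennreal (cmod (f z) / norm (z - z0) ^ M))
     \<le> (NLINT z. ennreal (1 / \<rho> ^ M) * (indicator (cball z0 R) z * ennreal (cmod (f z)))
          + (\<Sum>k. ennreal (a k) * (indicator (ball z0 (d k)) z * ennreal (cmod (f z)))))"
  proof (rule nn_integral_mono_AE, use AE_lborel_singleton[of z0] in eventually_elim)
    fix z assume z: "z \<noteq> z0"
    show "indicator (cball z0 R) z * ennreal (cmod (f z) / norm (z - z0) ^ M) \<le>
       ennreal (1 / \<rho> ^ M) * (indicator (cball z0 R) z * ennreal (cmod (f z)))
          + (\<Sum>k. ennreal (a k) * (indicator (ball z0 (d k)) z * ennreal (cmod (f z))))"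
    proof (cases "\<rho> \<le> norm (z - z0)")
      case True
      have "1 / norm (z - z0) ^ M \<le> 1 / \<rho> ^ M" using True \<rho> by (intro divide_left_mono power_mono mult_pos_pos zero_less_power) auto
      from mult_left_mono[OF this norm_ge_zero[of "f z"]]
      have "ennreal (cmod (f z) / norm (z - z0) ^ M) \<le> ennreal (1 / \<rho> ^ M * cmod (f z))"
        by (intro ennreal_leI) (simp add: mult.commute)
      also have "\<dots> = ennreal (1 / \<rho> ^ M) * ennreal (cmod (f z))" using \<rho> by (intro ennreal_mult) auto
      finally show ?thesis by (intro add_increasing2) (auto split: split_indicator)
    next
      case False
      then obtain k :: nat where k: "2 ^ k \<le> \<rho> / norm (z - z0)" "\<rho> / norm (z - z0) < 2 ^ Suc k"
        using dyadic_scale[of "\<rho> / norm (z - z0)"] z by auto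
      have zk: "norm (z - z0) < d k" "d k / 4 \<le> norm (z - z0)"
      proof -
        have "norm (z - z0) \<le> \<rho> / 2 ^ k" using k(1) z by (simp add: field_simps)
        also have "\<dots> < d k" using \<rho> unfolding d_def by (intro divide_strict_right_mono) auto
        finally show "norm (z - z0) < d k" .
        show "d k / 4 \<le> norm (z - z0)" using k(2) z by (simp add: d_def field_simps)
      qed
      have "1 / norm (z - z0) ^ M \<le> 1 / (d k / 4) ^ M" using zk(2) dk(1)[of k]
        by (intro divide_left_mono power_mono mult_pos_pos zero_less_power) auto
      also have "\<dots> = a k" by (simp add: a_def power_divide)
      finally have "1 / norm (z - z0) ^ M \<le> a k" .
      from mult_left_mono[OF this norm_ge_zero[of "f z"]]
      have "ennreal (cmod (f z) / norm (z - z0) ^ M) \<le> ennreal (a k * cmod (f z))"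
        by (intro ennreal_leI) (simp add: mult.commute)
      also have "\<dots> = ennreal (a k) * (indicator (ball z0 (d k)) z * ennreal (cmod (f z)))" 
        using zk(1) dk(1)[of k] by (subst ennreal_mult) (auto simp: a_def dist_norm norm_minus_commute)
      also have "\<dots> \<le> (\<Sum>i<Suc k. ennreal (a i) * (indicator (ball z0 (d i)) z * ennreal (cmod (f z))))"
        by (rule member_le_sum) auto
      also have "\<dots> \<le> (\<Sum>k. ennreal (a k) * (indicator (ball z0 (d k)) z * ennreal (cmod (f z))))" by (rule sum_le_suminf) auto
      finally show ?thesis by (intro add_increasing) (auto split: split_indicator)
    qed
  qed
  also have "\<dots> = ennreal (1 / \<rho> ^ M) * (NLINT z. indicator (cball z0 R) z * ennreal (cmod (f z)))
       + (\<Sum>k. ennreal (a k) * (NLINT z. indicator (ball z0 (d k)) z * ennreal (cmod (f z))))"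
  proof -
    have m1: "(\<lambda>z. indicator (cball z0 R) z * ennreal (cmod (f z))) \<in> borel_measurable lborel" by measurable
    have m2: "(\<lambda>z. indicator (ball z0 (d k)) z * ennreal (cmod (f z))) \<in> borel_measurable lborel" for k
    proof -
      have [measurable]: "ball z0 (d k) \<in> sets borel" by simp
      show ?thesis by measurable
    qed
    note m = m1[THEN borel_measurable_times_ennreal[OF borel_measurable_const]] m2[THEN borel_measurable_times_ennreal[OF borel_measurable_const]]
    show ?thesis
      by (subst nn_integral_add[OF m(1) borel_measurable_suminf_order[OF m(2)]], subst nn_integral_suminf[OF m(2)])
         (simp only: nn_integral_cmult[OF m1] nn_integral_cmult[OF m2])
  qed
  also have "\<dots> \<le> ennreal (1 / \<rho> ^ M) * (NLINT z. indicator (cball z0 R) z * ennreal (cmod (f z)))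
       + (\<Sum>k. ennreal (a k) * ennreal (d k ^ Suc M))"
    by (intro add_left_mono suminf_le mult_left_mono \<rho>0(2) dk) auto
  also have "(\<Sum>k. ennreal (a k) * ennreal (d k ^ Suc M)) = ennreal (\<Sum>k. a k * d k ^ Suc M)"
  proof -
    have "0 \<le> a k" "0 \<le> d k ^ Suc M" for k using dk(1)[of k] by (auto simp: a_def)
    then show ?thesis using sm by (simp add: ennreal_mult[symmetric] suminf_ennreal2 del: power_Suc)
  qed
  also have "ennreal (1 / \<rho> ^ M) * (NLINT z. indicator (cball z0 R) z * ennreal (cmod (f z))) + ennreal (\<Sum>k. a k * d k ^ Suc M) < \<infinity>"
    using fin by (simp add: ennreal_mult_less_top)
  finally show ?thesis .
qed

text \<open>The hypotheses of the theorem for Borel representatives, with \<open>V\<close> increased by one so that it also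
dominates the constant \<open>1\<close>; the weighted integrals of \<open>V * |U|\<close> then control those of \<open>|U|\<close>.\<close>

locale dbar_system =
  fixes \<Omega> :: "(complex ^ 2) set" and U :: "'N::finite \<Rightarrow> complex ^ 2 \<Rightarrow> complex"
    and G :: "2 \<Rightarrow> 'N \<Rightarrow> complex ^ 2 \<Rightarrow> complex" and V :: "complex ^ 2 \<Rightarrow> real"
  assumes Um [measurable]: "\<And>k. U k \<in> borel_measurable borel"
    and Gm [measurable]: "\<And>j k. G j k \<in> borel_measurable borel"
    and Vm [measurable]: "V \<in> borel_measurable borel"
    and U4: "\<And>K k. compact K \<Longrightarrow> K \<subseteq> \<Omega> \<Longrightarrow> (NLINT z. indicator K z * ennreal (cmod (U k z) ^ 4)) < \<infinity>"
    and V4: "\<And>K. compact K \<Longrightarrow> K \<subseteq> \<Omega> \<Longrightarrow> (NLINT z. indicator K z * ennreal (V z ^ 4)) < \<infinity>"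
    and G1: "\<And>K j k. compact K \<Longrightarrow> K \<subseteq> \<Omega> \<Longrightarrow> integrable lborel (\<lambda>z. indicator K z *\<^sub>R G j k z)"
    and V1: "\<And>z. 1 \<le> V z"
    and dom: "AE z in lborel. z \<in> \<Omega> \<longrightarrow> (\<forall>j k. cmod (G j k z) \<le> V z * (\<Sum>l\<in>UNIV. cmod (U l z)))"
    and weak: "\<And>j k \<phi>. test_function \<Omega> \<phi> \<Longrightarrow> (LBINT z. U k z * dbar j \<phi> z) = - (LBINT z. G j k z * \<phi> z)"
begin

lemma U_integral_finite: assumes K: "compact K" "K \<subseteq> \<Omega>" shows "(NLINT z. indicator K z * ennreal (cmod (U k z))) < \<infinity>"
proof -
  have [measurable]: "K \<in> sets borel" using K(1) by (rule borel_compact)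
  have "(NLINT z. indicator K z * ennreal (cmod (U k z))) \<le> (NLINT z. indicator K z + indicator K z * ennreal (cmod (U k z) ^ 4))"
  proof (rule nn_integral_mono)
    fix z
    have "cmod (U k z) \<le> 1 + cmod (U k z) ^ 4"
    proof (cases "cmod (U k z) \<le> 1")
      case False
      then have "cmod (U k z) ^ 1 \<le> cmod (U k z) ^ 4" by (intro power_increasing) auto
      then show ?thesis by simp
    qed (simp add: add_increasing2)
    then have "ennreal (cmod (U k z)) \<le> ennreal (1 + cmod (U k z) ^ 4)" by (rule ennreal_leI)
    also have "\<dots> = 1 + ennreal (cmod (U k z) ^ 4)" by (subst ennreal_plus) auto
    finally have "ennreal (cmod (U k z)) \<le> 1 + ennreal (cmod (U k z) ^ 4)" .
    then show "indicator K z * ennreal (cmod (U k z)) \<le> indicator K z + indicator K z * ennreal (cmod (U k z) ^ 4)"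
      by (auto split: split_indicator)
  qed
  also have "\<dots> = emeasure lborel K + (NLINT z. indicator K z * ennreal (cmod (U k z) ^ 4))"
    by (subst nn_integral_add) simp_all
  also have "\<dots> < \<infinity>" using U4[OF K] emeasure_bounded_finite[OF compact_imp_bounded[OF K(1)]] by simp
  finally show ?thesis .
qed

lemma integrable_U: assumes K: "compact K" "K \<subseteq> \<Omega>" shows "integrable lborel (\<lambda>z. indicator K z *\<^sub>R U k z)"
proof (rule integrableI_bounded)
  have [measurable]: "K \<in> sets borel" using K(1) by (rule borel_compact)
  show "(\<lambda>z. indicator K z *\<^sub>R U k z) \<in> borel_measurable lborel" by measurable
  have "(NLINT z. ennreal (norm (indicator K z *\<^sub>R U k z))) = (NLINT z. indicator K z * ennreal (cmod (U k z)))"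
    by (intro nn_integral_cong) (auto split: split_indicator)
  then show "(NLINT z. ennreal (norm (indicator K z *\<^sub>R U k z))) < \<infinity>" using U_integral_finite[OF K] by simp
qed

end

text \<open>The bound on \<open>r\<close> puts the image of the bidisc \<open>|w| \<le> r\<close>, \<open>|s| \<le> S\<close> under the chart into the ball of radius \<open>R\<close>.\<close>

locale dbar_system_at = dbar_system +
  fixes z0 :: "complex ^ 2" and R S r :: real
  assumes R: "cball z0 R \<subseteq> \<Omega>" and decay: "\<And>k. decays_fast (U k) z0"
    and S: "0 < S" and r: "0 < r" and rS: "r * sqrt (1 + S\<^sup>2) \<le> R"
begin

abbreviation D where "D \<equiv> cball (0::complex) r \<times> cball (0::complex) S"

lemma slice_in_cball: "p \<in> D \<Longrightarrow> slice z0 p \<in> cball z0 R"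
proof -
  assume p: "p \<in> D"
  obtain w s where ws: "p = (w, s)" by (cases p)
  have "norm (slice z0 (w, s) - z0) \<le> r * sqrt (1 + S\<^sup>2)"
    unfolding norm_slice using p ws r S by (intro mult_mono real_sqrt_le_mono add_left_mono power_mono) auto
  then show ?thesis using rS ws by (simp add: dist_norm norm_minus_commute)
qed

lemma slice_image: "slice z0 ` D \<subseteq> \<Omega>"
  using slice_in_cball R by blast

lemma weighted_integral:
  "(NLINT z. indicator (cball z0 R) z * ennreal (V z * cmod (U k z) / norm (z - z0) ^ M)) < \<infinity>"
proof -
  have K: "compact (cball z0 R)" by simp
  have "(NLINT z. indicator (cball z0 R) z * ennreal (V z * cmod (U k z) / norm (z - z0) ^ M))
    \<le> (NLINT z. (indicator (cball z0 R) z * ennreal (V z ^ 4) + indicator (cball z0 R) z * ennreal (cmod (U k z) ^ 4))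
        + indicator (cball z0 R) z * ennreal (cmod (U k z) / norm (z - z0) ^ (M * 4)))"
  proof (rule nn_integral_mono)
    fix z
    have "V z * cmod (U k z) * (1 / norm (z - z0) ^ M) \<le> V z ^ 4 + cmod (U k z) ^ 4 + cmod (U k z) * (1 / norm (z - z0) ^ M) ^ 4"
      by (rule potential_weight_le[OF V1]) auto
    then have "ennreal (V z * cmod (U k z) / norm (z - z0) ^ M) \<le> ennreal (V z ^ 4 + cmod (U k z) ^ 4 + cmod (U k z) / norm (z - z0) ^ (M * 4))"
      by (intro ennreal_leI) (simp add: power_divide power_mult)
    also have "\<dots> = (ennreal (V z ^ 4) + ennreal (cmod (U k z) ^ 4)) + ennreal (cmod (U k z) / norm (z - z0) ^ (M * 4))"
      using V1[of z] by (subst ennreal_plus; (subst ennreal_plus)?) auto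
    finally show "indicator (cball z0 R) z * ennreal (V z * cmod (U k z) / norm (z - z0) ^ M) \<le>
       (indicator (cball z0 R) z * ennreal (V z ^ 4) + indicator (cball z0 R) z * ennreal (cmod (U k z) ^ 4))
        + indicator (cball z0 R) z * ennreal (cmod (U k z) / norm (z - z0) ^ (M * 4))"
      by (auto split: split_indicator)
  qed
  also have "\<dots> = ((NLINT z. indicator (cball z0 R) z * ennreal (V z ^ 4)) + (NLINT z. indicator (cball z0 R) z * ennreal (cmod (U k z) ^ 4)))
      + (NLINT z. indicator (cball z0 R) z * ennreal (cmod (U k z) / norm (z - z0) ^ (M * 4)))"
  proof -
    have m: "(\<lambda>z. indicator (cball z0 R) z * ennreal (V z ^ 4)) \<in> borel_measurable lborel"
      "(\<lambda>z. indicator (cball z0 R) z * ennreal (cmod (U k z) ^ 4)) \<in> borel_measurable lborel"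
      "(\<lambda>z. indicator (cball z0 R) z * ennreal (cmod (U k z) / norm (z - z0) ^ (M * 4))) \<in> borel_measurable lborel"
      by measurable
    show ?thesis using nn_integral_add[OF borel_measurable_add[OF m(1,2)] m(3)] nn_integral_add[OF m(1,2)] by simp
  qed
  also have "\<dots> < \<infinity>"
    using V4[OF K R] U4[OF K R] decays_fast_weighted_integral[OF Um decay U_integral_finite[OF K R]] by simp
  finally show ?thesis .
qed

definition Vs where "Vs p = (1 + S) * V (slice z0 p)"
definition Us where "Us k p = U k (slice z0 p)"
definition Gs where "Gs k p = G 1 k (slice z0 p) + cnj (snd p) * G 2 k (slice z0 p)"

lemma measurable_slices [measurable]:
  "Vs \<in> borel_measurable borel" "Us k \<in> borel_measurable borel" "Gs k \<in> borel_measurable borel"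
proof -
  have "Vs \<in> borel_measurable lborel" "Us k \<in> borel_measurable lborel" "Gs k \<in> borel_measurable lborel"
    unfolding Vs_def[abs_def] Us_def[abs_def] Gs_def[abs_def] by measurable
  then show "Vs \<in> borel_measurable borel" "Us k \<in> borel_measurable borel" "Gs k \<in> borel_measurable borel" by simp_all
qed

lemma Vs1: "1 \<le> Vs p"
  unfolding Vs_def using mult_mono[of 1 "1 + S" 1 "V (slice z0 p)"] V1 S by auto

lemma slice_weighted_integral:
  "(NLINT p. indicator D p * ennreal (Vs p * cmod (Us k p) / cmod (fst p) ^ M)) < \<infinity>"
proof -
  let ?C = "(1 + S) * (1 + S) ^ (M + 2)"
  let ?h = "\<lambda>z. ennreal ?C * (indicator (cball z0 R) z * ennreal (V z * cmod (U k z) / norm (z - z0) ^ (M + 2)))"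
  have hm: "?h \<in> borel_measurable borel"
  proof -
    have "?h \<in> borel_measurable lborel" by measurable
    then show ?thesis by simp
  qed
  have "(NLINT p. indicator D p * ennreal (Vs p * cmod (Us k p) / cmod (fst p) ^ M)) \<le> (NLINT p. ennreal ((cmod (fst p))\<^sup>2) * ?h (slice z0 p))"
  proof (rule nn_integral_mono_AE, use AE_fst_nonzero in eventually_elim)
    fix p :: "complex \<times> complex" assume nz: "fst p \<noteq> 0"
    obtain w s where ws: "p = (w, s)" by (cases p)
    show "indicator D p * ennreal (Vs p * cmod (Us k p) / cmod (fst p) ^ M) \<le> ennreal ((cmod (fst p))\<^sup>2) * ?h (slice z0 p)"
    proof (cases "p \<in> D")
      case True
      have w: "w \<noteq> 0" and s: "cmod s \<le> S" using nz True ws by auto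
      let ?n = "norm (slice z0 p - z0)"
      have "sqrt (1 + (cmod s)\<^sup>2) \<le> 1 + S"
      proof -
        have "1 + (cmod s)\<^sup>2 \<le> 1 + S\<^sup>2" using s S by (simp add: power_mono)
        also have "\<dots> \<le> (1 + S)\<^sup>2" using S by (simp add: power2_sum)
        finally show ?thesis using S by (simp add: real_le_lsqrt)
      qed
      then have "?n \<le> cmod w * (1 + S)" unfolding ws norm_slice by (intro mult_left_mono) auto
      then have n2: "?n ^ (M + 2) \<le> (cmod w * (1 + S)) ^ (M + 2)" by (intro power_mono) auto
      have n0: "0 < ?n" unfolding ws norm_slice using w by (simp add: add_pos_nonneg)
      have "1 / cmod w ^ M = (cmod w)\<^sup>2 * ((1 + S) ^ (M + 2) / (cmod w * (1 + S)) ^ (M + 2))"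
        using w S by (simp add: power_mult_distrib power2_eq_square)
      also have "\<dots> \<le> (cmod w)\<^sup>2 * ((1 + S) ^ (M + 2) / ?n ^ (M + 2))"
        using n2 n0 S w by (intro mult_left_mono divide_left_mono mult_pos_pos zero_less_power) auto
      finally have "Vs p * cmod (Us k p) * (1 / cmod w ^ M) \<le> Vs p * cmod (Us k p) * ((cmod w)\<^sup>2 * ((1 + S) ^ (M + 2) / ?n ^ (M + 2)))"
        using Vs1[of p] by (intro mult_left_mono) auto
      also have "\<dots> = (cmod w)\<^sup>2 * (?C * (V (slice z0 p) * cmod (U k (slice z0 p)) / ?n ^ (M + 2)))"
        by (simp add: Vs_def Us_def)
      finally have "ennreal (Vs p * cmod (Us k p) / cmod w ^ M) \<le> ennreal ((cmod w)\<^sup>2 * (?C * (V (slice z0 p) * cmod (U k (slice z0 p)) / ?n ^ (M + 2))))"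
        by (intro ennreal_leI) simp
      also have "\<dots> = ennreal ((cmod w)\<^sup>2) * (ennreal ?C * ennreal (V (slice z0 p) * cmod (U k (slice z0 p)) / ?n ^ (M + 2)))"
        using S V1[of "slice z0 p"] by (subst ennreal_mult, simp, simp, subst ennreal_mult) auto
      finally show ?thesis using True slice_in_cball[OF True] ws by simp
    qed simp
  qed
  also have "\<dots> = (NLINT z. ?h z)" by (rule nn_integral_slice[OF hm, symmetric])
  also have "\<dots> = ennreal ?C * (NLINT z. indicator (cball z0 R) z * ennreal (V z * cmod (U k z) / norm (z - z0) ^ (M + 2)))"
    by (rule nn_integral_cmult) measurable
  also have "\<dots> < \<infinity>" using weighted_integral[of k "M + 2"]
    unfolding infinity_ennreal_def ennreal_mult_less_top by (metis ennreal_less_top)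
  finally show ?thesis .
qed

lemma slice_potential_integral:
  "(NLINT p. indicator D p * ennreal ((cmod (fst p))\<^sup>2 * Vs p ^ 4)) < \<infinity>"
proof -
  let ?h = "\<lambda>z. ennreal ((1 + S) ^ 4) * (indicator (cball z0 R) z * ennreal (V z ^ 4))"
  have hm: "?h \<in> borel_measurable borel"
  proof -
    have "?h \<in> borel_measurable lborel" by measurable
    then show ?thesis by simp
  qed
  have "(NLINT p. indicator D p * ennreal ((cmod (fst p))\<^sup>2 * Vs p ^ 4)) \<le> (NLINT p. ennreal ((cmod (fst p))\<^sup>2) * ?h (slice z0 p))"
  proof (rule nn_integral_mono)
    fix p
    show "indicator D p * ennreal ((cmod (fst p))\<^sup>2 * Vs p ^ 4) \<le> ennreal ((cmod (fst p))\<^sup>2) * ?h (slice z0 p)"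
    proof (cases "p \<in> D")
      case True
      have "ennreal ((cmod (fst p))\<^sup>2 * Vs p ^ 4) = ennreal ((cmod (fst p))\<^sup>2) * (ennreal ((1 + S) ^ 4) * ennreal (V (slice z0 p) ^ 4))"
        using S V1[of "slice z0 p"] by (simp add: Vs_def power_mult_distrib ennreal_mult)
      then show ?thesis using slice_in_cball[OF True] True by simp
    qed simp
  qed
  also have "\<dots> = (NLINT z. ?h z)" by (rule nn_integral_slice[OF hm, symmetric])
  also have "\<dots> = ennreal ((1 + S) ^ 4) * (NLINT z. indicator (cball z0 R) z * ennreal (V z ^ 4))"
    by (rule nn_integral_cmult) measurable
  also have "\<dots> < \<infinity>" using V4[OF compact_cball R] by (simp add: ennreal_mult_less_top)
  finally show ?thesis .
qed

lemma slice_dominated: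
  "AE p in lborel. p \<in> D \<longrightarrow> (\<forall>k. cmod (Gs k p) \<le> Vs p * (\<Sum>l\<in>UNIV. cmod (Us l p)))"
  using AE_slice[OF dom, of z0]
proof eventually_elim
  case (elim p)
  show ?case
  proof (intro impI allI)
    fix k assume p: "p \<in> D"
    let ?X = "V (slice z0 p) * (\<Sum>l\<in>UNIV. cmod (Us l p))"
    have e: "cmod (G j k (slice z0 p)) \<le> ?X" for j
      using elim slice_in_cball[OF p] R unfolding Us_def by blast
    have "cmod (Gs k p) \<le> ?X + S * ?X" unfolding Gs_def
      using p S e[of 1] e[of 2] by (intro order_trans[OF norm_triangle_ineq] add_mono) (auto simp: norm_mult mem_Times_iff intro!: mult_mono)
    then show "cmod (Gs k p) \<le> Vs p * (\<Sum>l\<in>UNIV. cmod (Us l p))" by (simp add: Vs_def algebra_simps)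
  qed
qed

lemma integrable_from_dominated:
  assumes [measurable]: "f \<in> borel_measurable borel"
    and b: "AE p in lborel. p \<in> D \<longrightarrow> cmod (f p) \<le> Vs p * (\<Sum>l\<in>UNIV. cmod (Us l p))"
  shows "integrable lborel (\<lambda>p. indicator D p *\<^sub>R (f p / fst p ^ M))"
proof (rule integrableI_bounded)
  show "(\<lambda>p. indicator D p *\<^sub>R (f p / fst p ^ M)) \<in> borel_measurable lborel"
  proof -
    have [measurable]: "D \<in> sets borel" by (intro borel_closed closed_Times) auto
    show ?thesis by measurable
  qed
  have [measurable]: "D \<in> sets borel" by (intro borel_closed closed_Times) auto
  have "(NLINT p. ennreal (norm (indicator D p *\<^sub>R (f p / fst p ^ M))))
     \<le> (NLINT p. (\<Sum>l\<in>UNIV. indicator D p * ennreal (Vs p * cmod (Us l p) / cmod (fst p) ^ M)))"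
  proof (rule nn_integral_mono_AE, use b in eventually_elim)
    case (elim p)
    show ?case
    proof (cases "p \<in> D")
      case True
      have "cmod (f p) / cmod (fst p) ^ M \<le> (\<Sum>l\<in>UNIV. Vs p * cmod (Us l p) / cmod (fst p) ^ M)"
        using elim True by (simp add: sum_distrib_left sum_divide_distrib[symmetric] divide_right_mono)
      then have "ennreal (cmod (f p) / cmod (fst p) ^ M) \<le> ennreal (\<Sum>l\<in>UNIV. Vs p * cmod (Us l p) / cmod (fst p) ^ M)"
        by (rule ennreal_leI)
      also have "\<dots> = (\<Sum>l\<in>UNIV. ennreal (Vs p * cmod (Us l p) / cmod (fst p) ^ M))"
        using Vs1[of p] by (intro sum_ennreal[symmetric]) auto
      finally show ?thesis using True by (simp add: norm_divide norm_power)
    qed simp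
  qed
  also have "\<dots> = (\<Sum>l\<in>UNIV. NLINT p. indicator D p * ennreal (Vs p * cmod (Us l p) / cmod (fst p) ^ M))"
    by (rule nn_integral_sum) measurable
  also have "\<dots> < \<infinity>" using slice_weighted_integral by simp
  finally show "(NLINT p. ennreal (norm (indicator D p *\<^sub>R (f p / fst p ^ M)))) < \<infinity>" .
qed

lemma slice_data: "slice_data (Us k) (Gs k) r S"
proof
  show "integrable lborel (\<lambda>p. indicator D p *\<^sub>R (Us k p / fst p ^ M))" for M
  proof (rule integrable_from_dominated)
    have "cmod (Us k p) \<le> Vs p * (\<Sum>l\<in>UNIV. cmod (Us l p))" for p
    proof -
      have "1 * cmod (Us k p) \<le> Vs p * (\<Sum>l\<in>UNIV. cmod (Us l p))"
        using Vs1[of p] by (intro mult_mono member_le_sum) auto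
      then show ?thesis by simp
    qed
    then show "AE p in lborel. p \<in> D \<longrightarrow> cmod (Us k p) \<le> Vs p * (\<Sum>l\<in>UNIV. cmod (Us l p))" by simp
  qed measurable
  show "integrable lborel (\<lambda>p. indicator D p *\<^sub>R (Gs k p / fst p ^ M))" for M
    by (rule integrable_from_dominated) (measurable, use slice_dominated in eventually_elim, blast)
  fix \<alpha> \<beta> :: "complex \<Rightarrow> complex" and a :: real
  assume t: "smooth \<alpha>" "smooth \<beta>" "0 < a" "\<And>w. cmod w \<le> a \<Longrightarrow> \<alpha> w = 0"
      "\<And>w. r < cmod w \<Longrightarrow> \<alpha> w = 0" "\<And>s. S < cmod s \<Longrightarrow> \<beta> s = 0"
  show "(LBINT p. Us k p * (cdbar \<alpha> (fst p) * \<beta> (snd p))) = - (LBINT p. Gs k p * (\<alpha> (fst p) * \<beta> (snd p)))"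
    unfolding Us_def Gs_def
    by (rule weak_equation_slice[OF Um Gm weak integrable_U G1 t slice_image])
qed (use r S in \<open>auto intro: measurable_slices\<close>)

lemma AE_slices_finite:
  assumes f: "f \<in> borel_measurable borel"
    and fin: "(NLINT p. indicator D p * ennreal (f p)) < \<infinity>"
  shows "AE s in lborel. cmod s < S \<longrightarrow> (NLINT w. indicator (ball 0 r) w * ennreal (f (w, s))) < \<infinity>"
proof -
  have [measurable]: "D \<in> sets borel" by (intro borel_closed closed_Times) auto
  note [measurable] = f
  have "(\<lambda>p. indicator D p * ennreal (f p)) \<in> borel_measurable lborel" by measurable
  then have m: "(\<lambda>p. indicator D p * ennreal (f p)) \<in> borel_measurable (lborel \<Otimes>\<^sub>M lborel)" by (simp add: lborel_prod)
  have "(NLINT s. (NLINT w. indicator D (w, s) * ennreal (f (w, s)))) = (NLINT p. indicator D p * ennreal (f p))"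
    using lborel_pair.nn_integral_snd[OF m] by (simp add: lborel_prod)
  then have "AE s in lborel. (NLINT w. indicator D (w, s) * ennreal (f (w, s))) \<noteq> \<infinity>"
    using fin by (intro nn_integral_PInf_AE lborel.borel_measurable_nn_integral
        measurable_compose[OF measurable_pair_swap' m, simplified]) (auto simp: case_prod_unfold)
  then show ?thesis
  proof eventually_elim
    case (elim s)
    have "(NLINT w. indicator (ball 0 r) w * ennreal (f (w, s))) \<le> (NLINT w. indicator D (w, s) * ennreal (f (w, s)))" if "cmod s < S"
      using that by (intro nn_integral_mono) (auto split: split_indicator)
    then show ?case using elim by (auto simp: less_top top_unique)
  qed
qed

text \<open>By Tonelli's theorem the integral bounds on the bidisc hold on almost every line, and the Cauchy bound
holds there for the countably many weights, components and rational radii.\<close>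

lemma vanishing_on_slices: "AE s in lborel. cmod s < S \<longrightarrow> (AE w in lborel. cmod w < r \<longrightarrow> (\<forall>k. Us k (w, s) = 0))"
proof -
  have 1: "AE s in lborel. AE w in lborel. (w, s) \<in> D \<longrightarrow> (\<forall>k. cmod (Gs k (w, s)) \<le> Vs (w, s) * (\<Sum>l\<in>UNIV. cmod (Us l (w, s))))"
  proof -
    have [measurable]: "D \<in> sets borel" by (intro borel_closed closed_Times) auto
    have "Measurable.pred lborel (\<lambda>p. p \<in> D \<longrightarrow> (\<forall>k. cmod (Gs k p) \<le> Vs p * (\<Sum>l\<in>UNIV. cmod (Us l p))))"
      by measurable
    then have m: "{p \<in> space (lborel \<Otimes>\<^sub>M lborel). p \<in> D \<longrightarrow> (\<forall>k. cmod (Gs k p) \<le> Vs p * (\<Sum>l\<in>UNIV. cmod (Us l p)))} \<in> sets (lborel \<Otimes>\<^sub>M lborel)"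
      unfolding lborel_prod by (simp only: pred_def)
    have "AE w in lborel. AE s in lborel. (w, s) \<in> D \<longrightarrow> (\<forall>k. cmod (Gs k (w, s)) \<le> Vs (w, s) * (\<Sum>l\<in>UNIV. cmod (Us l (w, s))))"
      using slice_dominated unfolding lborel_prod[symmetric] by (rule lborel_pair.AE_pair)
    then show ?thesis
      by (subst (asm) lborel_pair.AE_commute) (use m in auto)
  qed
  have 2: "AE s in lborel. cmod s < S \<longrightarrow> (NLINT w. indicator (ball 0 r) w * ennreal ((cmod w)\<^sup>2 * Vs (w, s) ^ 4)) < \<infinity>"
  proof -
    have "(\<lambda>p. (cmod (fst p))\<^sup>2 * Vs p ^ 4) \<in> borel_measurable lborel" by measurable
    then show ?thesis using AE_slices_finite[OF _ slice_potential_integral] by simp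
  qed
  have 3: "AE s in lborel. \<forall>M. \<forall>k. cmod s < S \<longrightarrow> (NLINT w. indicator (ball 0 r) w * ennreal (Vs (w, s) * cmod (Us k (w, s)) / cmod w ^ M)) < \<infinity>"
    unfolding AE_all_countable
  proof (intro allI)
    fix M k
    have "(\<lambda>p. Vs p * cmod (Us k p) / cmod (fst p) ^ M) \<in> borel_measurable lborel" by measurable
    then show "AE s in lborel. cmod s < S \<longrightarrow> (NLINT w. indicator (ball 0 r) w * ennreal (Vs (w, s) * cmod (Us k (w, s)) / cmod w ^ M)) < \<infinity>"
      using AE_slices_finite[OF _ slice_weighted_integral] by simp
  qed
  define P where "P m k r1 r2 s \<longleftrightarrow> (AE q in lborel. ennreal (cauchy_const * cmod (disc_cutoff r1 r2 q * Us k (q, s) / q ^ m))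
         \<le> (NLINT w. ennreal (cmod ((disc_cutoff r1 r2 w * Gs k (w, s) + cdbar (disc_cutoff r1 r2) w * Us k (w, s)) / w ^ m) / cmod (w - q))))"
    for m k r1 r2 s
  have 4: "AE s in lborel. \<forall>r1\<in>\<rat>. \<forall>r2\<in>\<rat>. \<forall>m. \<forall>k\<in>UNIV. 0 < r1 \<and> r1 < r2 \<and> r2 < r \<and> cmod s < S \<longrightarrow> P m k r1 r2 s"
  proof (intro AE_ball_countable[OF countable_rat, THEN iffD2] ballI AE_all_countable[THEN iffD2] allI AE_finite_allI[OF finite])
    fix r1 r2 :: real and m k
    show "AE s in lborel. 0 < r1 \<and> r1 < r2 \<and> r2 < r \<and> cmod s < S \<longrightarrow> P m k r1 r2 s"
    proof (cases "0 < r1 \<and> r1 < r2 \<and> r2 < r")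
      case True
      have "AE s in lborel. cmod s < S \<longrightarrow> P m k r1 r2 s" unfolding P_def
        by (rule slice_data.slice_cauchy_bound[OF slice_data]) (use True disc_cutoff[of r1 r2] in auto)
      then show ?thesis by eventually_elim auto
    qed auto
  qed
  from 1 2 3 4 show ?thesis
  proof eventually_elim
    case (elim s)
    show ?case
    proof
      assume s: "cmod s < S"
      have pm: "(\<lambda>w. (w, s)) \<in> borel \<rightarrow>\<^sub>M borel" by (intro borel_measurable_continuous_onI continuous_intros)
      interpret planar_slice "\<lambda>k w. Us k (w, s)" "\<lambda>k w. Gs k (w, s)" "\<lambda>w. Vs (w, s)" r
      proof
        show "(\<lambda>w. Us k (w, s)) \<in> borel_measurable borel" "(\<lambda>w. Gs k (w, s)) \<in> borel_measurable borel" "(\<lambda>w. Vs (w, s)) \<in> borel_measurable borel" for k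
          by (rule measurable_compose[OF pm], rule measurable_slices)+
        show "1 \<le> Vs (w, s)" for w by (rule Vs1)
        show "AE w in lborel. cmod w < r \<longrightarrow> (\<forall>k. cmod (Gs k (w, s)) \<le> Vs (w, s) * (\<Sum>l\<in>UNIV. cmod (Us l (w, s))))"
          using elim(1) by eventually_elim (use s in auto)
      qed (use elim(2,3,4) s in \<open>auto simp: P_def\<close>)
      show "AE w in lborel. cmod w < r \<longrightarrow> (\<forall>k. Us k (w, s) = 0)" by (rule planar_vanishing[OF r])
    qed
  qed
qed

end

context dbar_system
begin

text \<open>A point of the ball off the vertical line satisfies \<open>|w| * sqrt (1 + |s|\<^sup>2) < R\<close>, and the strict inequality
survives when \<open>|s|\<close> is replaced by a slightly larger rational \<open>S\<close>. So the ball is covered, up to a null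
set, by the countably many sets \<open>|w| < R / sqrt (1 + S\<^sup>2)\<close>, \<open>|s| < S\<close>.\<close>

lemma vanishing_on_ball:
  assumes R: "cball z0 R \<subseteq> \<Omega>" "0 < R" and decay: "\<And>k. decays_fast (U k) z0"
  shows "AE z in lborel. z \<in> ball z0 R \<longrightarrow> (\<forall>k. U k z = 0)"
proof -
  have sec: "AE p in lborel. cmod (fst p) < R / sqrt (1 + S\<^sup>2) \<and> cmod (snd p) < S \<longrightarrow> (\<forall>k. U k (slice z0 p) = 0)"
    if S: "0 < S" for S
  proof -
    define r where "r = R / sqrt (1 + S\<^sup>2)"
    have sq: "0 < sqrt (1 + S\<^sup>2)" by (simp add: add_pos_nonneg)
    interpret dbar_system_at \<Omega> U G V z0 R S r
      by unfold_locales (use assms S sq in \<open>auto simp: r_def\<close>)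
    define P where "P p \<longleftrightarrow> (cmod (fst p) < r \<and> cmod (snd p) < S \<longrightarrow> (\<forall>k. Us k p = 0))" for p
    have "Measurable.pred lborel P" unfolding P_def[abs_def] by measurable
    then have m: "{p \<in> space (lborel \<Otimes>\<^sub>M lborel). P p} \<in> sets (lborel \<Otimes>\<^sub>M lborel)"
      unfolding lborel_prod by (simp only: pred_def)
    have sw: "AE s in lborel. AE w in lborel. P (w, s)"
      using vanishing_on_slices
    proof eventually_elim
      case (elim s)
      show ?case
      proof (cases "cmod s < S")
        case True
        then have "AE w in lborel. cmod w < r \<longrightarrow> (\<forall>k. Us k (w, s) = 0)" using elim by blast
        then show ?thesis by eventually_elim (simp add: P_def)
      qed (simp add: P_def)
    qed
    have m': "{p \<in> space (lborel \<Otimes>\<^sub>M lborel). P (fst p, snd p)} \<in> sets (lborel \<Otimes>\<^sub>M lborel)"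
      using m by (simp only: prod.collapse)
    have "AE w in lborel. AE s in lborel. P (w, s)"
      by (rule lborel_pair.AE_commute[where P = "\<lambda>w s. P (w, s)", OF m', THEN iffD2, OF sw])
    then have "AE p in lborel \<Otimes>\<^sub>M lborel. P p" by (rule lborel_pair.AE_pair_measure[OF m])
    then have "AE p in lborel. P p" by (simp only: lborel_prod)
    then show ?thesis by (simp add: P_def Us_def r_def)
  qed
  have "AE p in lborel. \<forall>S\<in>\<rat>. 0 < S \<longrightarrow> cmod (fst p) < R / sqrt (1 + S\<^sup>2) \<and> cmod (snd p) < S \<longrightarrow> (\<forall>k. U k (slice z0 p) = 0)"
  proof (intro AE_ball_countable[OF countable_rat, THEN iffD2] ballI)
    fix S :: real
    show "AE p in lborel. 0 < S \<longrightarrow> cmod (fst p) < R / sqrt (1 + S\<^sup>2) \<and> cmod (snd p) < S \<longrightarrow> (\<forall>k. U k (slice z0 p) = 0)"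
      using sec[of S] by (cases "0 < S") auto
  qed
  then have "AE p in lborel. slice z0 p \<in> ball z0 R \<longrightarrow> (\<forall>k. U k (slice z0 p) = 0)"
    using AE_fst_nonzero
  proof eventually_elim
    case (elim p)
    show ?case
    proof
      assume b: "slice z0 p \<in> ball z0 R"
      obtain w s where ws: "p = (w, s)" by (cases p)
      have w: "0 < cmod w" using elim(2) ws by simp
      have "cmod w * sqrt (1 + (cmod s)\<^sup>2) < R"
        using b norm_slice[of z0 w s] by (simp add: ws dist_norm norm_minus_commute)
      then have "sqrt (1 + (cmod s)\<^sup>2) < R / cmod w" using w by (simp add: field_simps)
      then have lt: "1 + (cmod s)\<^sup>2 < (R / cmod w)\<^sup>2" using w R(2)
        by (metis divide_pos_pos less_imp_le real_sqrt_less_iff real_sqrt_abs abs_of_pos)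
      (* the modulus of the slope for which cmod w * sqrt (1 + T^2) = R *)
      define T where "T = sqrt ((R / cmod w)\<^sup>2 - 1)"
      have "cmod s < T" unfolding T_def using lt by (intro real_less_rsqrt) simp
      then obtain S where S: "S \<in> \<rat>" "cmod s < S" "S < T" using Rats_dense_in_real by blast
      have S0: "0 < S" using S(2) norm_ge_zero[of s] by linarith
      have "S\<^sup>2 < T\<^sup>2" using S(3) S0 by (intro power_strict_mono) auto
      also have "T\<^sup>2 = (R / cmod w)\<^sup>2 - 1" unfolding T_def using lt zero_le_power2[of "cmod s"] by (intro real_sqrt_pow2) linarith
      finally have "sqrt (1 + S\<^sup>2) < R / cmod w" using w R(2) by (intro real_less_lsqrt) auto
      then have "cmod w < R / sqrt (1 + S\<^sup>2)" using w by (simp add: field_simps add_pos_nonneg)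
      then show "\<forall>k. U k (slice z0 p) = 0" using elim(1) S S0 ws by auto
    qed
  qed
  moreover have "Measurable.pred borel (\<lambda>z. z \<in> ball z0 R \<longrightarrow> (\<forall>k. U k z = 0))" by measurable
  ultimately show ?thesis using AE_slice_iff[of "\<lambda>z. z \<in> ball z0 R \<longrightarrow> (\<forall>k. U k z = 0)" z0] by blast
qed

lemma decays_fast_if_zero_near:
  assumes "0 < e" "AE z in lborel. z \<in> ball z0 e \<longrightarrow> U k z = 0"
  shows "decays_fast (U k) z0"
  unfolding decays_fast_def
proof (intro allI exI[of _ e] conjI impI \<open>0 < e\<close>)
  fix m r assume r: "0 < r \<and> r < e"
  have "AE z in lborel. indicator (ball z0 r) z * ennreal (cmod (U k z)) = 0"
    using assms(2) by eventually_elim (use r in \<open>auto split: split_indicator\<close>)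
  then have "(NLINT z. indicator (ball z0 r) z * ennreal (cmod (U k z))) = 0"
    by (subst nn_integral_0_iff_AE) auto
  then show "(NLINT z. indicator (ball z0 r) z * ennreal (cmod (U k z))) \<le> ennreal (r ^ m)" by simp
qed

text \<open>The radius in \<open>vanishing_on_ball\<close> depends only on the distance to the boundary. A point of \<open>\<Omega>\<close> that is close
to a point near which \<open>U\<close> vanishes therefore lies in a ball about the latter on which \<open>U\<close> vanishes, and
the set of all points near which \<open>U\<close> vanishes is closed in \<open>\<Omega>\<close>.\<close>

theorem unique_continuation:
  assumes op: "open \<Omega>" and con: "connected \<Omega>" and z0: "z0 \<in> \<Omega>" and decay: "\<And>k. decays_fast (U k) z0"
  shows "AE z in lborel. z \<in> \<Omega> \<longrightarrow> (\<forall>k. U k z = 0)"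
proof -
  (* openness of Z is immediate; balls of uniform size, from vanishing_on_ball, make it closed in the domain *)
  define Z where "Z = {z \<in> \<Omega>. \<exists>e>0. ball z e \<subseteq> \<Omega> \<and> (AE y in lborel. y \<in> ball z e \<longrightarrow> (\<forall>k. U k y = 0))}"
  have oZ: "open Z"
  unfolding open_contains_ball
  proof
    fix z assume "z \<in> Z"
    then obtain e where e: "e > 0" "ball z e \<subseteq> \<Omega>" "AE y in lborel. y \<in> ball z e \<longrightarrow> (\<forall>k. U k y = 0)"
      by (auto simp: Z_def)
    have "ball z (e / 2) \<subseteq> Z"
    proof
      fix y assume y: "y \<in> ball z (e / 2)"
      have sub: "ball y (e / 2) \<subseteq> ball z e" using y by (intro ball_subset_ball_iff[THEN iffD2] disjI1) (simp add: dist_commute)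
      have "AE x in lborel. x \<in> ball y (e / 2) \<longrightarrow> (\<forall>k. U k x = 0)" using e(3) by eventually_elim (use sub in auto)
      moreover have "y \<in> \<Omega>" "ball y (e / 2) \<subseteq> \<Omega>" using y e sub by auto
      ultimately show "y \<in> Z" using e(1) unfolding Z_def by (auto intro!: exI[of _ "e / 2"])
    qed
    then show "\<exists>e>0. ball z e \<subseteq> Z" using e(1) by (intro exI[of _ "e / 2"]) auto
  qed
  have oC: "open (\<Omega> - Z)"
  unfolding open_contains_ball
  proof
    fix z assume z: "z \<in> \<Omega> - Z"
    then obtain e where e: "e > 0" "ball z e \<subseteq> \<Omega>" using op open_contains_ball by blast
    have "ball z (e / 4) \<inter> Z = {}"
    proof (rule ccontr)
      assume "ball z (e / 4) \<inter> Z \<noteq> {}"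
      then obtain y where y: "y \<in> ball z (e / 4)" "y \<in> Z" by blast
      then obtain d where d: "d > 0" "AE x in lborel. x \<in> ball y d \<longrightarrow> (\<forall>k. U k x = 0)" by (auto simp: Z_def)
      have dec: "decays_fast (U k) y" for k
        by (rule decays_fast_if_zero_near[OF d(1)]) (use d(2) in eventually_elim, blast)
      have "cball y (e / 2) \<subseteq> ball z e"
      proof
        fix x assume "x \<in> cball y (e / 2)"
        then show "x \<in> ball z e" using y(1) e(1) dist_triangle[of z x y] by auto
      qed
      then have "AE x in lborel. x \<in> ball y (e / 2) \<longrightarrow> (\<forall>k. U k x = 0)"
        using e by (intro vanishing_on_ball dec) auto
      then have "AE x in lborel. x \<in> ball z (e / 4) \<longrightarrow> (\<forall>k. U k x = 0)"
      proof eventually_elim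
        case (elim x)
        have "x \<in> ball y (e / 2)" if "x \<in> ball z (e / 4)"
          using that y(1) dist_triangle[of y x z] by (auto simp: dist_commute)
        then show ?case using elim by blast
      qed
      moreover have "ball z (e / 4) \<subseteq> \<Omega>" using e subset_ball[of "e / 4" e z] by auto
      ultimately have "z \<in> Z" using z e(1) unfolding Z_def by (auto intro!: exI[of _ "e / 4"])
      then show False using z by blast
    qed
    moreover have "ball z (e / 4) \<subseteq> \<Omega>" using e subset_ball[of "e / 4" e z] by auto
    ultimately show "\<exists>e>0. ball z e \<subseteq> \<Omega> - Z" using e(1) by (intro exI[of _ "e / 4"]) auto
  qed
  have "z0 \<in> Z"
  proof -
    obtain R where R: "R > 0" "cball z0 R \<subseteq> \<Omega>" using op z0 open_contains_cball by blast
    have "AE z in lborel. z \<in> ball z0 R \<longrightarrow> (\<forall>k. U k z = 0)" using R decay by (intro vanishing_on_ball)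
    moreover have "ball z0 R \<subseteq> \<Omega>" using R ball_subset_cball by blast
    ultimately show ?thesis using z0 R(1) by (auto simp: Z_def intro!: exI[of _ R])
  qed
  have "Z \<inter> \<Omega> = {} \<or> (\<Omega> - Z) \<inter> \<Omega> = {}" by (rule connectedD[OF con oZ oC]) auto
  then have "\<Omega> \<subseteq> Z" using \<open>z0 \<in> Z\<close> z0 by blast
  then have "\<forall>z\<in>\<Omega>. \<exists>e. 0 < e \<and> (AE y in lborel. y \<in> ball z e \<longrightarrow> (\<forall>k. U k y = 0))"
    by (auto simp: Z_def)
  from bchoice[OF this] obtain e where
    e': "\<forall>z\<in>\<Omega>. 0 < e z \<and> (AE y in lborel. y \<in> ball z (e z) \<longrightarrow> (\<forall>k. U k y = 0))" ..
  have e: "0 < e z" "AE y in lborel. y \<in> ball z (e z) \<longrightarrow> (\<forall>k. U k y = 0)" if "z \<in> \<Omega>" for z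
    using bspec[OF e' that] by (rule conjunct1, rule conjunct2)
  obtain F where F: "F \<subseteq> (\<lambda>z. ball z (e z)) ` \<Omega>" "countable F" "\<Union>F = \<Union>((\<lambda>z. ball z (e z)) ` \<Omega>)"
    using Lindelof[of "(\<lambda>z. ball z (e z)) ` \<Omega>"] by auto
  have "AE y in lborel. \<forall>B\<in>F. y \<in> B \<longrightarrow> (\<forall>k. U k y = 0)"
    by (rule AE_ball_countable[OF F(2), THEN iffD2]) (use F(1) e(2) in auto)
  then show ?thesis
  proof eventually_elim
    case (elim y)
    show ?case
    proof (intro impI)
      assume y: "y \<in> \<Omega>"
      then have "y \<in> \<Union>F" unfolding F(3) using e(1)[OF y] y by (intro UN_I[of y]) auto
      then show "\<forall>k. U k y = 0" using elim by blast
    qed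
  qed
qed

end

lemma Lp_loc_nn_integral:
  fixes f :: "'a::euclidean_space \<Rightarrow> 'b::real_normed_vector" and h :: "'a \<Rightarrow> real"
  assumes f: "Lp_loc p \<Omega> f" and K: "compact K" "K \<subseteq> \<Omega>"
    and h: "AE z in lborel. z \<in> \<Omega> \<longrightarrow> h z = norm (f z)"
  shows "(NLINT z. indicator K z * ennreal (h z powr p)) < \<infinity>"
proof -
  have "integrable lebesgue (\<lambda>z. indicator K z *\<^sub>R (norm (f z) powr p))"
    using f K by (simp add: Lp_loc_def set_integrable_def)
  then have fin: "(\<integral>\<^sup>+z. ennreal (norm (indicator K z *\<^sub>R (norm (f z) powr p))) \<partial>lebesgue) < \<infinity>"
    by (simp add: integrable_iff_bounded)
  have "(NLINT z. indicator K z * ennreal (h z powr p)) = (\<integral>\<^sup>+z. indicator K z * ennreal (h z powr p) \<partial>lebesgue)"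
    by (rule nn_integral_completion[symmetric])
  also have "\<dots> = (\<integral>\<^sup>+z. ennreal (norm (indicator K z *\<^sub>R (norm (f z) powr p))) \<partial>lebesgue)"
    by (rule nn_integral_cong_AE, rule AE_completion, use h in eventually_elim) (use K(2) in \<open>auto split: split_indicator\<close>)
  finally show ?thesis using fin by simp
qed

lemma AE_lebesgue_on_iff:
  assumes "\<Omega> \<in> sets borel"
  shows "(AE z in lebesgue_on \<Omega>. P z) \<longleftrightarrow> (AE z in lborel. z \<in> \<Omega> \<longrightarrow> P z)"
  using assms by (simp add: AE_restrict_space_iff AE_completion_iff)

lemma norm_le_sum_components: "norm (x :: complex ^ 'N) \<le> (\<Sum>l\<in>UNIV. cmod (x $ l))"
  unfolding norm_vec_def by (rule L2_set_le_sum) simp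

theorem theorem1p3:
  fixes \<Omega> :: "(complex ^ 2) set"
    and u :: "complex ^ 2 \<Rightarrow> complex ^ 'N"
    and dbar_u :: "2 \<Rightarrow> 'N \<Rightarrow> complex ^ 2 \<Rightarrow> complex"
    and V :: "complex ^ 2 \<Rightarrow> real"
    and \<epsilon> :: real
    and z0 :: "complex ^ 2"
  assumes "open \<Omega>" and "connected \<Omega>" and "\<Omega> \<noteq> {}"
    and "\<epsilon> > 0"
    and "\<And>k. W1p_loc (4 + \<epsilon>) \<Omega> (\<lambda>z. u z $ k)"
    and "\<And>j k. has_weak_dbar \<Omega> j (\<lambda>z. u z $ k) (dbar_u j k)"
    and "\<And>z. z \<in> \<Omega> \<Longrightarrow> 0 \<le> V z"
    and "Lp_loc 4 \<Omega> V"
    and "AE z in lebesgue_on \<Omega>.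
           sqrt (\<Sum>j\<in>UNIV. \<Sum>k\<in>UNIV. (cmod (dbar_u j k z))\<^sup>2) \<le> V z * norm (u z)"
    and "z0 \<in> \<Omega>"
    and "vanishes_to_infinite_order 1 \<Omega> u z0"
  shows "AE z in lebesgue_on \<Omega>. u z = 0"
proof -
  have \<Omega>: "\<Omega> \<in> sets borel" using assms(1) by simp
  have um: "(\<lambda>z. u z $ k) \<in> borel_measurable (lebesgue_on \<Omega>)" and gm: "dbar_u j k \<in> borel_measurable (lebesgue_on \<Omega>)" for j k
    using assms(6) by (auto simp: has_weak_dbar_def Lp_loc_def)
  have "\<forall>k. \<exists>f'. f' \<in> borel_measurable borel \<and> (AE z in lborel. z \<in> \<Omega> \<longrightarrow> f' z = u z $ k) \<and> (\<forall>z. z \<notin> \<Omega> \<longrightarrow> f' z = 0)"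
    using borel_version_complex[OF um \<Omega>] by blast
  from choice[OF this] obtain U where U': "\<forall>k. U k \<in> borel_measurable borel \<and> (AE z in lborel. z \<in> \<Omega> \<longrightarrow> U k z = u z $ k) \<and> (\<forall>z. z \<notin> \<Omega> \<longrightarrow> U k z = 0)" ..
  have U: "U k \<in> borel_measurable borel" "AE z in lborel. z \<in> \<Omega> \<longrightarrow> U k z = u z $ k" "\<forall>z. z \<notin> \<Omega> \<longrightarrow> U k z = 0" for k
    using spec[OF U', of k] by simp_all
  have "\<forall>p. \<exists>f'. f' \<in> borel_measurable borel \<and> (AE z in lborel. z \<in> \<Omega> \<longrightarrow> f' z = dbar_u (fst p) (snd p) z) \<and> (\<forall>z. z \<notin> \<Omega> \<longrightarrow> f' z = 0)"
    using borel_version_complex[OF gm \<Omega>] by blast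
  from choice[OF this] obtain G0 where G': "\<forall>p. G0 p \<in> borel_measurable borel \<and> (AE z in lborel. z \<in> \<Omega> \<longrightarrow> G0 p z = dbar_u (fst p) (snd p) z) \<and> (\<forall>z. z \<notin> \<Omega> \<longrightarrow> G0 p z = 0)" ..
  define G where "G j k = G0 (j, k)" for j k
  have G: "G j k \<in> borel_measurable borel" "AE z in lborel. z \<in> \<Omega> \<longrightarrow> G j k z = dbar_u j k z" "\<forall>z. z \<notin> \<Omega> \<longrightarrow> G j k z = 0" for j k
    using spec[OF G', of "(j, k)"] unfolding G_def by simp_all
  obtain V' where V': "V' \<in> borel_measurable borel" "AE z in lborel. z \<in> \<Omega> \<longrightarrow> V' z = V z" "\<forall>z. z \<notin> \<Omega> \<longrightarrow> V' z = 0"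
    using borel_version_real[OF _ \<Omega>, of V] assms(8) by (auto simp: Lp_loc_def)
  (* the added 1 makes the potential at least 1 everywhere, off the domain as well *)
  define W where "W z = \<bar>V' z\<bar> + 1" for z
  have [measurable]: "W \<in> borel_measurable borel" using V'(1) unfolding W_def[abs_def] by measurable
  have Un: "AE z in lborel. z \<in> \<Omega> \<longrightarrow> cmod (U k z) = norm (u z $ k)" for k
    using U(2)[of k] by eventually_elim auto
  have Ucomp: "AE z in lborel. z \<in> \<Omega> \<longrightarrow> (\<forall>k. U k z = u z $ k)"
    using AE_finite_allI[of UNIV, OF finite U(2)] by eventually_elim auto
  have power4_le: "x ^ 4 \<le> 1 + x powr (4 + \<epsilon>)" if "0 \<le> x" for x :: real
  proof (cases "x \<le> 1")
    case True
    then have "x ^ 4 \<le> 1" using that by (simp add: power_le_one)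
    then show ?thesis by (simp add: add_increasing2)
  next
    case False
    then have "x powr 4 \<le> x powr (4 + \<epsilon>)" using assms(4) by (intro powr_mono) auto
    then show ?thesis using False by (simp add: powr_numeral)
  qed
  interpret dbar_system \<Omega> U G W
  proof
    show "U k \<in> borel_measurable borel" "G j k \<in> borel_measurable borel" for j k using U(1) G(1) .
    show "W \<in> borel_measurable borel" by measurable
    show "1 \<le> W z" for z by (simp add: W_def)
    fix K :: "(complex ^ 2) set" assume K: "compact K" "K \<subseteq> \<Omega>"
    have [measurable]: "K \<in> sets borel" using K(1) by (rule borel_compact)
    have eK: "emeasure lborel K < \<infinity>" using emeasure_bounded_finite[OF compact_imp_bounded[OF K(1)]] .
    show "(NLINT z. indicator K z * ennreal (cmod (U k z) ^ 4)) < \<infinity>" for k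
    proof -
      note [measurable] = U(1)
      have f: "(NLINT z. indicator K z * ennreal (cmod (U k z) powr (4 + \<epsilon>))) < \<infinity>"
        using assms(5)[of k] by (intro Lp_loc_nn_integral[OF _ K Un]) (simp add: W1p_loc_def)
      have "(NLINT z. indicator K z * ennreal (cmod (U k z) ^ 4))
        \<le> (NLINT z. indicator K z + indicator K z * ennreal (cmod (U k z) powr (4 + \<epsilon>)))"
      proof (rule nn_integral_mono)
        fix z
        have "ennreal (cmod (U k z) ^ 4) \<le> ennreal (1 + cmod (U k z) powr (4 + \<epsilon>))" by (intro ennreal_leI power4_le) simp
        also have "\<dots> = 1 + ennreal (cmod (U k z) powr (4 + \<epsilon>))" by (subst ennreal_plus) auto
        finally show "indicator K z * ennreal (cmod (U k z) ^ 4) \<le> indicator K z + indicator K z * ennreal (cmod (U k z) powr (4 + \<epsilon>))"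
          by (auto split: split_indicator)
      qed
      also have "\<dots> = emeasure lborel K + (NLINT z. indicator K z * ennreal (cmod (U k z) powr (4 + \<epsilon>)))"
        by (subst nn_integral_add) simp_all
      finally show ?thesis using f eK by (simp add: order_le_less_trans)
    qed
    show "(NLINT z. indicator K z * ennreal (W z ^ 4)) < \<infinity>"
    proof -
      note [measurable] = V'(1)
      have f: "(NLINT z. indicator K z * ennreal (\<bar>V' z\<bar> powr 4)) < \<infinity>"
        by (intro Lp_loc_nn_integral[OF assms(8) K]) (use V'(2) in eventually_elim, auto)
      have "(NLINT z. indicator K z * ennreal (W z ^ 4))
        \<le> (NLINT z. ennreal 16 * indicator K z + ennreal 16 * (indicator K z * ennreal (\<bar>V' z\<bar> powr 4)))"
      proof (rule nn_integral_mono)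
        fix z
        have "W z ^ 4 \<le> (2 * max \<bar>V' z\<bar> 1) ^ 4" unfolding W_def by (intro power_mono) auto
        also have "\<dots> \<le> 16 + 16 * \<bar>V' z\<bar> powr 4" by (auto simp: max_def power_mult_distrib powr_numeral)
        finally have "ennreal (W z ^ 4) \<le> ennreal (16 + 16 * \<bar>V' z\<bar> powr 4)" by (rule ennreal_leI)
        also have "\<dots> = ennreal 16 + ennreal 16 * ennreal (\<bar>V' z\<bar> powr 4)"
          by (subst ennreal_plus, simp, simp, subst ennreal_mult) auto
        finally show "indicator K z * ennreal (W z ^ 4) \<le> ennreal 16 * indicator K z + ennreal 16 * (indicator K z * ennreal (\<bar>V' z\<bar> powr 4))"
          by (auto split: split_indicator)
      qed
      also have "\<dots> = ennreal 16 * emeasure lborel K + ennreal 16 * (NLINT z. indicator K z * ennreal (\<bar>V' z\<bar> powr 4))"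
        by (subst nn_integral_add) (simp_all add: nn_integral_cmult del: ennreal_numeral)
      also have "\<dots> < \<infinity>" using f eK by (simp add: ennreal_mult_less_top del: ennreal_numeral)
      finally show ?thesis .
    qed
    show "integrable lborel (\<lambda>z. indicator K z *\<^sub>R G j k z)" for j k
    proof (rule integrableI_bounded)
      note [measurable] = G(1)
      show "(\<lambda>z. indicator K z *\<^sub>R G j k z) \<in> borel_measurable lborel" by measurable
      have n: "AE z in lborel. z \<in> \<Omega> \<longrightarrow> cmod (G j k z) = norm (dbar_u j k z)"
        using G(2)[of j k] by eventually_elim auto
      have L: "Lp_loc 1 \<Omega> (dbar_u j k)" using assms(6) by (simp add: has_weak_dbar_def)
      have "(NLINT z. ennreal (norm (indicator K z *\<^sub>R G j k z))) = (NLINT z. indicator K z * ennreal (cmod (G j k z) powr 1))"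
        by (intro nn_integral_cong) (auto split: split_indicator)
      also have "\<dots> < \<infinity>" by (rule Lp_loc_nn_integral[OF L K n])
      finally show "(NLINT z. ennreal (norm (indicator K z *\<^sub>R G j k z))) < \<infinity>" .
    qed
  next
    have Gc: "AE z in lborel. \<forall>k. \<forall>j. z \<in> \<Omega> \<longrightarrow> G j k z = dbar_u j k z"
      unfolding AE_all_countable using G(2) by blast
    have a9: "AE z in lborel. z \<in> \<Omega> \<longrightarrow> sqrt (\<Sum>j\<in>UNIV. \<Sum>k\<in>UNIV. (cmod (dbar_u j k z))\<^sup>2) \<le> V z * norm (u z)"
      using assms(9) by (simp add: AE_lebesgue_on_iff[OF \<Omega>])
    show "AE z in lborel. z \<in> \<Omega> \<longrightarrow> (\<forall>j k. cmod (G j k z) \<le> W z * (\<Sum>l\<in>UNIV. cmod (U l z)))"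
      using Gc a9 V'(2) Ucomp
    proof eventually_elim
      case (elim z)
      show ?case
      proof (intro impI allI)
        fix j k assume z: "z \<in> \<Omega>"
        have "(cmod (dbar_u j k z))\<^sup>2 \<le> (\<Sum>k\<in>UNIV. (cmod (dbar_u j k z))\<^sup>2)" by (rule member_le_sum) auto
        also have "\<dots> \<le> (\<Sum>j\<in>UNIV. \<Sum>k\<in>UNIV. (cmod (dbar_u j k z))\<^sup>2)"
          by (rule member_le_sum) (auto intro: sum_nonneg)
        finally have "cmod (dbar_u j k z) \<le> sqrt (\<Sum>j\<in>UNIV. \<Sum>k\<in>UNIV. (cmod (dbar_u j k z))\<^sup>2)" by (rule real_le_rsqrt)
        also have "\<dots> \<le> V z * norm (u z)" using elim(2) z by blast
        also have "\<dots> \<le> W z * (\<Sum>l\<in>UNIV. cmod (u z $ l))"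
          using elim(3) z assms(7)[OF z] by (intro mult_mono norm_le_sum_components) (auto simp: W_def)
        finally show "cmod (G j k z) \<le> W z * (\<Sum>l\<in>UNIV. cmod (U l z))" using elim(1,4) z by simp
      qed
    qed
    fix j k and \<phi> :: "complex ^ 2 \<Rightarrow> complex" assume \<phi>: "test_function \<Omega> \<phi>"
    then have s: "smooth \<phi>" by (simp add: test_function_def smooth_def)
    then have m: "\<phi> \<in> borel_measurable borel" "dbar j \<phi> \<in> borel_measurable borel"
      by (auto intro!: borel_measurable_continuous_onI smooth_imp_continuous smooth_dbar)
    have "(LINT z:\<Omega>|lebesgue. u z $ k * dbar j \<phi> z) = - (LINT z:\<Omega>|lebesgue. dbar_u j k z * \<phi> z)"
      using assms(6)[of j k] \<phi> unfolding has_weak_dbar_def by blast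
    then show "(LBINT z. U k z * dbar j \<phi> z) = - (LBINT z. G j k z * \<phi> z)"
      using set_integral_borel_version[OF um \<Omega> U m(2)] set_integral_borel_version[OF gm \<Omega> G m(1)]
      by simp
  qed
  have decay: "decays_fast (U k) z0" for k
    unfolding decays_fast_def
  proof
    fix m :: nat
    (* the exponent is raised by one because the hypothesis concerns positive exponents only *)
    have L1: "Lp_loc 1 \<Omega> u" and lim: "((\<lambda>r. (LINT z:ball z0 r|lebesgue. norm (u z) powr 1) / r ^ Suc m) \<longlongrightarrow> 0) (at_right 0)"
      using assms(11) unfolding vanishes_to_infinite_order_def by (auto simp del: power_Suc)
    obtain R where R: "0 < R" "cball z0 R \<subseteq> \<Omega>" using assms(1,10) open_contains_cball by blast
    have "\<forall>\<^sub>F r in at_right 0. (LINT z:ball z0 r|lebesgue. norm (u z) powr 1) / r ^ Suc m < 1"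
      by (rule order_tendstoD(2)[OF lim]) simp
    then obtain b where b: "b > 0" "\<And>r. 0 < r \<Longrightarrow> r < b \<Longrightarrow> (LINT z:ball z0 r|lebesgue. norm (u z) powr 1) / r ^ Suc m < 1"
      unfolding eventually_at_right_field by auto
    define \<rho> where "\<rho> = min (min b R) 1"
    have "(NLINT z. indicator (ball z0 r) z * ennreal (cmod (U k z))) \<le> ennreal (r ^ m)" if r: "0 < r \<and> r < \<rho>" for r
    proof -
      have rb: "r < b" "r < R" "r < 1" using r by (auto simp: \<rho>_def)
      have sub: "ball z0 r \<subseteq> cball z0 R" using rb by auto
      have "set_integrable lebesgue (cball z0 R) (\<lambda>z. norm (u z) powr 1)" using L1 R(2) by (simp add: Lp_loc_def)
      then have si: "set_integrable lebesgue (ball z0 r) (\<lambda>z. norm (u z) powr 1)"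
        by (rule set_integrable_subset) (use sub in auto)
      have "(NLINT z. indicator (ball z0 r) z * ennreal (cmod (U k z))) = (\<integral>\<^sup>+z. indicator (ball z0 r) z * ennreal (cmod (U k z)) \<partial>lebesgue)"
        by (rule nn_integral_completion[symmetric])
      also have "\<dots> \<le> (\<integral>\<^sup>+z. ennreal (indicator (ball z0 r) z *\<^sub>R (norm (u z) powr 1)) \<partial>lebesgue)"
      proof (rule nn_integral_mono_AE, rule AE_completion, use U(2)[of k] in eventually_elim)
        case (elim z)
        have "z \<in> \<Omega>" if "z \<in> ball z0 r" using that sub R(2) by blast
        then show ?case using elim Finite_Cartesian_Product.norm_nth_le[of "u z" k] by (auto split: split_indicator intro!: ennreal_leI)
      qed
      also have "\<dots> = ennreal (LINT z:ball z0 r|lebesgue. norm (u z) powr 1)"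
        using si unfolding set_lebesgue_integral_def set_integrable_def by (intro nn_integral_eq_integral) auto
      also have "\<dots> \<le> ennreal (r ^ m)"
      proof (rule ennreal_leI)
        have "(LINT z:ball z0 r|lebesgue. norm (u z) powr 1) \<le> r ^ Suc m"
          using b(2)[of r] r rb by (simp add: divide_less_eq del: power_Suc)
        also have "\<dots> \<le> r ^ m" using r rb by (intro power_decreasing) auto
        finally show "(LINT z:ball z0 r|lebesgue. norm (u z) powr 1) \<le> r ^ m" .
      qed
      finally show ?thesis .
    qed
    moreover have "0 < \<rho>" using b R by (simp add: \<rho>_def)
    ultimately show "\<exists>\<rho>>0. \<forall>r. 0 < r \<and> r < \<rho> \<longrightarrow> (NLINT z. indicator (ball z0 r) z * ennreal (cmod (U k z))) \<le> ennreal (r ^ m)" by blast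
  qed
  have "AE z in lborel. z \<in> \<Omega> \<longrightarrow> (\<forall>k. U k z = 0)"
    by (rule unique_continuation[OF assms(1,2,10) decay])
  with Ucomp have "AE z in lborel. z \<in> \<Omega> \<longrightarrow> u z = 0"
    by eventually_elim (auto simp: vec_eq_iff)
  then show ?thesis by (simp add: AE_lebesgue_on_iff[OF \<Omega>])
qed

end
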